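(* Let $a,b,\sigma,r_0>0$ be constants and let $r=\{r_t,t\ge0\}$ be the Cox--Ingersoll--Ross process, i.e. the unique solution of $dr_t=(a-br_t)\,dt+\sigma\sqrt{r_t}\,dW_t$ with initial value $r_0$. Then $$\frac1T\int_0^T r_t^2\,dt\to\frac{a^2}{b^2}+\frac{a\sigma^2}{2b^2}\quad\text{almost surely, as }T\to\infty.$$
   Context: $W=\{W_t,t\ge0\}$ is a standard Wiener process on a probability space $(\Omega,\mathcal F,\mathbf P)$. The Cox--Ingersoll--Ross process $r$ with parameters $a,b,\sigma>0$ and initial value $r_0>0$ is the unique strong solution (which is nonnegative) of $dr_t=(a-br_t)\,dt+\sigma\sqrt{r_t}\,dW_t$, $r_t|_{t=0}=r_0$. No relation between $2a$ and $\sigma^2$ is assumed. *)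

theory Defs
  imports "HOL-Probability.Probability"
begin

text \<open>
  Processes are indexed by \<open>real\<close>; only times \<open>t \<ge> 0\<close> are constrained. The libraries contain
  neither Wiener processes nor stochastic integrals, so both are developed here. Path properties
  are required almost surely only.
\<close>

locale standard_wiener_process = prob_space M for M :: "'a measure" +
  fixes W :: "real \<Rightarrow> 'a \<Rightarrow> real"
  assumes measurable_W: "\<And>t. 0 \<le> t \<Longrightarrow> W t \<in> borel_measurable M"
    and W_0: "AE \<omega> in M. W 0 \<omega> = 0"
    and indep_increments:
      "\<And>(n::nat) (s :: nat \<Rightarrow> real). 0 \<le> s 0 \<Longrightarrow> (\<And>i. i < n \<Longrightarrow> s i < s (Suc i)) \<Longrightarrow>
        indep_vars (\<lambda>_. borel) (\<lambda>i \<omega>. W (s (Suc i)) \<omega> - W (s i) \<omega>) {..<n}"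
    and normal_increments:
      "\<And>s t. 0 \<le> s \<Longrightarrow> s < t \<Longrightarrow>
        distributed M lborel (\<lambda>\<omega>. W t \<omega> - W s \<omega>) (normal_density 0 (sqrt (t - s)))"
    and continuous_paths: "AE \<omega> in M. continuous_on {0..} (\<lambda>t. W t \<omega>)"

definition augmented_filtration :: "'a measure \<Rightarrow> (real \<Rightarrow> 'a \<Rightarrow> real) \<Rightarrow> real \<Rightarrow> 'a measure" where
  "augmented_filtration M W t =
    sigma (space M)
      ({W s -` B \<inter> space M | s B. 0 \<le> s \<and> s \<le> t \<and> B \<in> sets borel} \<union> null_sets M)"

lemma filtration_augmented_filtration: "filtration (space M) (augmented_filtration M W)"
proof
  have sub: "{W s -` B \<inter> space M | s B. 0 \<le> s \<and> s \<le> t \<and> B \<in> sets borel} \<union> null_sets M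
      \<subseteq> Pow (space M)" for t
    using sets.sets_into_space[of _ M] by (auto simp: null_sets_def)
  show "space (augmented_filtration M W t) = space M" for t
    unfolding augmented_filtration_def using sub by (rule space_measure_of)
  show "sets (augmented_filtration M W s) \<subseteq> sets (augmented_filtration M W t)" if "s \<le> t" for s t
    unfolding augmented_filtration_def sets_measure_of[OF sub] using that
    by (intro sigma_sets_mono') fastforce
qed

definition adapted :: "(real \<Rightarrow> 'a measure) \<Rightarrow> (real \<Rightarrow> 'a \<Rightarrow> real) \<Rightarrow> bool" where
  "adapted F X \<longleftrightarrow> (\<forall>t\<ge>0. X t \<in> borel_measurable (F t))"

text \<open>
  The measurability clauses are needed because \<^const>\<open>measure\<close> is \<open>0\<close> on non-measurable sets.
\<close>

definition tendsto_in_probability ::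
    "'a measure \<Rightarrow> (nat \<Rightarrow> 'a \<Rightarrow> real) \<Rightarrow> ('a \<Rightarrow> real) \<Rightarrow> bool" where
  "tendsto_in_probability M X Y \<longleftrightarrow>
    (\<forall>k. X k \<in> borel_measurable M) \<and> Y \<in> borel_measurable M \<and>
    (\<forall>\<epsilon>>0. (\<lambda>k. measure M {\<omega> \<in> space M. \<epsilon> < \<bar>X k \<omega> - Y \<omega>\<bar>}) \<longlonglongrightarrow> 0)"

text \<open>
  The data \<open>n, s, \<xi>\<close> represent the simple process equal to \<open>\<xi> i\<close> on \<open>(s i, s (i + 1)]\<close> for \<open>i < n\<close>
  and to \<open>0\<close> elsewhere.
\<close>

definition simple_process ::
    "(real \<Rightarrow> 'a measure) \<Rightarrow> nat \<Rightarrow> (nat \<Rightarrow> real) \<Rightarrow> (nat \<Rightarrow> 'a \<Rightarrow> real) \<Rightarrow> bool" where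
  "simple_process F n s \<xi> \<longleftrightarrow>
    0 \<le> s 0 \<and> (\<forall>i<n. s i < s (Suc i)) \<and>
    (\<forall>i<n. \<xi> i \<in> borel_measurable (F (s i)) \<and> (\<exists>C. \<forall>\<omega>\<in>space (F (s i)). \<bar>\<xi> i \<omega>\<bar> \<le> C))"

definition simple_value ::
    "nat \<Rightarrow> (nat \<Rightarrow> real) \<Rightarrow> (nat \<Rightarrow> 'a \<Rightarrow> real) \<Rightarrow> real \<Rightarrow> 'a \<Rightarrow> real" where
  "simple_value n s \<xi> t \<omega> = (\<Sum>i<n. \<xi> i \<omega> * indicator {s i<..s (Suc i)} t)"

definition simple_integral_process ::
    "(real \<Rightarrow> 'a \<Rightarrow> real) \<Rightarrow> nat \<Rightarrow> (nat \<Rightarrow> real) \<Rightarrow> (nat \<Rightarrow> 'a \<Rightarrow> real) \<Rightarrow> real \<Rightarrow> 'a \<Rightarrow> real" where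
  "simple_integral_process W n s \<xi> t \<omega> =
    (\<Sum>i<n. \<xi> i \<omega> * (W (min t (s (Suc i))) \<omega> - W (min t (s i)) \<omega>))"

text \<open>
  \<open>is_ito_integral M F W H I\<close>: the process \<open>I\<close> is (a continuous version of) the Ito integral process
  of \<open>H\<close> with respect to \<open>W\<close>. The integrand is adapted and almost surely locally square integrable,
  and for each \<open>t\<close> the variable \<open>I t\<close> is the limit in probability of the integrals of simple processes
  that approximate \<open>H\<close> in \<open>L\<^sup>2[0,t]\<close> in probability. This determines \<open>I\<close> up to
  indistinguishability, so it is stated as a relation.
\<close>

definition is_ito_integral ::
    "'a measure \<Rightarrow> (real \<Rightarrow> 'a measure) \<Rightarrow> (real \<Rightarrow> 'a \<Rightarrow> real) \<Rightarrow> (real \<Rightarrow> 'a \<Rightarrow> real) \<Rightarrow>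
      (real \<Rightarrow> 'a \<Rightarrow> real) \<Rightarrow> bool" where
  "is_ito_integral M F W H I \<longleftrightarrow>
    adapted F H \<and>
    (AE \<omega> in M. \<forall>t\<ge>0. set_borel_measurable lborel {0..t} (\<lambda>u. H u \<omega>) \<and>
                        set_integrable lborel {0..t} (\<lambda>u. (H u \<omega>)\<^sup>2)) \<and>
    (AE \<omega> in M. continuous_on {0..} (\<lambda>t. I t \<omega>)) \<and>
    (\<forall>t\<ge>0. \<exists>n s \<xi>.
      (\<forall>k::nat. simple_process F (n k) (s k) (\<xi> k)) \<and>
      tendsto_in_probability M
        (\<lambda>k \<omega>. LBINT u:{0..t}. (simple_value (n k) (s k) (\<xi> k) u \<omega> - H u \<omega>)\<^sup>2) (\<lambda>_. 0) \<and>
      tendsto_in_probability M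
        (\<lambda>k. simple_integral_process W (n k) (s k) (\<xi> k) t) (I t))"

text \<open>Strong solutions of \<open>dX = \<mu>(X) dt + v(X) dW\<close>, \<open>X 0 = x0\<close>.\<close>

definition strong_solution ::
    "'a measure \<Rightarrow> (real \<Rightarrow> 'a \<Rightarrow> real) \<Rightarrow> (real \<Rightarrow> real) \<Rightarrow> (real \<Rightarrow> real) \<Rightarrow> real \<Rightarrow>
      (real \<Rightarrow> 'a \<Rightarrow> real) \<Rightarrow> bool" where
  "strong_solution M W \<mu> v x0 X \<longleftrightarrow>
    adapted (augmented_filtration M W) X \<and>
    (AE \<omega> in M. continuous_on {0..} (\<lambda>t. X t \<omega>)) \<and>
    (AE \<omega> in M. X 0 \<omega> = x0) \<and>
    (AE \<omega> in M. \<forall>t\<ge>0. set_integrable lborel {0..t} (\<lambda>u. \<mu> (X u \<omega>))) \<and>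
    (\<exists>I. is_ito_integral M (augmented_filtration M W) W (\<lambda>u \<omega>. v (X u \<omega>)) I \<and>
      (AE \<omega> in M. \<forall>t\<ge>0. X t \<omega> = x0 + (LBINT u:{0..t}. \<mu> (X u \<omega>)) + I t \<omega>))"

text \<open>
  Nonnegativity is part of the definition because the diffusion coefficient only makes sense on
  \<open>[0,\<infinity>)\<close>, whereas \<^const>\<open>sqrt\<close> is total, with \<open>sqrt (- x) = - sqrt x\<close>.
\<close>

definition cir_process ::
    "'a measure \<Rightarrow> (real \<Rightarrow> 'a \<Rightarrow> real) \<Rightarrow> real \<Rightarrow> real \<Rightarrow> real \<Rightarrow> real \<Rightarrow> (real \<Rightarrow> 'a \<Rightarrow> real) \<Rightarrow> bool" where
  "cir_process M W a b \<sigma> r0 r \<longleftrightarrow>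
    strong_solution M W (\<lambda>x. a - b * x) (\<lambda>x. \<sigma> * sqrt x) r0 r \<and>
    (AE \<omega> in M. \<forall>t\<ge>0. 0 \<le> r t \<omega>)"

end

theory Submission
  imports Defs
begin

text \<open>
  The polynomial \<open>psi x = x\<^sup>2 / (2 b) + (2 a + \<sigma>\<^sup>2) x / (2 b\<^sup>2)\<close> solves the Poisson equation
  \<open>L psi = c - x\<^sup>2\<close>, where \<open>L\<close> is the generator and \<open>c\<close> the claimed limit. Hence
  \<open>psi (r t) - psi (r 0) - c t + \<integral>\<^sub>0\<^sup>t r\<^sup>2\<close> is a martingale. Since \<open>sup\<^sub>n E (r n)\<^sup>4\<close> is finite, its unit
  increments are orthogonal and bounded in \<open>L\<^sup>2\<close>; so it is \<open>o(t)\<close> almost surely along the squares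
  \<open>t = k\<^sup>2\<close>, and monotonicity of \<open>\<integral>\<^sub>0\<^sup>t r\<^sup>2\<close> fills the gaps.

  Dynkin's formula is first shown for decaying exponentials, which need no moments: the Ito integral
  is approximated uniformly on a fine grid by Euler sums (a discrete Lenglart inequality transfers
  the defining convergence in probability), and the Taylor expansion of an Euler step only uses the
  moments of a Gaussian increment independent of the past. It passes to polynomials through
  \<open>((1 - exp (- l x)) / l) ^ p\<close> as \<open>l \<rightarrow> 0\<close>, with the fourth moment controlled along the way
  by the negative drift of \<open>L x\<^sup>4\<close>.
\<close>

section \<open>Independence of increments\<close>

text \<open>\<open>is_ito_integral\<close> is pointwise in time: every \<open>t\<close> has its own
  approximating simple processes, which converge in probability only. All uniform control in time
  has to be recovered from that, and the Lenglart inequality is the tool because it asks for no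
  moments, none being known for \<open>X\<close> at that stage. The Euler sums take their
  coefficients from \<open>X\<close> at the grid points instead of from the scheme itself, so
  continuity of the paths suffices for convergence and the square root needs no Lipschitz bound at
  0. Exponentials are the right test functions because their first two derivatives, multiplied by
  the linearly growing drift and squared volatility, stay bounded on [0,\<infinity>). The martingale
  property is always expressed as orthogonality to bounded \<open>F s\<close>-measurable variables,
  so conditional expectations never occur. The fourth moment is the natural one: \<open>psi\<close>
  and the time integrand are quadratic, and their squares must be integrable with bounds independent
  of time.\<close>

lemma strict_mono_grid:
  fixes q :: "nat \<Rightarrow> real"
  assumes "\<And>i. i < N \<Longrightarrow> q i < q (Suc i)" "i < j" "j \<le> N"
  shows "q i < q j"
  using assms(2,3)
proof (induction j)
  case (Suc j)
  then show ?case
    using assms(1)[of j] by (cases "i = j") auto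
qed simp

lemma mono_grid:
  fixes q :: "nat \<Rightarrow> real"
  assumes "\<And>i. i < N \<Longrightarrow> q i < q (Suc i)" "i \<le> j" "j \<le> N"
  shows "q i \<le> q j"
  using strict_mono_grid[of N q i j] assms by (cases "i = j") auto

text \<open>Puts an arbitrary finite set of times into the indexed increasing form in which
  \<open>indep_increments\<close> and simple processes are stated; the end points \<open>s\<close>
  and \<open>t\<close> become the first and last nodes.\<close>

lemma finite_set_grid:
  fixes A :: "real set"
  assumes "finite A" "s \<in> A" "t \<in> A" "A \<subseteq> {s..t}"
  obtains q :: "nat \<Rightarrow> real" and N where
    "\<And>i. i < N \<Longrightarrow> q i < q (Suc i)" "q 0 = s" "q N = t" "A = q ` {..N}"
proof -
  define L where "L = sorted_list_of_set A"
  define N where "N = length L - 1"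
  have L: "set L = A" "distinct L" "sorted L" "sorted_wrt (<) L"
    using assms(1) by (simp_all add: L_def)
  have ne: "L \<noteq> []" using L(1) assms(2) by auto
  then have N: "length L = Suc N" by (simp add: N_def)
  have 1: "L ! i < L ! Suc i" if "i < N" for i
    using L(4) that N by (simp add: sorted_wrt_iff_nth_less)
  have img: "A = (!) L ` {..N}"
    using L(1) N by (auto simp: set_conv_nth less_Suc_eq_le)
  then obtain i j where ij: "i \<le> N" "s = L ! i" "j \<le> N" "t = L ! j"
    using assms(2,3) by auto
  have "L ! 0 = s"
    using mono_grid[of N "(!) L" 0 i] 1 ij assms(4) img by force
  moreover have "L ! N = t"
    using mono_grid[of N "(!) L" j N] 1 ij assms(4) img by force
  ultimately show ?thesis using that[of N "(!) L"] 1 img by auto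
qed

lemma (in prob_space) indep_set_mono:
  assumes "indep_set A B" "A' \<subseteq> A" "B' \<subseteq> B"
  shows "indep_set A' B'"
  using assms(1) unfolding indep_set_def
  by (rule indep_sets_mono_sets) (use assms(2,3) in \<open>auto split: bool.split\<close>)

context standard_wiener_process
begin

abbreviation F :: "real \<Rightarrow> 'a measure" where
  "F \<equiv> augmented_filtration M W"

lemma space_F [simp]: "space (F t) = space M"
  using filtration_augmented_filtration[of M W] by (simp add: filtration_def)

lemma sets_F_mono: "s \<le> t \<Longrightarrow> sets (F s) \<subseteq> sets (F t)"
  using filtration_augmented_filtration[of M W] by (simp add: filtration_def)

lemma generators_F_Pow:
  "{W s -` B \<inter> space M | s B. 0 \<le> s \<and> s \<le> t \<and> B \<in> sets borel} \<union> null_sets M \<subseteq> Pow (space M)"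
  using sets.sets_into_space[of _ M] by (auto simp: null_sets_def)

lemma sets_F:
  "sets (F t) = sigma_sets (space M)
     ({W s -` B \<inter> space M | s B. 0 \<le> s \<and> s \<le> t \<and> B \<in> sets borel} \<union> null_sets M)"
  unfolding augmented_filtration_def by (rule sets_measure_of[OF generators_F_Pow])

lemma sets_F_subset: "sets (F t) \<subseteq> sets M"
  unfolding sets_F
  by (rule sets.sigma_sets_subset) (use measurable_W in \<open>auto intro: measurable_sets\<close>)

lemma measurable_F_M: "f \<in> borel_measurable (F t) \<Longrightarrow> f \<in> borel_measurable M"
  using sets_F_subset[of t] by (auto simp: measurable_def)

lemma measurable_F_mono: "f \<in> borel_measurable (F s) \<Longrightarrow> s \<le> t \<Longrightarrow> f \<in> borel_measurable (F t)"
  using sets_F_mono[of s t] by (auto simp: measurable_def)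

lemma null_sets_F: "N \<in> null_sets M \<Longrightarrow> N \<in> sets (F t)"
  unfolding sets_F by (intro sigma_sets.Basic) blast

lemma measurable_F_W: "0 \<le> s \<Longrightarrow> s \<le> t \<Longrightarrow> W s \<in> borel_measurable (F t)"
proof (rule measurableI)
  fix B :: "real set" assume "0 \<le> s" "s \<le> t" "B \<in> sets borel"
  then show "W s -` B \<inter> space (F t) \<in> sets (F t)"
    unfolding sets_F space_F by (intro sigma_sets.Basic) blast
qed simp

lemma sets_cylinder:
  assumes "finite T" "T \<subseteq> {0..s}" "\<And>u. u \<in> T \<Longrightarrow> B u \<in> sets borel"
  shows "{\<omega>\<in>space M. \<forall>u\<in>T. W u \<omega> \<in> B u} \<in> sets M"
proof (intro sets.sets_Collect_finite_All assms(1))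
  fix u assume "u \<in> T"
  then show "{\<omega> \<in> space M. W u \<omega> \<in> B u} \<in> sets M"
    using assms(2,3) by (intro measurable_sets_Collect[OF measurable_W]) auto
qed

text \<open>A finite-dimensional cylinder set up to time \<open>s\<close> is, up to a null set, an event in the
  increments over a partition of \<open>[0,s]\<close>, because \<open>W 0 = 0\<close> almost surely.\<close>

lemma indep_cylinder_increment:
  assumes "finite T" "T \<subseteq> {0..s}" "0 \<le> s" "s < t" and B: "\<And>u. u \<in> T \<Longrightarrow> B u \<in> sets borel"
    and D: "D \<in> sets borel"
  shows "prob ({\<omega>\<in>space M. \<forall>u\<in>T. W u \<omega> \<in> B u} \<inter> ((\<lambda>\<omega>. W t \<omega> - W s \<omega>) -` D \<inter> space M)) =
    prob {\<omega>\<in>space M. \<forall>u\<in>T. W u \<omega> \<in> B u} * prob ((\<lambda>\<omega>. W t \<omega> - W s \<omega>) -` D \<inter> space M)"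
proof -
  obtain q :: "nat \<Rightarrow> real" and N where q: "\<And>i. i < N \<Longrightarrow> q i < q (Suc i)" "q 0 = 0" "q N = s"
      "insert 0 (insert s T) = q ` {..N}"
  proof (rule finite_set_grid[of "insert 0 (insert s T)" 0 s])
    show "insert 0 (insert s T) \<subseteq> {0..s}" using assms by auto
    fix q N assume "\<And>i. i < N \<Longrightarrow> q i < q (Suc i)" "q 0 = 0" "q N = s"
      "insert 0 (insert s T) = q ` {..N}"
    then show thesis by (rule that)
  qed (use assms(1) in simp_all)
  \<comment> \<open>Appending \<open>t\<close> makes \<open>W t - W s\<close> the last increment
    \<open>Z N\<close>, so one use of \<open>indep_increments\<close> separates it from all
    increments up to \<open>s\<close>.\<close>
  define p where "p = q (Suc N := t)"
  have p: "p i < p (Suc i)" if "i < Suc N" for i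
    using q that assms(4) by (auto simp: p_def less_Suc_eq)
  define Z where "Z = (\<lambda>i \<omega>. W (p (Suc i)) \<omega> - W (p i) \<omega>)"
  have "indep_vars (\<lambda>_. borel) Z {..<Suc N}"
    unfolding Z_def by (rule indep_increments) (use p q in \<open>auto simp: p_def\<close>)
  from indep_var_restrict[OF this, of "{..<N}" "{N}"]
  have ind: "indep_var (PiM {..<N} (\<lambda>_. borel)) (\<lambda>\<omega>. restrict (\<lambda>i. Z i \<omega>) {..<N})
      (PiM {N} (\<lambda>_. borel)) (\<lambda>\<omega>. restrict (\<lambda>i. Z i \<omega>) {N})"
    by auto
  have ex: "\<forall>u\<in>T. \<exists>i\<le>N. u = q i" using q(4) by blast
  then obtain k where k: "\<And>u. u \<in> T \<Longrightarrow> k u \<le> N \<and> u = q (k u)" by metis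
  define A where "A = {x \<in> space (PiM {..<N} (\<lambda>_. borel)). \<forall>u\<in>T. (\<Sum>j<k u. x j) \<in> B u}"
  define E where "E = {x \<in> space (PiM {N} (\<lambda>_. borel)). x N \<in> D}"
  have A: "A \<in> sets (PiM {..<N} (\<lambda>_. borel))"
  proof -
    have "{x \<in> space (PiM {..<N} (\<lambda>_. borel::real measure)). (\<Sum>j<k u. x j) \<in> B u} \<in> sets (PiM {..<N} (\<lambda>_. borel))"
      if "u \<in> T" for u
    proof -
      have "(\<lambda>x. \<Sum>j<k u. x j) \<in> borel_measurable (PiM {..<N} (\<lambda>_. borel::real measure))"
        using k[OF that] by (intro borel_measurable_sum measurable_component_singleton) auto
      from measurable_sets[OF this B[OF that]] show ?thesis
        by (simp add: vimage_def Int_def conj_commute)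
    qed
    then show ?thesis
      unfolding A_def using \<open>finite T\<close> by (intro sets.sets_Collect_finite_All) auto
  qed
  have E: "E \<in> sets (PiM {N} (\<lambda>_. borel))"
    unfolding E_def using D by measurable
  have W_sum: "AE \<omega> in M. \<forall>i\<le>N. W (q i) \<omega> = (\<Sum>j<i. Z j \<omega>)"
    using W_0
  proof eventually_elim
    case (elim \<omega>)
    show ?case
    proof safe
      fix i assume "i \<le> N"
      then show "W (q i) \<omega> = (\<Sum>j<i. Z j \<omega>)"
        by (induction i) (auto simp: q(2) elim Z_def p_def)
    qed
  qed
  have cyl: "{\<omega>\<in>space M. \<forall>u\<in>T. W u \<omega> \<in> B u} \<in> sets M"
    using assms(1,2) B by (rule sets_cylinder)
  have Zr: "(\<lambda>\<omega>. restrict (\<lambda>i. Z i \<omega>) {..<N}) \<in> measurable M (PiM {..<N} (\<lambda>_. borel))"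
    "(\<lambda>\<omega>. restrict (\<lambda>i. Z i \<omega>) {N}) \<in> measurable M (PiM {N} (\<lambda>_. borel))"
    using indep_var_rv1[OF ind] indep_var_rv2[OF ind] by auto
  have eqE: "(\<lambda>\<omega>. restrict (\<lambda>i. Z i \<omega>) {N}) -` E \<inter> space M = (\<lambda>\<omega>. W t \<omega> - W s \<omega>) -` D \<inter> space M"
    by (auto simp: E_def space_PiM Z_def p_def q(3))
  have eqA: "AE \<omega> in M. \<omega> \<in> {\<omega>\<in>space M. \<forall>u\<in>T. W u \<omega> \<in> B u} \<longleftrightarrow>
      \<omega> \<in> (\<lambda>\<omega>. restrict (\<lambda>i. Z i \<omega>) {..<N}) -` A \<inter> space M"
    using W_sum
  proof eventually_elim
    case (elim \<omega>)
    have "(\<Sum>j<k u. restrict (\<lambda>i. Z i \<omega>) {..<N} j) = W u \<omega>" if "u \<in> T" for u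
    proof -
      have "(\<Sum>j<k u. restrict (\<lambda>i. Z i \<omega>) {..<N} j) = (\<Sum>j<k u. Z j \<omega>)"
        using k[OF that] by (intro sum.cong) auto
      then show ?thesis using elim k[OF that] by metis
    qed
    then show ?case by (auto simp: A_def space_PiM)
  qed
  have "prob ({\<omega>\<in>space M. \<forall>u\<in>T. W u \<omega> \<in> B u} \<inter> ((\<lambda>\<omega>. W t \<omega> - W s \<omega>) -` D \<inter> space M)) =
     prob (((\<lambda>\<omega>. restrict (\<lambda>i. Z i \<omega>) {..<N}) -` A \<inter> space M) \<inter>
       ((\<lambda>\<omega>. restrict (\<lambda>i. Z i \<omega>) {N}) -` E \<inter> space M))"
    unfolding eqE[symmetric]
  proof (rule finite_measure_eq_AE)
    show "AE x in M. (x \<in> {\<omega> \<in> space M. \<forall>u\<in>T. W u \<omega> \<in> B u} \<inter> ((\<lambda>\<omega>. \<lambda>i\<in>{N}. Z i \<omega>) -` E \<inter> space M)) =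
              (x \<in> (\<lambda>\<omega>. \<lambda>i\<in>{..<N}. Z i \<omega>) -` A \<inter> space M \<inter> ((\<lambda>\<omega>. \<lambda>i\<in>{N}. Z i \<omega>) -` E \<inter> space M))"
      using eqA by eventually_elim blast
  qed (use cyl measurable_sets[OF Zr(1) A] measurable_sets[OF Zr(2) E] in simp_all)
  also have "\<dots> = prob ((\<lambda>\<omega>. restrict (\<lambda>i. Z i \<omega>) {..<N}) -` A \<inter> space M) *
       prob ((\<lambda>\<omega>. restrict (\<lambda>i. Z i \<omega>) {N}) -` E \<inter> space M)"
  proof -
    have "((\<lambda>\<omega>. restrict (\<lambda>i. Z i \<omega>) {..<N}) -` A \<inter> space M) \<inter> ((\<lambda>\<omega>. restrict (\<lambda>i. Z i \<omega>) {N}) -` E \<inter> space M)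
      = (\<lambda>\<omega>. (restrict (\<lambda>i. Z i \<omega>) {..<N}, restrict (\<lambda>i. Z i \<omega>) {N})) -` (A \<times> E) \<inter> space M" by blast
    then show ?thesis using indep_varD[OF ind A E] by (simp only:)
  qed
  also have "prob ((\<lambda>\<omega>. restrict (\<lambda>i. Z i \<omega>) {..<N}) -` A \<inter> space M) =
      prob {\<omega>\<in>space M. \<forall>u\<in>T. W u \<omega> \<in> B u}"
    by (rule finite_measure_eq_AE)
      (use eqA cyl measurable_sets[OF Zr(1) A] in \<open>simp_all add: eq_commute\<close>)
  finally show ?thesis unfolding eqE .
qed

text \<open>A pi-system argument. The generators of \<open>F s\<close> are not closed under
  intersection, so they are enlarged to the finite-dimensional cylinders; null sets are adjoined,
  being independent of every event, and the result is intersection stable.\<close>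

lemma indep_set_F_increment:
  assumes "0 \<le> s" "s < t"
  shows "indep_set (sets (F s)) (sigma_sets (space M) {(\<lambda>\<omega>. W t \<omega> - W s \<omega>) -` D \<inter> space M | D. D \<in> sets borel})"
proof -
  define C where "C = {{\<omega>\<in>space M. \<forall>u\<in>T. W u \<omega> \<in> B u} | T B. finite T \<and> T \<subseteq> {0..s} \<and>
    (\<forall>u::real. (B u :: real set) \<in> sets borel)}"
  define G where "G = {(\<lambda>\<omega>. W t \<omega> - W s \<omega>) -` D \<inter> space M | D. D \<in> sets borel}"
  have dW: "(\<lambda>\<omega>. W t \<omega> - W s \<omega>) \<in> borel_measurable M"
    using assms measurable_W by (intro borel_measurable_diff) auto
  have C_sets: "C \<subseteq> sets M"
  proof
    fix A assume "A \<in> C"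
    then obtain T B where A: "A = {\<omega>\<in>space M. \<forall>u\<in>T. W u \<omega> \<in> B u}" "finite T" "T \<subseteq> {0..s}"
        "\<forall>u. B u \<in> sets borel" unfolding C_def by blast
    show "A \<in> sets M" unfolding A(1) by (rule sets_cylinder) (use A in auto)
  qed
  have "indep_set (C \<union> null_sets M) G"
  proof (rule indep_setI)
    show "C \<union> null_sets M \<subseteq> events" using C_sets by auto
    show "G \<subseteq> events" using measurable_sets[OF dW] by (auto simp: G_def)
    fix A E assume "A \<in> C \<union> null_sets M" and E: "E \<in> G"
    then consider "A \<in> C" | "A \<in> null_sets M" by auto
    then show "prob (A \<inter> E) = prob A * prob E"
    proof cases
      case 1
      then obtain T B where A: "A = {\<omega>\<in>space M. \<forall>u\<in>T. W u \<omega> \<in> B u}" "finite T" "T \<subseteq> {0..s}"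
        "\<forall>u. B u \<in> sets borel" unfolding C_def by blast
      from E obtain D where D: "E = (\<lambda>\<omega>. W t \<omega> - W s \<omega>) -` D \<inter> space M" "D \<in> sets borel"
        unfolding G_def by blast
      show ?thesis unfolding A(1) D(1)
        by (rule indep_cylinder_increment) (use A D assms in simp_all)
    next
      case 2
      then have "A \<inter> E \<in> null_sets M" using E \<open>G \<subseteq> events\<close> by (auto intro: null_set_Int2)
      then show ?thesis using 2 by (simp add: measure_def null_setsD1)
    qed
  qed
  moreover have "Int_stable (C \<union> null_sets M)"
  proof (rule Int_stableI)
    fix a b assume ab: "a \<in> C \<union> null_sets M" "b \<in> C \<union> null_sets M"
    show "a \<inter> b \<in> C \<union> null_sets M"
    proof (cases "a \<in> C \<and> b \<in> C")
      case True
      then obtain T B T' B' where *: "a = {\<omega>\<in>space M. \<forall>u\<in>T. W u \<omega> \<in> B u}" "finite T" "T \<subseteq> {0..s}"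
          "\<forall>u. B u \<in> sets borel" "b = {\<omega>\<in>space M. \<forall>u\<in>T'. W u \<omega> \<in> B' u}" "finite T'" "T' \<subseteq> {0..s}"
          "\<forall>u. B' u \<in> sets borel" by (auto simp: C_def)
      \<comment> \<open>Taking the full line outside the index set of each cylinder turns the
        intersection into a single cylinder over \<open>T \<union> T'\<close>.\<close>
      define B'' where "B'' u = (if u \<in> T then B u else UNIV) \<inter> (if u \<in> T' then B' u else UNIV)" for u
      have "a \<inter> b = {\<omega>\<in>space M. \<forall>u\<in>T \<union> T'. W u \<omega> \<in> B'' u}"
        using * by (auto simp: B''_def)
      moreover have "\<forall>u. B'' u \<in> sets borel" using * by (auto simp: B''_def)
      ultimately have "a \<inter> b \<in> C" unfolding C_def using *(2,3,6,7)
        by (intro CollectI exI[of _ "T \<union> T'"] exI[of _ B'']) simp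
      then show ?thesis by simp
    next
      case False
      then have "a \<inter> b \<in> null_sets M" using ab C_sets by (auto intro: null_set_Int1 null_set_Int2)
      then show ?thesis by simp
    qed
  qed
  moreover have "Int_stable G"
  proof (rule Int_stableI)
    fix a b assume "a \<in> G" "b \<in> G"
    then obtain D D' where "D \<in> sets borel" "D' \<in> sets borel" 
      "a = (\<lambda>\<omega>. W t \<omega> - W s \<omega>) -` D \<inter> space M" "b = (\<lambda>\<omega>. W t \<omega> - W s \<omega>) -` D' \<inter> space M"
      by (auto simp: G_def)
    then show "a \<inter> b \<in> G" unfolding G_def by (intro CollectI exI[of _ "D \<inter> D'"]) auto
  qed
  ultimately have ind: "indep_set (sigma_sets (space M) (C \<union> null_sets M)) (sigma_sets (space M) G)"
    by (rule indep_set_sigma_sets)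
  have "sets (F s) \<subseteq> sigma_sets (space M) (C \<union> null_sets M)"
    unfolding sets_F
  proof (rule sigma_sets_mono', safe)
    fix u and B :: "real set" assume u: "0 \<le> u" "u \<le> s" "B \<in> sets borel" "W u -` B \<inter> space M \<notin> null_sets M"
    show "W u -` B \<inter> space M \<in> C"
      unfolding C_def using u by (intro CollectI exI[of _ "{u}"] exI[of _ "\<lambda>_. B"]) auto
  qed
  then show ?thesis
    using indep_set_mono[OF ind] unfolding G_def[symmetric] by blast
qed

lemma indep_var_F_increment:
  assumes "0 \<le> s" "s < t" and Z: "Z \<in> borel_measurable (F s)"
  shows "indep_var borel (Z :: 'a \<Rightarrow> real) borel (\<lambda>\<omega>. W t \<omega> - W s \<omega>)"
  unfolding indep_var_eq
proof safe
  have dW: "(\<lambda>\<omega>. W t \<omega> - W s \<omega>) \<in> borel_measurable M"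
    using assms measurable_W by (intro borel_measurable_diff) auto
  then show "(\<lambda>\<omega>. W t \<omega> - W s \<omega>) \<in> borel_measurable M" .
  show "Z \<in> borel_measurable M" by (rule measurable_F_M[OF Z])
  have "sigma_sets (space M) {Z -` A \<inter> space M | A. A \<in> sets borel} \<subseteq> sets (F s)"
    using measurable_sets[OF Z] sets.sigma_sets_subset[of "{Z -` A \<inter> space M | A. A \<in> sets borel}" "F s"]
    by auto
  then show "indep_set (sigma_sets (space M) {Z -` A \<inter> space M | A. A \<in> sets borel})
     (sigma_sets (space M) {(\<lambda>\<omega>. W t \<omega> - W s \<omega>) -` A \<inter> space M |A. A \<in> sets borel})"
    using indep_set_mono[OF indep_set_F_increment[OF assms(1,2)]] by blast
qed

text \<open>Stands in for conditioning on \<open>F s\<close>: independence splits the expectation,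
  and the normal density of the increment turns the second factor into the Gaussian integral
  \<open>c\<close>.\<close>

lemma F_increment_expectation:
  fixes g :: "real \<Rightarrow> real"
  assumes st: "0 \<le> s" "s < t" and Z: "Z \<in> borel_measurable (F s)" "integrable M Z"
    and g: "g \<in> borel_measurable borel" "has_bochner_integral lborel (\<lambda>x. normal_density 0 (sqrt (t - s)) x * g x) c"
  shows "integrable M (\<lambda>\<omega>. Z \<omega> * g (W t \<omega> - W s \<omega>))"
    and "(\<integral>\<omega>. Z \<omega> * g (W t \<omega> - W s \<omega>) \<partial>M) = c * (\<integral>\<omega>. Z \<omega> \<partial>M)"
proof -
  have ind: "indep_var borel Z borel (\<lambda>\<omega>. g (W t \<omega> - W s \<omega>))"
    using indep_var_compose[OF indep_var_F_increment[OF st Z(1)] measurable_ident g(1)]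
    by (simp add: comp_def)
  note d = normal_increments[OF st]
  have g': "g \<in> borel_measurable lborel" using g(1) by simp
  have int: "integrable M (\<lambda>\<omega>. g (W t \<omega> - W s \<omega>))"
    using distributed_integrable[OF d g'] g(2) by (auto simp: has_bochner_integral_iff)
  have c: "(\<integral>\<omega>. g (W t \<omega> - W s \<omega>) \<partial>M) = c"
    using distributed_integral[OF d g'] g(2) by (auto simp: has_bochner_integral_iff)
  show "integrable M (\<lambda>\<omega>. Z \<omega> * g (W t \<omega> - W s \<omega>))"
    by (rule indep_var_integrable[OF ind Z(2) int])
  show "(\<integral>\<omega>. Z \<omega> * g (W t \<omega> - W s \<omega>) \<partial>M) = c * (\<integral>\<omega>. Z \<omega> \<partial>M)"
    using indep_var_lebesgue_integral[OF ind Z(2) int] c by simp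
qed

text \<open>The first two moments serve the isometry and the drift and diffusion terms of a Taylor
  step; the absolute third moment pays for its remainder.\<close>

lemma F_increment_moments:
  assumes st: "0 \<le> s" "s < t" and Z: "Z \<in> borel_measurable (F s)" "integrable M Z"
  shows "integrable M (\<lambda>\<omega>. Z \<omega> * (W t \<omega> - W s \<omega>))"
    and "(\<integral>\<omega>. Z \<omega> * (W t \<omega> - W s \<omega>) \<partial>M) = 0"
    and "integrable M (\<lambda>\<omega>. Z \<omega> * (W t \<omega> - W s \<omega>)\<^sup>2)"
    and "(\<integral>\<omega>. Z \<omega> * (W t \<omega> - W s \<omega>)\<^sup>2 \<partial>M) = (t - s) * (\<integral>\<omega>. Z \<omega> \<partial>M)"
    and "integrable M (\<lambda>\<omega>. Z \<omega> * \<bar>W t \<omega> - W s \<omega>\<bar> ^ 3)"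
    and "(\<integral>\<omega>. Z \<omega> * \<bar>W t \<omega> - W s \<omega>\<bar> ^ 3 \<partial>M) = 2 * sqrt (2 / pi) * sqrt (t - s) ^ 3 * (\<integral>\<omega>. Z \<omega> \<partial>M)"
proof -
  have pos: "0 < sqrt (t - s)" using st by simp
  have 1: "has_bochner_integral lborel (\<lambda>x. normal_density 0 (sqrt (t - s)) x * x) 0"
    using normal_moment_odd[OF pos, of 0 0] by simp
  have 2: "has_bochner_integral lborel (\<lambda>x. normal_density 0 (sqrt (t - s)) x * x\<^sup>2) (t - s)"
    using normal_moment_even[OF pos, of 0 1] st by (simp add: fact_numeral diff_divide_distrib)
  have 3: "has_bochner_integral lborel (\<lambda>x. normal_density 0 (sqrt (t - s)) x * \<bar>x\<bar> ^ 3) (2 * sqrt (2 / pi) * sqrt (t - s) ^ 3)"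
    using normal_moment_abs_odd[OF pos, of 0 1] by (simp add: eval_nat_numeral mult_ac)
  show "integrable M (\<lambda>\<omega>. Z \<omega> * (W t \<omega> - W s \<omega>))" "(\<integral>\<omega>. Z \<omega> * (W t \<omega> - W s \<omega>) \<partial>M) = 0"
    using F_increment_expectation[OF st Z _ 1] by auto
  show "integrable M (\<lambda>\<omega>. Z \<omega> * (W t \<omega> - W s \<omega>)\<^sup>2)"
    "(\<integral>\<omega>. Z \<omega> * (W t \<omega> - W s \<omega>)\<^sup>2 \<partial>M) = (t - s) * (\<integral>\<omega>. Z \<omega> \<partial>M)"
    using F_increment_expectation[OF st Z _ 2] by auto
  show "integrable M (\<lambda>\<omega>. Z \<omega> * \<bar>W t \<omega> - W s \<omega>\<bar> ^ 3)"
    "(\<integral>\<omega>. Z \<omega> * \<bar>W t \<omega> - W s \<omega>\<bar> ^ 3 \<partial>M) = 2 * sqrt (2 / pi) * sqrt (t - s) ^ 3 * (\<integral>\<omega>. Z \<omega> \<partial>M)"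
    using F_increment_expectation[OF st Z _ 3] by auto
qed

end

section \<open>Convergence in probability and a discrete Lenglart inequality\<close>

context prob_space
begin

lemma integrable_square_of_bounded:
  assumes "\<And>\<omega>. \<omega> \<in> space M \<Longrightarrow> \<bar>f \<omega>\<bar> \<le> C" "f \<in> borel_measurable M"
  shows "integrable M (\<lambda>\<omega>. (f \<omega>)\<^sup>2 :: real)"
proof (rule integrable_const_bound[of _ "C\<^sup>2"])
  show "AE \<omega> in M. norm ((f \<omega>)\<^sup>2) \<le> C\<^sup>2"
  proof (rule AE_I2)
    fix \<omega> assume "\<omega> \<in> space M"
    from power_mono[OF assms(1)[OF this] abs_ge_zero, of 2]
    show "norm ((f \<omega>)\<^sup>2) \<le> C\<^sup>2" by simp
  qed
  show "(\<lambda>\<omega>. (f \<omega>)\<^sup>2) \<in> borel_measurable M"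
    using assms(2) by (rule borel_measurable_power)
qed

lemma tendsto_in_probability_zeroD:
  assumes "tendsto_in_probability M Y (\<lambda>_. 0)"
  shows "Y k \<in> borel_measurable M"
    and "0 < \<epsilon> \<Longrightarrow> (\<lambda>k. prob {\<omega>\<in>space M. \<epsilon> < \<bar>Y k \<omega>\<bar>}) \<longlonglongrightarrow> 0"
  using assms by (auto simp: tendsto_in_probability_def)

lemma tendsto_in_probability_zero_le:
  assumes A: "tendsto_in_probability M A (\<lambda>_. 0)" and B: "tendsto_in_probability M B (\<lambda>_. 0)"
    and Y: "\<And>k. Y k \<in> borel_measurable M" and "0 < c"
    and le: "\<And>k. AE \<omega> in M. \<bar>Y k \<omega>\<bar> \<le> c * (\<bar>A k \<omega>\<bar> + \<bar>B k \<omega>\<bar>)"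
  shows "tendsto_in_probability M Y (\<lambda>_. 0)"
  unfolding tendsto_in_probability_def
proof (intro conjI allI impI)
  fix \<epsilon> :: real assume "0 < \<epsilon>"
  define d where "d = \<epsilon> / (2 * c)"
  have d: "0 < d" using \<open>0 < \<epsilon>\<close> \<open>0 < c\<close> by (simp add: d_def)
  note [measurable] = Y tendsto_in_probability_zeroD(1)[OF A] tendsto_in_probability_zeroD(1)[OF B]
  have bound: "prob {\<omega>\<in>space M. \<epsilon> < \<bar>Y k \<omega> - 0\<bar>} \<le>
      prob {\<omega>\<in>space M. d < \<bar>A k \<omega>\<bar>} + prob {\<omega>\<in>space M. d < \<bar>B k \<omega>\<bar>}" for k
  proof -
    have "prob {\<omega>\<in>space M. \<epsilon> < \<bar>Y k \<omega> - 0\<bar>} \<le>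
        prob ({\<omega>\<in>space M. d < \<bar>A k \<omega>\<bar>} \<union> {\<omega>\<in>space M. d < \<bar>B k \<omega>\<bar>})"
    proof (rule finite_measure_mono_AE)
      show "AE \<omega> in M. \<omega> \<in> {\<omega>\<in>space M. \<epsilon> < \<bar>Y k \<omega> - 0\<bar>} \<longrightarrow>
          \<omega> \<in> {\<omega>\<in>space M. d < \<bar>A k \<omega>\<bar>} \<union> {\<omega>\<in>space M. d < \<bar>B k \<omega>\<bar>}"
        using le[of k]
      proof eventually_elim
        case (elim \<omega>)
        show ?case
        proof (rule impI, rule ccontr)
          assume 1: "\<omega> \<in> {\<omega>\<in>space M. \<epsilon> < \<bar>Y k \<omega> - 0\<bar>}"
            and "\<omega> \<notin> {\<omega>\<in>space M. d < \<bar>A k \<omega>\<bar>} \<union> {\<omega>\<in>space M. d < \<bar>B k \<omega>\<bar>}"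
          then have "\<bar>A k \<omega>\<bar> + \<bar>B k \<omega>\<bar> \<le> 2 * d" by auto
          then have "c * (\<bar>A k \<omega>\<bar> + \<bar>B k \<omega>\<bar>) \<le> c * (2 * d)"
            using \<open>0 < c\<close> by (intro mult_left_mono) auto
          also have "\<dots> = \<epsilon>" using \<open>0 < c\<close> by (simp add: d_def)
          finally show False using 1 elim by auto
        qed
      qed
    qed measurable
    also have "\<dots> \<le> prob {\<omega>\<in>space M. d < \<bar>A k \<omega>\<bar>} + prob {\<omega>\<in>space M. d < \<bar>B k \<omega>\<bar>}"
      by (rule measure_Un_le) auto
    finally show ?thesis .
  qed
  have "(\<lambda>k. prob {\<omega>\<in>space M. d < \<bar>A k \<omega>\<bar>} + prob {\<omega>\<in>space M. d < \<bar>B k \<omega>\<bar>}) \<longlonglongrightarrow> 0 + 0"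
    by (intro tendsto_add tendsto_in_probability_zeroD(2)[OF A d] tendsto_in_probability_zeroD(2)[OF B d])
  then show "(\<lambda>k. prob {\<omega>\<in>space M. \<epsilon> < \<bar>Y k \<omega> - 0\<bar>}) \<longlonglongrightarrow> 0"
    unfolding add_0_left
    by (rule Lim_null_comparison[rotated]) (use bound in \<open>simp add: eventually_sequentially\<close>)
qed (use Y in auto)

lemma tendsto_in_probability_AE:
  assumes [measurable]: "\<And>k. Y k \<in> borel_measurable M"
    and lim: "AE \<omega> in M. (\<lambda>k. Y k \<omega>) \<longlonglongrightarrow> 0"
  shows "tendsto_in_probability M Y (\<lambda>_. 0)"
  unfolding tendsto_in_probability_def
proof (intro conjI allI impI)
  fix \<epsilon> :: real assume "0 < \<epsilon>"
  have "(\<lambda>k. \<integral>\<omega>. indicator {\<omega>\<in>space M. \<epsilon> < \<bar>Y k \<omega> - 0\<bar>} \<omega> \<partial>M) \<longlonglongrightarrow> (\<integral>\<omega>. (0::real) \<partial>M)"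
  proof (rule integral_dominated_convergence[where w = "\<lambda>_. 1"])
    show "AE \<omega> in M. (\<lambda>k. indicator {\<omega>\<in>space M. \<epsilon> < \<bar>Y k \<omega> - 0\<bar>} \<omega>) \<longlonglongrightarrow> (0::real)"
      using lim
    proof eventually_elim
      case (elim \<omega>)
      have "\<forall>\<^sub>F k in sequentially. \<bar>Y k \<omega>\<bar> < \<epsilon>"
        using tendstoD[OF elim \<open>0 < \<epsilon>\<close>] by simp
      then show ?case by (intro tendsto_eventually) (auto elim!: eventually_mono)
    qed
  qed (auto simp: indicator_def)
  then show "(\<lambda>k. prob {\<omega>\<in>space M. \<epsilon> < \<bar>Y k \<omega> - 0\<bar>}) \<longlonglongrightarrow> 0" by simp
qed auto

text \<open>Convergence in probability gives convergence of \<open>min 1 \<bar>Y k\<bar>\<close> in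
  \<open>L1\<close>, hence almost surely along a subsequence. The cut at 1 disappears afterwards,
  since the minimum is eventually below 1.\<close>

lemma tendsto_in_probability_subseq:
  assumes Y: "tendsto_in_probability M Y (\<lambda>_. 0)"
  obtains r :: "nat \<Rightarrow> nat" where "strict_mono r" "AE \<omega> in M. (\<lambda>k. Y (r k) \<omega>) \<longlonglongrightarrow> 0"
proof -
  note [measurable] = tendsto_in_probability_zeroD(1)[OF Y]
  have int: "integrable M (\<lambda>\<omega>. min 1 \<bar>Y k \<omega>\<bar>)" for k
    by (rule integrable_const_bound[of _ 1]) auto
  have "(\<lambda>k. \<integral>\<omega>. norm (min 1 \<bar>Y k \<omega>\<bar> :: real) \<partial>M) \<longlonglongrightarrow> 0"
  proof (rule LIMSEQ_I)
    fix e :: real assume "0 < e"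
    then have "\<forall>\<^sub>F k in sequentially. prob {\<omega>\<in>space M. e / 2 < \<bar>Y k \<omega>\<bar>} < e / 2"
      using order_tendstoD(2)[OF tendsto_in_probability_zeroD(2)[OF Y, of "e / 2"], of "e / 2"] by simp
    then obtain K where K: "\<And>k. k \<ge> K \<Longrightarrow> prob {\<omega>\<in>space M. e / 2 < \<bar>Y k \<omega>\<bar>} < e / 2"
      by (auto simp: eventually_sequentially)
    have "(\<integral>\<omega>. min 1 \<bar>Y k \<omega>\<bar> \<partial>M) < e" if "k \<ge> K" for k
    proof -
      have "(\<integral>\<omega>. min 1 \<bar>Y k \<omega>\<bar> \<partial>M) \<le> (\<integral>\<omega>. e / 2 + indicator {\<omega>\<in>space M. e / 2 < \<bar>Y k \<omega>\<bar>} \<omega> \<partial>M)"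
        using \<open>0 < e\<close> by (intro integral_mono int Bochner_Integration.integrable_add integrable_real_indicator)
            (auto simp: indicator_def min_def less_top[symmetric])
      also have "\<dots> = e / 2 + prob {\<omega>\<in>space M. e / 2 < \<bar>Y k \<omega>\<bar>}"
        by (subst Bochner_Integration.integral_add) (auto simp: prob_space less_top[symmetric] intro!: integrable_real_indicator)
      also have "\<dots> < e" using K[OF that] by simp
      finally show ?thesis .
    qed
    moreover have "0 \<le> (\<integral>\<omega>. min 1 \<bar>Y k \<omega>\<bar> \<partial>M)" for k by simp
    ultimately show "\<exists>no. \<forall>k\<ge>no. norm ((\<integral>\<omega>. norm (min 1 \<bar>Y k \<omega>\<bar> :: real) \<partial>M) - 0) < e"
      by (intro exI[of _ K]) auto
  qed
  from tendsto_L1_AE_subseq[OF int this] obtain r where r: "strict_mono r"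
    "AE \<omega> in M. (\<lambda>k. min 1 \<bar>Y (r k) \<omega>\<bar>) \<longlonglongrightarrow> 0" by auto
  have "AE \<omega> in M. (\<lambda>k. Y (r k) \<omega>) \<longlonglongrightarrow> 0"
    using r(2)
  proof eventually_elim
    case (elim \<omega>)
    have "\<forall>\<^sub>F k in sequentially. min 1 \<bar>Y (r k) \<omega>\<bar> < 1"
      using order_tendstoD(2)[OF elim, of 1] by simp
    then have "\<forall>\<^sub>F k in sequentially. min 1 \<bar>Y (r k) \<omega>\<bar> = \<bar>Y (r k) \<omega>\<bar>"
      by (rule eventually_mono) auto
    from Lim_transform_eventually[OF elim this] show ?case by (rule tendsto_rabs_zero_cancel)
  qed
  with r(1) show ?thesis by (rule that)
qed

end

context standard_wiener_process
begin

lemma increments_measurable_F: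
  assumes q: "0 \<le> q 0" "\<And>i. i < N \<Longrightarrow> q i < q (Suc i)"
    and \<zeta>: "\<And>i. i < N \<Longrightarrow> \<zeta> i \<in> borel_measurable (F (q i))" and "j \<le> N"
  shows "(\<lambda>\<omega>. \<Sum>i<j. \<zeta> i \<omega> * (W (q (Suc i)) \<omega> - W (q i) \<omega>)) \<in> borel_measurable (F (q j))"
proof (intro borel_measurable_sum borel_measurable_times borel_measurable_diff)
  fix i assume "i \<in> {..<j}"
  then have i: "i < N" "q i \<le> q j" "q (Suc i) \<le> q j" "0 \<le> q i" "0 \<le> q (Suc i)"
    using mono_grid[of N q, OF q(2)] q(1) \<open>j \<le> N\<close>
    by (auto intro: order_trans[OF q(1)])
  show "\<zeta> i \<in> borel_measurable (F (q j))" using measurable_F_mono[OF \<zeta>] i by auto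
  show "W (q (Suc i)) \<in> borel_measurable (F (q j))" "W (q i) \<in> borel_measurable (F (q j))"
    using i by (auto intro: measurable_F_W)
qed

text \<open>The Ito isometry on a grid. In the induction step the mixed term
  \<open>2 * S \<omega> * \<zeta> j \<omega>\<close> is known at time \<open>q j\<close> and
  multiplies a centred increment; boundedness of the coefficients makes it integrable.\<close>

lemma increments_L2:
  assumes q: "0 \<le> q 0" "\<And>i. i < N \<Longrightarrow> q i < q (Suc i)"
    and \<zeta>: "\<And>i. i < N \<Longrightarrow> \<zeta> i \<in> borel_measurable (F (q i))"
      "\<And>i. i < N \<Longrightarrow> \<exists>C. \<forall>\<omega>\<in>space M. \<bar>\<zeta> i \<omega>\<bar> \<le> C" and "j \<le> N"
  shows "integrable M (\<lambda>\<omega>. (\<Sum>i<j. \<zeta> i \<omega> * (W (q (Suc i)) \<omega> - W (q i) \<omega>))\<^sup>2) \<and>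
    (\<integral>\<omega>. (\<Sum>i<j. \<zeta> i \<omega> * (W (q (Suc i)) \<omega> - W (q i) \<omega>))\<^sup>2 \<partial>M) =
      (\<Sum>i<j. (q (Suc i) - q i) * (\<integral>\<omega>. (\<zeta> i \<omega>)\<^sup>2 \<partial>M))"
  using \<open>j \<le> N\<close>
proof (induction j)
  case (Suc j)
  define S where "S = (\<lambda>\<omega>. \<Sum>i<j. \<zeta> i \<omega> * (W (q (Suc i)) \<omega> - W (q i) \<omega>))"
  have j: "j < N" "0 \<le> q j" "q j < q (Suc j)"
    using Suc.prems mono_grid[of N q, OF q(2), of 0 j] q by auto
  have S [measurable]: "S \<in> borel_measurable (F (q j))"
    unfolding S_def using j by (intro increments_measurable_F[where N = N] q \<zeta>(1)) auto
  have \<zeta>j [measurable]: "\<zeta> j \<in> borel_measurable (F (q j))" using \<zeta>(1) j by auto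
  obtain C where C: "\<And>\<omega>. \<omega> \<in> space M \<Longrightarrow> \<bar>\<zeta> j \<omega>\<bar> \<le> C" using \<zeta>(2)[OF j(1)] by auto
  have SM: "S \<in> borel_measurable M" "\<zeta> j \<in> borel_measurable M"
    using measurable_F_M[OF S] measurable_F_M[OF \<zeta>j] .
  have IH: "integrable M (\<lambda>\<omega>. (S \<omega>)\<^sup>2)"
    "(\<integral>\<omega>. (S \<omega>)\<^sup>2 \<partial>M) = (\<Sum>i<j. (q (Suc i) - q i) * (\<integral>\<omega>. (\<zeta> i \<omega>)\<^sup>2 \<partial>M))"
    using Suc unfolding S_def by auto
  have "integrable M S" using square_integrable_imp_integrable[OF SM(1) IH(1)] .
  then have "integrable M (\<lambda>\<omega>. C * \<bar>S \<omega>\<bar>)" by auto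
  then have Sz: "integrable M (\<lambda>\<omega>. 2 * S \<omega> * \<zeta> j \<omega>)"
  proof (rule Bochner_Integration.integrable_bound[OF integrable_mult_right[of 2]])
    show "AE \<omega> in M. norm (2 * S \<omega> * \<zeta> j \<omega>) \<le> norm (2 * (C * \<bar>S \<omega>\<bar>))"
    proof (rule AE_I2)
      fix \<omega> assume "\<omega> \<in> space M"
      then have "\<bar>S \<omega>\<bar> * \<bar>\<zeta> j \<omega>\<bar> \<le> \<bar>S \<omega>\<bar> * C" using C by (intro mult_left_mono) auto
      moreover have "0 \<le> C" using C[OF \<open>\<omega> \<in> space M\<close>] by linarith
      ultimately show "norm (2 * S \<omega> * \<zeta> j \<omega>) \<le> norm (2 * (C * \<bar>S \<omega>\<bar>))"
        by (simp add: abs_mult mult_ac)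
    qed
  qed (use SM in measurable)
  have zz: "integrable M (\<lambda>\<omega>. (\<zeta> j \<omega>)\<^sup>2)"
    using C SM(2) by (rule integrable_square_of_bounded)
  note 1 = F_increment_moments(1,2)[OF j(2,3) _ Sz]
  note 2 = F_increment_moments(3,4)[OF j(2,3) _ zz]
  have eq: "(\<Sum>i<Suc j. \<zeta> i \<omega> * (W (q (Suc i)) \<omega> - W (q i) \<omega>))\<^sup>2 =
     (S \<omega>)\<^sup>2 + 2 * S \<omega> * \<zeta> j \<omega> * (W (q (Suc j)) \<omega> - W (q j) \<omega>) +
      (\<zeta> j \<omega>)\<^sup>2 * (W (q (Suc j)) \<omega> - W (q j) \<omega>)\<^sup>2" for \<omega>
    by (simp add: S_def power2_sum power_mult_distrib)
  show ?case unfolding eq using IH 1 2 by simp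
qed simp

text \<open>The coefficients are switched off once the sum has left [-\<epsilon>,\<epsilon>] or the
  accumulated squares would pass \<delta>. By the isometry the stopped sum has second moment at most
  \<delta>, so Chebyshev's inequality gives the first term; the second accounts for the paths on
  which the squares do pass \<delta>.\<close>

lemma lenglart_discrete:
  fixes \<epsilon> \<delta> :: real
  assumes q: "0 \<le> q 0" "\<And>i. i < N \<Longrightarrow> q i < q (Suc i)"
    and \<zeta>: "\<And>i. i < N \<Longrightarrow> \<zeta> i \<in> borel_measurable (F (q i))"
      "\<And>i. i < N \<Longrightarrow> \<exists>C. \<forall>\<omega>\<in>space M. \<bar>\<zeta> i \<omega>\<bar> \<le> C"
    and "0 < \<epsilon>" "0 < \<delta>"
  shows "prob {\<omega>\<in>space M. \<exists>j\<le>N. \<epsilon> < \<bar>\<Sum>i<j. \<zeta> i \<omega> * (W (q (Suc i)) \<omega> - W (q i) \<omega>)\<bar>} \<le>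
    \<delta> / \<epsilon>\<^sup>2 + prob {\<omega>\<in>space M. \<delta> < (\<Sum>i<N. (\<zeta> i \<omega>)\<^sup>2 * (q (Suc i) - q i))}"
proof -
  define S where "S = (\<lambda>j \<omega>. \<Sum>i<j. \<zeta> i \<omega> * (W (q (Suc i)) \<omega> - W (q i) \<omega>))"
  define A where "A = (\<lambda>j \<omega>. \<Sum>i<j. (\<zeta> i \<omega>)\<^sup>2 * (q (Suc i) - q i))"
  \<comment> \<open>\<open>A (Suc i)\<close> involves coefficients up to index \<open>i\<close> only
    and is known at time \<open>q i\<close>. Testing it instead of \<open>A i\<close> stops before
    \<delta> is exceeded, so there is no overshoot.\<close>
  define \<kappa> where "\<kappa> = (\<lambda>i \<omega>. if (\<forall>j\<in>{..i}. \<bar>S j \<omega>\<bar> \<le> \<epsilon>) \<and> A (Suc i) \<omega> \<le> \<delta> then 1 else 0 :: real)"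
  define \<zeta>' where "\<zeta>' = (\<lambda>i \<omega>. \<kappa> i \<omega> * \<zeta> i \<omega>)"
  define S' where "S' = (\<lambda>j \<omega>. \<Sum>i<j. \<zeta>' i \<omega> * (W (q (Suc i)) \<omega> - W (q i) \<omega>))"
  have SF: "S j \<in> borel_measurable (F (q j))" if "j \<le> N" for j
    unfolding S_def using that by (intro increments_measurable_F[where N = N] q \<zeta>(1)) auto
  have AF: "A (Suc i) \<in> borel_measurable (F (q i))" if "i < N" for i
    unfolding A_def
  proof (intro borel_measurable_sum borel_measurable_times borel_measurable_power)
    fix k assume "k \<in> {..<Suc i}"
    then show "\<zeta> k \<in> borel_measurable (F (q i))"
      using that mono_grid[of N q, OF q(2), of k i] by (intro measurable_F_mono[OF \<zeta>(1)]) auto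
  qed auto
  have \<zeta>'F: "\<zeta>' i \<in> borel_measurable (F (q i))" if "i < N" for i
  proof -
    have [measurable]: "A (Suc i) \<in> borel_measurable (F (q i))" by (rule AF[OF that])
    have "{\<omega> \<in> space (F (q i)). \<forall>j\<in>{..i}. \<bar>S j \<omega>\<bar> \<le> \<epsilon>} \<in> sets (F (q i))"
    proof (rule sets.sets_Collect_finite_All)
      fix j assume "j \<in> {..i}"
      then have [measurable]: "S j \<in> borel_measurable (F (q i))"
        using that mono_grid[of N q, OF q(2), of j i] by (intro measurable_F_mono[OF SF]) auto
      show "{\<omega> \<in> space (F (q i)). \<bar>S j \<omega>\<bar> \<le> \<epsilon>} \<in> sets (F (q i))" by measurable
    qed simp
    moreover have "{\<omega> \<in> space (F (q i)). A (Suc i) \<omega> \<le> \<delta>} \<in> sets (F (q i))" by measurable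
    ultimately have "{\<omega> \<in> space (F (q i)). (\<forall>j\<in>{..i}. \<bar>S j \<omega>\<bar> \<le> \<epsilon>) \<and> A (Suc i) \<omega> \<le> \<delta>} \<in> sets (F (q i))"
      by (intro sets.sets_Collect_conj)
    then show ?thesis unfolding \<zeta>'_def \<kappa>_def
      by (intro borel_measurable_times measurable_If measurable_const \<zeta>(1) that) auto
  qed
  have \<zeta>'_le: "\<bar>\<zeta>' i \<omega>\<bar> \<le> \<bar>\<zeta> i \<omega>\<bar>" for i \<omega> by (auto simp: \<zeta>'_def \<kappa>_def)
  have \<zeta>'_bdd: "\<exists>C. \<forall>\<omega>\<in>space M. \<bar>\<zeta>' i \<omega>\<bar> \<le> C" if "i < N" for i
    using \<zeta>(2)[OF that] \<zeta>'_le by (meson order_trans)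
  have dq: "0 \<le> q (Suc i) - q i" if "i < N" for i using q(2)[OF that] by simp
  have A'_le: "(\<Sum>i<j. (\<zeta>' i \<omega>)\<^sup>2 * (q (Suc i) - q i)) \<le> \<delta>" if "j \<le> N" for j \<omega>
    using that
  proof (induction j)
    case (Suc j)
    show ?case
    proof (cases "\<kappa> j \<omega> = 1")
      case True
      have "(\<Sum>i<Suc j. (\<zeta>' i \<omega>)\<^sup>2 * (q (Suc i) - q i)) \<le> A (Suc j) \<omega>"
        unfolding A_def using \<zeta>'_le[of _ \<omega>] dq Suc.prems
        by (intro sum_mono mult_right_mono) (auto simp: abs_le_square_iff)
      also have "\<dots> \<le> \<delta>" using True by (auto simp: \<kappa>_def split: if_splits)
      finally show ?thesis .
    next
      case False
      then have "\<zeta>' j \<omega> = 0" by (auto simp: \<zeta>'_def \<kappa>_def)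
      then show ?thesis using Suc by simp
    qed
  qed (use \<open>0 < \<delta>\<close> in simp)
  have L2: "integrable M (\<lambda>\<omega>. (S' N \<omega>)\<^sup>2)"
    "(\<integral>\<omega>. (S' N \<omega>)\<^sup>2 \<partial>M) = (\<Sum>i<N. (q (Suc i) - q i) * (\<integral>\<omega>. (\<zeta>' i \<omega>)\<^sup>2 \<partial>M))"
    using increments_L2[where q = q and N = N and j = N and \<zeta> = \<zeta>', OF q \<zeta>'F \<zeta>'_bdd] unfolding S'_def by auto
  have z2: "integrable M (\<lambda>\<omega>. (\<zeta>' i \<omega>)\<^sup>2)" if i: "i < N" for i
  proof -
    obtain C where C: "\<And>\<omega>. \<omega> \<in> space M \<Longrightarrow> \<bar>\<zeta>' i \<omega>\<bar> \<le> C" using \<zeta>'_bdd[OF i] by auto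
    show ?thesis
      using C measurable_F_M[OF \<zeta>'F[OF i]] by (rule integrable_square_of_bounded)
  qed
  have "(\<integral>\<omega>. (S' N \<omega>)\<^sup>2 \<partial>M) = (\<integral>\<omega>. (\<Sum>i<N. (\<zeta>' i \<omega>)\<^sup>2 * (q (Suc i) - q i)) \<partial>M)"
    unfolding L2 using z2 by (simp add: mult.commute)
  also have "\<dots> \<le> (\<integral>\<omega>. \<delta> \<partial>M)"
    using z2 A'_le by (intro integral_mono) auto
  finally have ES': "(\<integral>\<omega>. (S' N \<omega>)\<^sup>2 \<partial>M) \<le> \<delta>" by (simp add: prob_space)
  \<comment> \<open>If \<open>A N\<close> is at most \<delta>, all switches are on before the first
    exceedance at \<open>j\<close> and off from \<open>j\<close> on. Hence \<open>S'\<close> agrees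
    with \<open>S\<close> up to \<open>j\<close> and keeps the exceeding value until
    \<open>N\<close>.\<close>
  have first_passage: "\<epsilon> < \<bar>S' N \<omega>\<bar>" if "\<exists>j\<le>N. \<epsilon> < \<bar>S j \<omega>\<bar>" "A N \<omega> \<le> \<delta>" for \<omega>
  proof -
    define j where "j = (LEAST j. j \<le> N \<and> \<epsilon> < \<bar>S j \<omega>\<bar>)"
    have j: "j \<le> N" "\<epsilon> < \<bar>S j \<omega>\<bar>"
      using LeastI_ex[OF that(1)] unfolding j_def by auto
    have before: "\<bar>S i \<omega>\<bar> \<le> \<epsilon>" if "i < j" for i
      using not_less_Least[of i "\<lambda>j. j \<le> N \<and> \<epsilon> < \<bar>S j \<omega>\<bar>"] that j(1) unfolding j_def by auto
    have "\<kappa> i \<omega> = 1" if "i < j" for i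
    proof -
      have "A (Suc i) \<omega> \<le> A N \<omega>"
        unfolding A_def using that j(1) dq by (intro sum_mono2) auto
      then show ?thesis using that before \<open>A N \<omega> \<le> \<delta>\<close> by (auto simp: \<kappa>_def)
    qed
    then have "S' j \<omega> = S j \<omega>" unfolding S'_def S_def \<zeta>'_def by (intro sum.cong) auto
    moreover have "\<kappa> i \<omega> = 0" if "j \<le> i" for i using that j by (auto simp: \<kappa>_def not_le)
    then have "S' N \<omega> = S' j \<omega>"
      unfolding S'_def using j(1) by (intro sum.mono_neutral_right) (auto simp: \<zeta>'_def)
    ultimately show ?thesis using j by simp
  qed
  have [measurable]: "S' N \<in> borel_measurable M" "\<And>j. j \<le> N \<Longrightarrow> S j \<in> borel_measurable M"
    unfolding S'_def
    using measurable_F_M[OF increments_measurable_F[where q = q and N = N and j = N and \<zeta> = \<zeta>', OF q \<zeta>'F]] measurable_F_M[OF SF] by auto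
  have AM [measurable]: "A N \<in> borel_measurable M"
    unfolding A_def using measurable_F_M[OF \<zeta>(1)]
    by (intro borel_measurable_sum borel_measurable_times borel_measurable_power) auto
  have "prob {\<omega>\<in>space M. \<exists>j\<le>N. \<epsilon> < \<bar>S j \<omega>\<bar>} \<le>
     prob ({\<omega>\<in>space M. \<epsilon>\<^sup>2 \<le> (S' N \<omega>)\<^sup>2} \<union> {\<omega>\<in>space M. \<delta> < A N \<omega>})"
  proof (rule finite_measure_mono)
    show "{\<omega>\<in>space M. \<exists>j\<le>N. \<epsilon> < \<bar>S j \<omega>\<bar>} \<subseteq> {\<omega>\<in>space M. \<epsilon>\<^sup>2 \<le> (S' N \<omega>)\<^sup>2} \<union> {\<omega>\<in>space M. \<delta> < A N \<omega>}"
    proof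
      fix \<omega> assume \<omega>: "\<omega> \<in> {\<omega>\<in>space M. \<exists>j\<le>N. \<epsilon> < \<bar>S j \<omega>\<bar>}"
      show "\<omega> \<in> {\<omega>\<in>space M. \<epsilon>\<^sup>2 \<le> (S' N \<omega>)\<^sup>2} \<union> {\<omega>\<in>space M. \<delta> < A N \<omega>}"
      proof (cases "A N \<omega> \<le> \<delta>")
        case True
        then have "\<epsilon> < \<bar>S' N \<omega>\<bar>" using first_passage \<omega> by blast
        then show ?thesis using \<omega> \<open>0 < \<epsilon>\<close> by (auto simp: abs_le_square_iff[symmetric])
      qed (use \<omega> in auto)
    qed
  qed measurable
  also have "\<dots> \<le> prob {\<omega>\<in>space M. \<epsilon>\<^sup>2 \<le> (S' N \<omega>)\<^sup>2} + prob {\<omega>\<in>space M. \<delta> < A N \<omega>}"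
    by (rule measure_Un_le) auto
  also have "prob {\<omega>\<in>space M. \<epsilon>\<^sup>2 \<le> (S' N \<omega>)\<^sup>2} \<le> (\<integral>\<omega>. (S' N \<omega>)\<^sup>2 \<partial>M) / \<epsilon>\<^sup>2"
    using L2(1) \<open>0 < \<epsilon>\<close> by (intro integral_Markov_inequality_measure[of _ _ "{}"]) auto
  also have "\<dots> \<le> \<delta> / \<epsilon>\<^sup>2" using ES' by (intro divide_right_mono) auto
  finally show ?thesis unfolding S_def A_def by simp
qed

end

section \<open>Simple processes on grids\<close>

lemma simple_value_eq:
  assumes q: "\<And>i. i < N \<Longrightarrow> q i < q (Suc i)" and k: "k < N" "q k < u" "u \<le> q (Suc k)"
  shows "simple_value N q c u \<omega> = c k \<omega>"
proof -
  have "indicator {q i<..q (Suc i)} u = (0::real)" if "i < N" "i \<noteq> k" for i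
  proof (cases "i < k")
    case True
    then show ?thesis using mono_grid[of N q "Suc i" k, OF q] k by (auto simp: indicator_def)
  next
    case False
    then show ?thesis using mono_grid[of N q "Suc k" i, OF q] k that by (auto simp: indicator_def)
  qed
  then have "simple_value N q c u \<omega> = (\<Sum>i<N. if i = k then c k \<omega> else 0)"
    unfolding simple_value_def using k by (intro sum.cong) (auto simp: indicator_def)
  then show ?thesis using k by simp
qed

lemma simple_value_outside:
  assumes q: "\<And>i. i < N \<Longrightarrow> q i < q (Suc i)" and u: "u \<le> q 0 \<or> q N < u"
  shows "simple_value N q c u \<omega> = 0"
  unfolding simple_value_def
proof (rule sum.neutral, rule ballI)
  fix i assume "i \<in> {..<N}"
  then show "c i \<omega> * indicator {q i<..q (Suc i)} u = 0"
    using mono_grid[of N q 0 i, OF q] mono_grid[of N q "Suc i" N, OF q] u by (auto simp: indicator_def)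
qed

lemma grid_find:
  fixes q :: "nat \<Rightarrow> real"
  assumes "q 0 < u" "u \<le> q N"
  obtains k where "k < N" "q k < u" "u \<le> q (Suc k)"
proof -
  have "\<exists>k<N. q k < u \<and> u \<le> q (Suc k)"
    using assms
  proof (induction N)
    case (Suc N)
    then show ?case by (cases "u \<le> q N") (auto intro: less_SucI)
  qed simp
  then show ?thesis using that by blast
qed

lemma simple_value_integral:
  fixes c :: "nat \<Rightarrow> 'a \<Rightarrow> real"
  assumes q: "\<And>i. i < N \<Longrightarrow> q i < q (Suc i)"
  shows "has_bochner_integral lborel (\<lambda>u. simple_value N q c u \<omega>) (\<Sum>i<N. c i \<omega> * (q (Suc i) - q i))"
  unfolding simple_value_def
proof (rule has_bochner_integral_sum)
  fix i assume "i \<in> {..<N}"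
  then have "q i \<le> q (Suc i)" using q[of i] by auto
  then have "has_bochner_integral lborel (indicator {q i<..q (Suc i)} :: real \<Rightarrow> real) (q (Suc i) - q i)"
    using has_bochner_integral_real_indicator[of "{q i<..q (Suc i)}" lborel] by simp
  then show "has_bochner_integral lborel (\<lambda>u. c i \<omega> * indicator {q i<..q (Suc i)} u) (c i \<omega> * (q (Suc i) - q i))"
    by (rule has_bochner_integral_mult_right)
qed

text \<open>Simple processes live on left-open cells and vanish at the left end of [s,t]; this
  single point has to be discarded when they are integrated over the closed interval. Time integrals
  over [t,t] are settled in the same way.\<close>

lemma lborel_integral_at_point:
  "has_bochner_integral lborel (\<lambda>u. indicator {s} u *\<^sub>R f u :: real) 0" for s :: real
proof -
  have "has_bochner_integral lborel (\<lambda>u. f s * indicator {s} u) (f s * 0)"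
    using has_bochner_integral_real_indicator[of "{s}" lborel]
    by (intro has_bochner_integral_mult_right) simp
  moreover have "(\<lambda>u. f s * indicator {s} u) = (\<lambda>u. indicator {s} u *\<^sub>R f u)"
    by (auto simp: indicator_def fun_eq_iff)
  ultimately show ?thesis by simp
qed

lemma set_integral_step:
  fixes \<phi> :: "real \<Rightarrow> real"
  assumes q: "\<And>i. i < N \<Longrightarrow> q i < q (Suc i)" "q 0 = s" "q N = t"
    and \<phi>: "\<And>i u. i < N \<Longrightarrow> q i < u \<Longrightarrow> u \<le> q (Suc i) \<Longrightarrow> \<phi> u = c i"
  shows "has_bochner_integral lborel (\<lambda>u. indicator {s..t} u *\<^sub>R \<phi> u) (\<Sum>i<N. c i * (q (Suc i) - q i))"
proof -
  have "s \<le> t" using mono_grid[of N q 0 N, OF q(1)] q by simp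
  have "has_bochner_integral lborel (\<lambda>u. simple_value N q (\<lambda>i _. c i) u () + indicator {s} u *\<^sub>R \<phi> u)
     ((\<Sum>i<N. c i * (q (Suc i) - q i)) + 0)"
    by (intro has_bochner_integral_add simple_value_integral q lborel_integral_at_point)
  moreover have "simple_value N q (\<lambda>i _. c i) u () + indicator {s} u *\<^sub>R \<phi> u = indicator {s..t} u *\<^sub>R \<phi> u" for u
  proof (cases "s < u \<and> u \<le> t")
    case True
    then obtain k where k: "k < N" "q k < u" "u \<le> q (Suc k)"
      using grid_find[of q u N] q by auto
    then have "simple_value N q (\<lambda>i _. c i) u () = c k" by (intro simple_value_eq q) auto
    then show ?thesis using True \<phi>[OF k] by (auto simp: indicator_def)
  next
    case False
    then have "simple_value N q (\<lambda>i _. c i) u () = 0" by (intro simple_value_outside q) (use q in auto)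
    then show ?thesis using False \<open>s \<le> t\<close> by (auto simp: indicator_def)
  qed
  ultimately show ?thesis by simp
qed

text \<open>Encoded as absence of nodes of \<open>p\<close> from the open cells of \<open>q\<close>,
  not as inclusion of node sets, so that \<open>p\<close> may have nodes outside the interval
  spanned by \<open>q\<close>.\<close>

definition refines_grid :: "nat \<Rightarrow> (nat \<Rightarrow> real) \<Rightarrow> nat \<Rightarrow> (nat \<Rightarrow> real) \<Rightarrow> bool" where
  "refines_grid N q n p \<longleftrightarrow> (\<forall>l\<le>n. \<forall>i<N. \<not> (q i < p l \<and> p l < q (Suc i)))"

lemma refines_gridI:
  assumes q: "\<And>i. i < N \<Longrightarrow> q i < q (Suc i)" "q 0 = s" "q N = t"
    and p: "\<And>l. l \<le> n \<Longrightarrow> p l \<in> {s..t} \<Longrightarrow> p l \<in> q ` {..N}"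
  shows "refines_grid N q n p"
  unfolding refines_grid_def
proof (intro allI impI notI)
  fix l i assume li: "l \<le> n" "i < N" "q i < p l \<and> p l < q (Suc i)"
  have "s \<le> q i" "q (Suc i) \<le> t"
    using mono_grid[of N q 0 i, OF q(1)] mono_grid[of N q "Suc i" N, OF q(1)] li q by auto
  then obtain j where j: "j \<le> N" "p l = q j" using p[OF li(1)] li by auto
  show False
  proof (cases "j \<le> i")
    case True
    then show False using mono_grid[of N q j i, OF q(1)] li j by auto
  next
    case False
    then show False using mono_grid[of N q "Suc i" j, OF q(1)] li j by auto
  qed
qed

lemma simple_value_refined:
  assumes "refines_grid N q n p" "i < N" "q i < u" "u \<le> q (Suc i)"
  shows "simple_value n p \<xi> u \<omega> = simple_value n p \<xi> (q (Suc i)) \<omega>"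
  unfolding simple_value_def
proof (rule sum.cong)
  fix l assume "l \<in> {..<n}"
  then have "\<not> (q i < p l \<and> p l < q (Suc i))" "\<not> (q i < p (Suc l) \<and> p (Suc l) < q (Suc i))"
    using assms(1,2) by (auto simp: refines_grid_def)
  then show "\<xi> l \<omega> * indicator {p l<..p (Suc l)} u = \<xi> l \<omega> * indicator {p l<..p (Suc l)} (q (Suc i))"
    using assms(3,4) by (auto simp: indicator_def)
qed simp

lemma simple_integral_increment_refined:
  assumes "refines_grid N q n p" "i < N" "q i < q (Suc i)" and p: "\<And>l. l < n \<Longrightarrow> p l < p (Suc l)"
  shows "simple_integral_process W n p \<xi> (q (Suc i)) \<omega> - simple_integral_process W n p \<xi> (q i) \<omega> =
    simple_value n p \<xi> (q (Suc i)) \<omega> * (W (q (Suc i)) \<omega> - W (q i) \<omega>)"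
  unfolding simple_value_def simple_integral_process_def sum_subtractf[symmetric] sum_distrib_right
proof (rule sum.cong)
  fix l assume l: "l \<in> {..<n}"
  then have *: "p l \<le> q i \<or> q (Suc i) \<le> p l" "p (Suc l) \<le> q i \<or> q (Suc i) \<le> p (Suc l)" "p l < p (Suc l)"
    using assms(1,2) p[of l] by (auto simp: refines_grid_def not_less)
  \<comment> \<open>A node \<open>a\<close> is never inside the cell, so the time cut off at
    \<open>a\<close> either runs through the whole cell or does not move. The difference of these
    cases for \<open>p (Suc l)\<close> and \<open>p l\<close> is the indicator of the cell of
    \<open>p\<close>.\<close>
  have min_diff: "W (min (q (Suc i)) a) \<omega> - W (min (q i) a) \<omega> =
      of_bool (q (Suc i) \<le> a) * (W (q (Suc i)) \<omega> - W (q i) \<omega>)" if "a \<le> q i \<or> q (Suc i) \<le> a" for a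
    using that assms(3) by (auto simp: min_def)
  have "\<xi> l \<omega> * (W (min (q (Suc i)) (p (Suc l))) \<omega> - W (min (q (Suc i)) (p l)) \<omega>) -
        \<xi> l \<omega> * (W (min (q i) (p (Suc l))) \<omega> - W (min (q i) (p l)) \<omega>) =
      \<xi> l \<omega> * ((W (min (q (Suc i)) (p (Suc l))) \<omega> - W (min (q i) (p (Suc l))) \<omega>) -
        (W (min (q (Suc i)) (p l)) \<omega> - W (min (q i) (p l)) \<omega>))"
    by (simp add: algebra_simps)
  also have "\<dots> = \<xi> l \<omega> * ((of_bool (q (Suc i) \<le> p (Suc l)) - of_bool (q (Suc i) \<le> p l)) * (W (q (Suc i)) \<omega> - W (q i) \<omega>))"
    unfolding min_diff[OF *(1)] min_diff[OF *(2)] by (simp add: algebra_simps)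
  also have "of_bool (q (Suc i) \<le> p (Suc l)) - of_bool (q (Suc i) \<le> p l) = (indicator {p l<..p (Suc l)} (q (Suc i)) :: real)"
    using * assms(3) by (auto simp: indicator_def)
  finally show "\<xi> l \<omega> * (W (min (q (Suc i)) (p (Suc l))) \<omega> - W (min (q (Suc i)) (p l)) \<omega>) -
        \<xi> l \<omega> * (W (min (q i) (p (Suc l))) \<omega> - W (min (q i) (p l)) \<omega>) =
       \<xi> l \<omega> * indicator {p l<..p (Suc l)} (q (Suc i)) * (W (q (Suc i)) \<omega> - W (q i) \<omega>)"
    by simp
qed simp

lemma simple_integral_refined:
  assumes "refines_grid N q n p" "\<And>i. i < N \<Longrightarrow> q i < q (Suc i)" "\<And>l. l < n \<Longrightarrow> p l < p (Suc l)" "j \<le> N"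
  shows "simple_integral_process W n p \<xi> (q j) \<omega> - simple_integral_process W n p \<xi> (q 0) \<omega> =
    (\<Sum>i<j. simple_value n p \<xi> (q (Suc i)) \<omega> * (W (q (Suc i)) \<omega> - W (q i) \<omega>))"
  using \<open>j \<le> N\<close>
proof (induction j)
  case (Suc j)
  then show ?case
    using simple_integral_increment_refined[of N q n p j W \<xi> \<omega>] assms by (simp add: algebra_simps)
qed simp

context standard_wiener_process
begin

lemma simple_processD:
  assumes "simple_process F n p \<xi>"
  shows "0 \<le> p 0" "i < n \<Longrightarrow> p i < p (Suc i)" "i < n \<Longrightarrow> \<xi> i \<in> borel_measurable (F (p i))"
    "i < n \<Longrightarrow> \<exists>C. \<forall>\<omega>\<in>space M. \<bar>\<xi> i \<omega>\<bar> \<le> C" "i \<le> n \<Longrightarrow> 0 \<le> p i"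
proof -
  show 1: "0 \<le> p 0" "i < n \<Longrightarrow> p i < p (Suc i)" "i < n \<Longrightarrow> \<xi> i \<in> borel_measurable (F (p i))"
      "i < n \<Longrightarrow> \<exists>C. \<forall>\<omega>\<in>space M. \<bar>\<xi> i \<omega>\<bar> \<le> C" for i
    using assms by (auto simp: simple_process_def)
  then show "i \<le> n \<Longrightarrow> 0 \<le> p i" using mono_grid[of n p 0 i] by fastforce
qed

lemma simple_integral_process_measurable:
  assumes "simple_process F n p \<xi>" "0 \<le> t"
  shows "simple_integral_process W n p \<xi> t \<in> borel_measurable M"
  unfolding simple_integral_process_def
proof (intro borel_measurable_sum borel_measurable_times borel_measurable_diff measurable_W)
  fix i assume "i \<in> {..<n}"
  then show "\<xi> i \<in> borel_measurable M" using simple_processD(3)[OF assms(1)] measurable_F_M by auto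
  show "0 \<le> min t (p (Suc i))" "0 \<le> min t (p i)"
    using simple_processD(5)[OF assms(1)] \<open>i \<in> {..<n}\<close> assms(2) by auto
qed

text \<open>Predictability: a cell of \<open>p\<close> that contains the right end
  \<open>q (Suc i)\<close> must begin at or before \<open>q i\<close>, because no node of
  \<open>p\<close> lies in between, and so its coefficient is known at time
  \<open>q i\<close>.\<close>

lemma simple_value_measurable_grid:
  assumes p: "simple_process F n p \<xi>" and r: "refines_grid N q n p" "i < N" "q i < q (Suc i)"
  shows "simple_value n p \<xi> (q (Suc i)) \<in> borel_measurable (F (q i))"
  unfolding simple_value_def
proof (rule borel_measurable_sum)
  fix l assume "l \<in> {..<n}"
  then have l: "l < n" by simp
  have "\<not> (q i < p l \<and> p l < q (Suc i))" using r l by (auto simp: refines_grid_def)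
  then consider "p l \<le> q i" | "q (Suc i) \<le> p l" by linarith
  then show "(\<lambda>\<omega>. \<xi> l \<omega> * indicator {p l<..p (Suc l)} (q (Suc i))) \<in> borel_measurable (F (q i))"
  proof cases
    case 1
    have [measurable]: "\<xi> l \<in> borel_measurable (F (q i))"
      by (rule measurable_F_mono[OF simple_processD(3)[OF p l] 1])
    show ?thesis by measurable
  next
    case 2
    then show ?thesis by simp
  qed
qed

lemma simple_value_bounded:
  assumes p: "simple_process F n p \<xi>"
  shows "\<exists>C. \<forall>\<omega>\<in>space M. \<bar>simple_value n p \<xi> u \<omega>\<bar> \<le> C"
proof -
  have "\<forall>l. \<exists>C. l < n \<longrightarrow> (\<forall>\<omega>\<in>space M. \<bar>\<xi> l \<omega>\<bar> \<le> C)"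
    using simple_processD(4)[OF p] by blast
  then obtain C where C: "\<And>l \<omega>. l < n \<Longrightarrow> \<omega> \<in> space M \<Longrightarrow> \<bar>\<xi> l \<omega>\<bar> \<le> C l" by metis
  have "\<bar>simple_value n p \<xi> u \<omega>\<bar> \<le> (\<Sum>l<n. C l)" if "\<omega> \<in> space M" for \<omega>
  proof -
    have "\<bar>simple_value n p \<xi> u \<omega>\<bar> \<le> (\<Sum>l<n. \<bar>\<xi> l \<omega> * indicator {p l<..p (Suc l)} u\<bar>)"
      unfolding simple_value_def by (rule sum_abs)
    also have "\<dots> \<le> (\<Sum>l<n. C l)"
      using C[OF _ that] by (intro sum_mono) (auto simp: indicator_def intro: order_trans[OF abs_ge_zero])
    finally show ?thesis .
  qed
  then show ?thesis by blast
qed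

text \<open>Both processes are rewritten on a common refinement of their partitions, where the
  discrete inequality applies to the difference.\<close>

lemma lenglart_simple_diff:
  assumes p: "simple_process F n p \<xi>" and p': "simple_process F n' p' \<xi>'"
    and st: "0 \<le> s" "s < t" and U: "finite U" "U \<subseteq> {s..t}" and "0 < \<epsilon>" "0 < \<delta>"
  shows "prob {\<omega>\<in>space M. \<exists>u\<in>U. \<epsilon> < \<bar>(simple_integral_process W n p \<xi> u \<omega> - simple_integral_process W n p \<xi> s \<omega>) -
      (simple_integral_process W n' p' \<xi>' u \<omega> - simple_integral_process W n' p' \<xi>' s \<omega>)\<bar>} \<le>
    \<delta> / \<epsilon>\<^sup>2 + prob {\<omega>\<in>space M. \<delta> < (LBINT u:{s..t}. (simple_value n p \<xi> u \<omega> - simple_value n' p' \<xi>' u \<omega>)\<^sup>2)}"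
    (is "?P \<le> _ + ?R")
proof -
  \<comment> \<open>Increments from \<open>s\<close> on only see the nodes within [s,t];
    \<open>U\<close> is included so that all monitored times become grid times.\<close>
  define A where "A = {s, t} \<union> U \<union> ((p ` {..n} \<union> p' ` {..n'}) \<inter> {s..t})"
  have A: "finite A" "s \<in> A" "t \<in> A" "A \<subseteq> {s..t}" using U st by (auto simp: A_def)
  obtain q :: "nat \<Rightarrow> real" and N where q: "\<And>i. i < N \<Longrightarrow> q i < q (Suc i)" "q 0 = s" "q N = t" "A = q ` {..N}"
    by (rule finite_set_grid[OF A]) (rule that)
  have r: "refines_grid N q n p" "refines_grid N q n' p'"
    by (rule refines_gridI[OF q(1-3)], use q(4) in \<open>auto simp: A_def\<close>)+
  define \<zeta> where "\<zeta> = (\<lambda>i \<omega>. simple_value n p \<xi> (q (Suc i)) \<omega> - simple_value n' p' \<xi>' (q (Suc i)) \<omega>)"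
  have \<zeta>F: "\<zeta> i \<in> borel_measurable (F (q i))" if "i < N" for i
    unfolding \<zeta>_def using that q(1)
    by (intro borel_measurable_diff simple_value_measurable_grid[OF p r(1)] simple_value_measurable_grid[OF p' r(2)]) auto
  have \<zeta>b: "\<exists>C. \<forall>\<omega>\<in>space M. \<bar>\<zeta> i \<omega>\<bar> \<le> C" for i
  proof -
    obtain C C' where "\<forall>\<omega>\<in>space M. \<bar>simple_value n p \<xi> (q (Suc i)) \<omega>\<bar> \<le> C"
      "\<forall>\<omega>\<in>space M. \<bar>simple_value n' p' \<xi>' (q (Suc i)) \<omega>\<bar> \<le> C'"
      using simple_value_bounded[OF p] simple_value_bounded[OF p'] by metis
    then have "\<forall>\<omega>\<in>space M. \<bar>\<zeta> i \<omega>\<bar> \<le> C + C'" unfolding \<zeta>_def by (smt (verit))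
    then show ?thesis by blast
  qed
  have int: "(LBINT u:{s..t}. (simple_value n p \<xi> u \<omega> - simple_value n' p' \<xi>' u \<omega>)\<^sup>2) =
      (\<Sum>i<N. (\<zeta> i \<omega>)\<^sup>2 * (q (Suc i) - q i))" for \<omega>
    unfolding set_lebesgue_integral_def
  proof (rule has_bochner_integral_integral_eq[OF set_integral_step[OF q(1-3)]])
    fix i u assume iu: "i < N" "q i < u" "u \<le> q (Suc i)"
    show "(simple_value n p \<xi> u \<omega> - simple_value n' p' \<xi>' u \<omega>)\<^sup>2 = (\<zeta> i \<omega>)\<^sup>2"
      unfolding \<zeta>_def simple_value_refined[OF r(1) iu] simple_value_refined[OF r(2) iu] ..
  qed
  define S where "S = (\<lambda>j \<omega>. \<Sum>i<j. \<zeta> i \<omega> * (W (q (Suc i)) \<omega> - W (q i) \<omega>))"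
  have S: "(simple_integral_process W n p \<xi> (q j) \<omega> - simple_integral_process W n p \<xi> s \<omega>) -
      (simple_integral_process W n' p' \<xi>' (q j) \<omega> - simple_integral_process W n' p' \<xi>' s \<omega>) = S j \<omega>"
    if "j \<le> N" for j \<omega>
    using simple_integral_refined[OF r(1) q(1) simple_processD(2)[OF p] that, of W \<xi> \<omega>]
      simple_integral_refined[OF r(2) q(1) simple_processD(2)[OF p'] that, of W \<xi>' \<omega>]
    unfolding S_def \<zeta>_def q(2) by (simp add: left_diff_distrib sum_subtractf)
  have q0: "0 \<le> q 0" using st q by simp
  have SM: "S j \<in> borel_measurable M" if "j \<le> N" for j
    unfolding S_def
    by (rule measurable_F_M[OF increments_measurable_F[where N = N and q = q, OF q0 q(1) \<zeta>F that]])
  have "?P \<le> prob {\<omega>\<in>space M. \<exists>j\<le>N. \<epsilon> < \<bar>S j \<omega>\<bar>}"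
  proof (rule finite_measure_mono)
    have "{\<omega>\<in>space M. \<exists>j\<in>{..N}. \<epsilon> < \<bar>S j \<omega>\<bar>} \<in> events"
    proof (rule sets.sets_Collect_finite_Ex)
      fix j assume "j \<in> {..N}"
      then have [measurable]: "S j \<in> borel_measurable M" using SM by simp
      show "{\<omega>\<in>space M. \<epsilon> < \<bar>S j \<omega>\<bar>} \<in> events" by measurable
    qed simp
    then show "{\<omega>\<in>space M. \<exists>j\<le>N. \<epsilon> < \<bar>S j \<omega>\<bar>} \<in> events" unfolding Bex_def atMost_iff .
    have "\<exists>j\<le>N. u = q j" if "u \<in> U" for u using that q(4) unfolding A_def by blast
    then show "{\<omega>\<in>space M. \<exists>u\<in>U. \<epsilon> < \<bar>(simple_integral_process W n p \<xi> u \<omega> - simple_integral_process W n p \<xi> s \<omega>) -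
      (simple_integral_process W n' p' \<xi>' u \<omega> - simple_integral_process W n' p' \<xi>' s \<omega>)\<bar>} \<subseteq> {\<omega>\<in>space M. \<exists>j\<le>N. \<epsilon> < \<bar>S j \<omega>\<bar>}"
      using S by fastforce
  qed
  also have "\<dots> \<le> \<delta> / \<epsilon>\<^sup>2 + ?R"
    unfolding int S_def
    by (rule lenglart_discrete[where N = N and q = q and \<zeta> = \<zeta>, OF q0 q(1) \<zeta>F \<zeta>b]) (use assms in auto)
  finally show ?thesis .
qed

end

section \<open>Joint measurability and integrals along paths\<close>

text \<open>Time is rounded down to multiples of 1/(k + 1). Only countably many values occur, so
  measurability at fixed times suffices, and continuity of the paths carries it to the limit. The
  measure space \<open>N\<close> is left open because the lemma is applied to \<open>M\<close> and
  to \<open>F v\<close>.\<close>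

lemma continuous_process_measurable_pair:
  fixes X :: "real \<Rightarrow> 'a \<Rightarrow> real"
  assumes X: "\<And>u. X u \<in> borel_measurable N"
    and cont: "\<And>\<omega>. \<omega> \<in> space N \<Longrightarrow> continuous_on UNIV (\<lambda>u. X u \<omega>)"
  shows "(\<lambda>z. X (snd z) (fst z)) \<in> borel_measurable (N \<Otimes>\<^sub>M lborel)"
proof (rule borel_measurable_LIMSEQ_real)
  define d where "d = (\<lambda>k u. real_of_int \<lfloor>real (Suc k) * u\<rfloor> / real (Suc k))"
  fix z :: "'a \<times> real" assume z: "z \<in> space (N \<Otimes>\<^sub>M lborel)"
  have d_lim: "(\<lambda>k. d k u) \<longlonglongrightarrow> u" for u
  proof (rule real_tendsto_sandwich)
    show "\<forall>\<^sub>F k in sequentially. u - 1 / real (Suc k) \<le> d k u"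
    proof (rule always_eventually, rule allI)
      fix k
      have "real (Suc k) * u - 1 \<le> real_of_int \<lfloor>real (Suc k) * u\<rfloor>" by linarith
      then have "(real (Suc k) * u - 1) / real (Suc k) \<le> d k u"
        unfolding d_def by (rule divide_right_mono) simp
      then show "u - 1 / real (Suc k) \<le> d k u" by (simp add: diff_divide_distrib del: of_nat_Suc)
    qed
    show "\<forall>\<^sub>F k in sequentially. d k u \<le> u"
    proof (rule always_eventually, rule allI)
      fix k
      have "real_of_int \<lfloor>real (Suc k) * u\<rfloor> / real (Suc k) \<le> (real (Suc k) * u) / real (Suc k)"
        by (rule divide_right_mono) (auto intro: of_int_floor_le)
      then show "d k u \<le> u" unfolding d_def by (simp del: of_nat_Suc)
    qed
    have "(\<lambda>k. u - 1 / real (Suc k)) \<longlonglongrightarrow> u - 0"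
      by (intro tendsto_diff tendsto_const LIMSEQ_Suc[OF lim_1_over_n])
    then show "(\<lambda>k. u - 1 / real (Suc k)) \<longlonglongrightarrow> u" by simp
  qed simp
  have "isCont (\<lambda>u. X u (fst z)) (snd z)"
    using cont[of "fst z"] z by (auto simp: space_pair_measure continuous_on_eq_continuous_at)
  from isCont_tendsto_compose[OF this d_lim]
  show "(\<lambda>k. X (real_of_int \<lfloor>real (Suc k) * snd z\<rfloor> / real (Suc k)) (fst z)) \<longlonglongrightarrow> X (snd z) (fst z)"
    unfolding d_def .
next
  fix k
  have 1: "(\<lambda>z. \<lfloor>real (Suc k) * snd z\<rfloor>) \<in> measurable (N \<Otimes>\<^sub>M lborel) (count_space (UNIV :: int set))"
    by measurable
  show "(\<lambda>z. X (real_of_int \<lfloor>real (Suc k) * snd z\<rfloor> / real (Suc k)) (fst z)) \<in> borel_measurable (N \<Otimes>\<^sub>M lborel)"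
    by (rule measurable_compose_countable[OF _ 1]) (use X in measurable)
qed

lemma integrable_const_interval: "integrable lborel (\<lambda>u. B * indicator {s..t} u :: real)" for s t :: real
  by (intro integrable_mult_right integrable_real_indicator) (auto simp: emeasure_lborel_Icc_eq)

lemma set_integrable_bounded_interval:
  fixes f :: "real \<Rightarrow> real"
  assumes "f \<in> borel_measurable borel" "\<And>u. u \<in> {s..t} \<Longrightarrow> \<bar>f u\<bar> \<le> B"
  shows "set_integrable lborel {s..t} f"
  unfolding set_integrable_def
proof (rule Bochner_Integration.integrable_bound[of lborel "\<lambda>u. B * indicator {s..t} u"])
  show "integrable lborel (\<lambda>u. B * indicator {s..t} u)" by (rule integrable_const_interval)
  show "(\<lambda>u. indicator {s..t} u *\<^sub>R f u) \<in> borel_measurable lborel" using assms(1) by measurable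
  show "AE u in lborel. norm (indicator {s..t} u *\<^sub>R f u) \<le> norm (B * indicator {s..t} u)"
    using assms(2) by (intro AE_I2) (auto simp: indicator_def intro: order_trans[OF _ abs_ge_self])
qed

lemma AE_lborel_neq: "AE u in lborel. u \<noteq> (s :: real)"
  by (rule AE_I[of _ _ "{s}"]) auto

text \<open>Convergence is required on the left-open interval only, since step functions on a grid
  vanish at \<open>s\<close>.\<close>

lemma set_integral_bounded_convergence:
  fixes f :: "nat \<Rightarrow> real \<Rightarrow> real"
  assumes f: "\<And>k. f k \<in> borel_measurable borel" and g: "g \<in> borel_measurable borel"
    and B: "\<And>k u. u \<in> {s..t} \<Longrightarrow> \<bar>f k u\<bar> \<le> B"
    and lim: "\<And>u. u \<in> {s<..t} \<Longrightarrow> (\<lambda>k. f k u) \<longlonglongrightarrow> g u"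
  shows "(\<lambda>k. LBINT u:{s..t}. f k u) \<longlonglongrightarrow> (LBINT u:{s..t}. g u)"
  unfolding set_lebesgue_integral_def
proof (rule integral_dominated_convergence[where w = "\<lambda>u. B * indicator {s..t} u"])
  show "AE u in lborel. (\<lambda>k. indicator {s..t} u *\<^sub>R f k u) \<longlonglongrightarrow> indicator {s..t} u *\<^sub>R g u"
    using AE_lborel_neq[of s]
  proof eventually_elim
    case (elim u)
    show ?case
    proof (cases "u \<in> {s..t}")
      case True
      then show ?thesis using lim[of u] elim by auto
    qed auto
  qed
  show "AE u in lborel. norm (indicator {s..t} u *\<^sub>R f k u) \<le> B * indicator {s..t} u" for k
    using B by (intro AE_I2) (auto simp: indicator_def)
  show "integrable lborel (\<lambda>u. B * indicator {s..t} u)" by (rule integrable_const_interval)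
qed (use f g in measurable)

lemma set_integral_split_interval:
  fixes f :: "real \<Rightarrow> real"
  assumes "set_integrable lborel {s..u} f" "s \<le> t" "t \<le> u"
  shows "(LBINT v:{s..u}. f v) = (LBINT v:{s..t}. f v) + (LBINT v:{t..u}. f v)"
proof -
  have i: "set_integrable lborel {s..t} f" "set_integrable lborel {t..u} f"
    by (rule set_integrable_subset[OF assms(1)]; use assms(2,3) in auto)+
  have "(LBINT v:{s..u}. f v) = (\<integral>v. indicator {s..t} v *\<^sub>R f v + indicator {t..u} v *\<^sub>R f v \<partial>lborel)"
    unfolding set_lebesgue_integral_def
  proof (rule integral_cong_AE)
    show "AE v in lborel. indicator {s..u} v *\<^sub>R f v = indicator {s..t} v *\<^sub>R f v + indicator {t..u} v *\<^sub>R f v"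
      using AE_lborel_neq[of t] by eventually_elim (use assms(2,3) in \<open>auto simp: indicator_def\<close>)
  qed (use assms(1) i in \<open>auto simp: set_integrable_def\<close>)
  then show ?thesis
    using i unfolding set_lebesgue_integral_def set_integrable_def by (simp add: Bochner_Integration.integral_add)
qed

lemma simple_value_borel: "(\<lambda>u. simple_value n p \<xi> u \<omega>) \<in> borel_measurable borel"
  unfolding simple_value_def by measurable

lemma simple_value_measurable_pair:
  assumes "\<And>i. i < n \<Longrightarrow> \<xi> i \<in> borel_measurable N"
  shows "(\<lambda>z. simple_value n p \<xi> (snd z) (fst z)) \<in> borel_measurable (N \<Otimes>\<^sub>M lborel)"
  unfolding simple_value_def
proof (rule borel_measurable_sum)
  fix i assume "i \<in> {..<n}"
  then have [measurable]: "\<xi> i \<in> borel_measurable N" using assms by simp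
  show "(\<lambda>z. \<xi> i (fst z) * indicator {p i<..p (Suc i)} (snd z)) \<in> borel_measurable (N \<Otimes>\<^sub>M lborel)"
    by measurable
qed

lemma simple_value_abs_le: "\<bar>simple_value n p \<xi> u \<omega>\<bar> \<le> (\<Sum>i<n. \<bar>\<xi> i \<omega>\<bar>)"
proof -
  have "\<bar>simple_value n p \<xi> u \<omega>\<bar> \<le> (\<Sum>i<n. \<bar>\<xi> i \<omega> * indicator {p i<..p (Suc i)} u\<bar>)"
    unfolding simple_value_def by (rule sum_abs)
  also have "\<dots> \<le> (\<Sum>i<n. \<bar>\<xi> i \<omega>\<bar>)" by (intro sum_mono) (auto simp: indicator_def)
  finally show ?thesis .
qed

lemma set_integral_measurable_pair:
  fixes s t :: real
  assumes "(\<lambda>z. f (fst z) (snd z)) \<in> borel_measurable (N \<Otimes>\<^sub>M lborel)"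
  shows "(\<lambda>\<omega>. LBINT u:{s..t}. (f \<omega> u :: real)) \<in> borel_measurable N"
proof -
  have "(\<lambda>z. indicator {s..t} (snd z) *\<^sub>R f (fst z) (snd z)) \<in> borel_measurable (N \<Otimes>\<^sub>M lborel)"
    by (intro borel_measurable_scaleR assms measurable_compose[OF measurable_snd borel_measurable_indicator]) auto
  then show ?thesis
    unfolding set_lebesgue_integral_def
    by (intro lborel.borel_measurable_lebesgue_integral) (simp add: case_prod_beta)
qed

text \<open>The uniform grid with \<open>(k + 1)\<^sup>4\<close> cells; truncating the coefficients at height \<open>k + 1\<close>
  keeps the accumulated third-order Taylor errors negligible.\<close>

definition cells :: "nat \<Rightarrow> nat" where "cells k = Suc k ^ 4"

definition ugrid :: "real \<Rightarrow> real \<Rightarrow> nat \<Rightarrow> nat \<Rightarrow> real" where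
  "ugrid s t k i = s + real i * ((t - s) / real (cells k))"

abbreviation ustep :: "real \<Rightarrow> real \<Rightarrow> nat \<Rightarrow> (nat \<Rightarrow> 'a \<Rightarrow> real) \<Rightarrow> real \<Rightarrow> 'a \<Rightarrow> real" where
  "ustep s t k \<equiv> simple_value (cells k) (ugrid s t k)"

lemma cells_pos: "0 < cells k"
  by (simp add: cells_def)

lemma ugrid_0 [simp]: "ugrid s t k 0 = s"
  by (simp add: ugrid_def)

lemma ugrid_cells [simp]: "ugrid s t k (cells k) = t"
  using cells_pos[of k] by (simp add: ugrid_def)

lemma ugrid_diff: "ugrid s t k (Suc i) - ugrid s t k i = (t - s) / real (cells k)"
  by (simp add: ugrid_def algebra_simps add_divide_distrib diff_divide_distrib)

lemma ugrid_less: "s < t \<Longrightarrow> ugrid s t k i < ugrid s t k (Suc i)"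
  using ugrid_diff[of s t k i] cells_pos[of k] by (smt (verit) divide_pos_pos of_nat_0_less_iff)

lemma ugrid_bounds:
  assumes "s < t" "i \<le> cells k"
  shows "s \<le> ugrid s t k i" "ugrid s t k i \<le> t"
  using mono_grid[of "cells k" "ugrid s t k" 0 i] mono_grid[of "cells k" "ugrid s t k" i "cells k"]
    ugrid_less[OF assms(1)] assms(2) by auto

lemma cells_tendsto: "(\<lambda>k. c / real (cells k)) \<longlonglongrightarrow> 0"
proof (rule Lim_null_comparison)
  show "\<forall>\<^sub>F k in sequentially. norm (c / real (cells k)) \<le> \<bar>c\<bar> * (1 / real (Suc k))"
  proof (rule always_eventually, rule allI)
    fix k
    have "real (Suc k) \<le> real (cells k)"
      unfolding cells_def of_nat_power using power_increasing[of 1 4 "real (Suc k)"] by simp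
    then have "\<bar>c\<bar> / real (cells k) \<le> \<bar>c\<bar> / real (Suc k)"
      by (intro divide_left_mono) (auto simp: cells_pos)
    then show "norm (c / real (cells k)) \<le> \<bar>c\<bar> * (1 / real (Suc k))" by simp
  qed
  have "(\<lambda>k. \<bar>c\<bar> * (1 / real (Suc k))) \<longlonglongrightarrow> \<bar>c\<bar> * 0"
    by (intro tendsto_mult tendsto_const LIMSEQ_Suc[OF lim_1_over_n])
  then show "(\<lambda>k. \<bar>c\<bar> * (1 / real (Suc k))) \<longlonglongrightarrow> 0" by simp
qed

text \<open>\<open>idx k\<close> is the cell of the \<open>k\<close>-th grid containing
  \<open>u\<close>. Its left node tends to \<open>u\<close>, which gives pointwise convergence of
  step functions sampled at left nodes from a continuous path.\<close>

lemma ugrid_index: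
  assumes "s < t" "u \<in> {s<..t}"
  obtains idx :: "nat \<Rightarrow> nat" where "\<And>k. idx k < cells k" "\<And>k. ugrid s t k (idx k) < u"
    "\<And>k c (\<omega>::'a). ustep s t k c u \<omega> = c (idx k) \<omega>"
    "(\<lambda>k. ugrid s t k (idx k)) \<longlonglongrightarrow> u"
proof -
  have "\<exists>i. i < cells k \<and> ugrid s t k i < u \<and> u \<le> ugrid s t k (Suc i)" for k
    using grid_find[of "ugrid s t k" u "cells k"] assms by auto
  then obtain idx where idx: "\<And>k. idx k < cells k" "\<And>k. ugrid s t k (idx k) < u" "\<And>k. u \<le> ugrid s t k (Suc (idx k))"
    by metis
  have sv: "ustep s t k c u \<omega> = c (idx k) \<omega>" for k c and \<omega> :: 'a
    by (rule simple_value_eq) (use idx ugrid_less[OF assms(1)] in auto)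
  have "(\<lambda>k. ugrid s t k (idx k)) \<longlonglongrightarrow> u"
  proof (rule real_tendsto_sandwich)
    show "\<forall>\<^sub>F k in sequentially. u - (t - s) / real (cells k) \<le> ugrid s t k (idx k)"
    proof (rule always_eventually, rule allI)
      fix k show "u - (t - s) / real (cells k) \<le> ugrid s t k (idx k)"
        using idx(3)[of k] ugrid_diff[of s t k "idx k"] by linarith
    qed
    show "\<forall>\<^sub>F k in sequentially. ugrid s t k (idx k) \<le> u"
      using idx(2) by (intro always_eventually allI less_imp_le)
    have "(\<lambda>k. u - (t - s) / real (cells k)) \<longlonglongrightarrow> u - 0"
      by (intro tendsto_diff tendsto_const cells_tendsto)
    then show "(\<lambda>k. u - (t - s) / real (cells k)) \<longlonglongrightarrow> u" by simp
  qed simp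
  with idx(1,2) sv show ?thesis by (rule that)
qed

lemma tendsto_min_Suc:
  fixes y :: "nat \<Rightarrow> real"
  assumes "y \<longlonglongrightarrow> l"
  shows "(\<lambda>k. min (y k) (real (Suc k))) \<longlonglongrightarrow> l"
proof -
  have "\<forall>\<^sub>F k in sequentially. y k < l + 1" using order_tendstoD(2)[OF assms, of "l + 1"] by simp
  moreover have "\<forall>\<^sub>F k in sequentially. l + 1 \<le> real (Suc k)"
    using filterlim_at_top[of real sequentially] filterlim_real_sequentially
    by (auto elim!: eventually_mono simp: filterlim_at_top)
  ultimately have "\<forall>\<^sub>F k in sequentially. y k = min (y k) (real (Suc k))"
    by eventually_elim auto
  from Lim_transform_eventually[OF assms this] show ?thesis .
qed

context standard_wiener_process
begin

lemma lenglart_simple_diff_tendsto: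
  assumes p: "\<And>k. simple_process F (n k) (p k) (\<xi> k)" and p': "\<And>k. simple_process F (n' k) (p' k) (\<xi>' k)"
    and st: "0 \<le> s" "s < t" and U: "\<And>k. finite (U k)" "\<And>k. U k \<subseteq> {s..t}" and "0 < \<epsilon>"
    and lim: "tendsto_in_probability M (\<lambda>k \<omega>. LBINT u:{s..t}.
        (simple_value (n k) (p k) (\<xi> k) u \<omega> - simple_value (n' k) (p' k) (\<xi>' k) u \<omega>)\<^sup>2) (\<lambda>_. 0)"
  shows "(\<lambda>k. prob {\<omega>\<in>space M. \<exists>u\<in>U k. \<epsilon> <
      \<bar>(simple_integral_process W (n k) (p k) (\<xi> k) u \<omega> - simple_integral_process W (n k) (p k) (\<xi> k) s \<omega>) -
      (simple_integral_process W (n' k) (p' k) (\<xi>' k) u \<omega> - simple_integral_process W (n' k) (p' k) (\<xi>' k) s \<omega>)\<bar>}) \<longlonglongrightarrow> 0"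
    (is "?P \<longlonglongrightarrow> 0")
proof (rule LIMSEQ_I)
  fix e :: real assume "0 < e"
  \<comment> \<open>Half of the tolerance \<open>e\<close> is spent on the term
    \<open>\<delta> / \<epsilon>\<^sup>2\<close> of the Lenglart bound; the other half is left for
    the probability that tends to 0.\<close>
  define \<delta> where "\<delta> = e * \<epsilon>\<^sup>2 / 2"
  have \<delta>: "0 < \<delta>" "\<delta> / \<epsilon>\<^sup>2 = e / 2" using \<open>0 < e\<close> \<open>0 < \<epsilon>\<close> by (auto simp: \<delta>_def)
  define J where "J = (\<lambda>k \<omega>. LBINT u:{s..t}.
        (simple_value (n k) (p k) (\<xi> k) u \<omega> - simple_value (n' k) (p' k) (\<xi>' k) u \<omega>)\<^sup>2)"
  have "\<forall>\<^sub>F k in sequentially. prob {\<omega>\<in>space M. \<delta> < \<bar>J k \<omega>\<bar>} < e / 2"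
    unfolding J_def using order_tendstoD(2)[OF tendsto_in_probability_zeroD(2)[OF lim \<delta>(1)], of "e / 2"] \<open>0 < e\<close> by simp
  then obtain K where K: "\<And>k. k \<ge> K \<Longrightarrow> prob {\<omega>\<in>space M. \<delta> < \<bar>J k \<omega>\<bar>} < e / 2"
    by (auto simp: eventually_sequentially)
  have [measurable]: "J k \<in> borel_measurable M" for k
    unfolding J_def by (rule tendsto_in_probability_zeroD(1)[OF lim])
  have "?P k < e" if "k \<ge> K" for k
  proof -
    have "?P k \<le> \<delta> / \<epsilon>\<^sup>2 + prob {\<omega>\<in>space M. \<delta> < J k \<omega>}"
      unfolding J_def by (rule lenglart_simple_diff[OF p p' st U \<open>0 < \<epsilon>\<close> \<delta>(1)])
    also have "prob {\<omega>\<in>space M. \<delta> < J k \<omega>} \<le> prob {\<omega>\<in>space M. \<delta> < \<bar>J k \<omega>\<bar>}"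
      by (rule finite_measure_mono) auto
    finally show ?thesis using K[OF that] \<delta>(2) by simp
  qed
  then show "\<exists>no. \<forall>k\<ge>no. norm (?P k - 0) < e" by auto
qed

end

section \<open>Euler approximation\<close>

text \<open>The setting for a regularised solution: every path is continuous on the whole line,
  nonnegative and equal to \<open>r0\<close> up to time 0, so that no exceptional sets have to be
  carried along for path properties. Of the Ito integral only the approximation property
  \<open>I_approx\<close> and the integral equation are kept.\<close>

locale cir = standard_wiener_process M W for M :: "'a measure" and W +
  fixes X I :: "real \<Rightarrow> 'a \<Rightarrow> real" and a b \<sigma> r0 :: real
  assumes pos: "0 < a" "0 < b" "0 < \<sigma>" "0 < r0"
    and X_F: "\<And>t. 0 \<le> t \<Longrightarrow> X t \<in> borel_measurable (F t)"
    and X_init: "\<And>t \<omega>. t \<le> 0 \<Longrightarrow> X t \<omega> = r0"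
    and X_cont: "\<And>\<omega>. continuous_on UNIV (\<lambda>t. X t \<omega>)"
    and X_nonneg: "\<And>t \<omega>. 0 \<le> X t \<omega>"
    and I_approx: "\<And>t. 0 \<le> t \<Longrightarrow> \<exists>n s \<xi>. (\<forall>k::nat. simple_process F (n k) (s k) (\<xi> k)) \<and>
      tendsto_in_probability M
        (\<lambda>k \<omega>. LBINT u:{0..t}. (simple_value (n k) (s k) (\<xi> k) u \<omega> - \<sigma> * sqrt (X u \<omega>))\<^sup>2) (\<lambda>_. 0) \<and>
      tendsto_in_probability M (\<lambda>k. simple_integral_process W (n k) (s k) (\<xi> k) t) (I t)"
    and X_eq: "AE \<omega> in M. \<forall>t\<ge>0. X t \<omega> = r0 + (LBINT u:{0..t}. a - b * X u \<omega>) + I t \<omega>"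
begin

lemma X_F': "s \<le> t \<Longrightarrow> X s \<in> borel_measurable (F t)"
proof (cases "0 \<le> s")
  case False
  then have "X s = (\<lambda>_. r0)" using X_init by auto
  then show ?thesis by simp
qed (auto intro: measurable_F_mono X_F)

lemma X_M [measurable]: "X t \<in> borel_measurable M"
  using X_F'[OF order_refl] by (rule measurable_F_M)

lemma X_path [measurable]: "(\<lambda>u. X u \<omega>) \<in> borel_measurable borel"
  using X_cont by (rule borel_measurable_continuous_onI)

lemma X_pair_M [measurable]: "(\<lambda>z. X (snd z) (fst z)) \<in> borel_measurable (M \<Otimes>\<^sub>M lborel)"
  by (rule continuous_process_measurable_pair) (auto intro: X_cont)

lemma X_isCont: "isCont (\<lambda>t. X t \<omega>) t"
  using X_cont continuous_on_eq_continuous_at[OF open_UNIV] by blast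

lemma X_bounded_on:
  obtains K where "0 \<le> K" "\<And>u. u \<in> {s..t} \<Longrightarrow> X u \<omega> \<le> K"
proof -
  have "compact ((\<lambda>u. X u \<omega>) ` {s..t})"
    by (intro compact_continuous_image continuous_on_subset[OF X_cont]) auto
  then have "bdd_above ((\<lambda>u. X u \<omega>) ` {s..t})"
    by (intro bounded_imp_bdd_above compact_imp_bounded)
  then obtain K where K: "\<And>u. u \<in> {s..t} \<Longrightarrow> X u \<omega> \<le> K" unfolding bdd_above_def by blast
  show ?thesis by (rule that[of "max K 0"]) (use K in \<open>auto intro: le_max_iff_disj[THEN iffD2]\<close>)
qed

lemma I_M: "0 \<le> t \<Longrightarrow> I t \<in> borel_measurable M"
  using I_approx[of t] by (auto simp: tendsto_in_probability_def)

abbreviation H :: "real \<Rightarrow> 'a \<Rightarrow> real" where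
  "H u \<omega> \<equiv> \<sigma> * sqrt (X u \<omega>)"

abbreviation gap :: "real \<Rightarrow> real \<Rightarrow> nat \<Rightarrow> (nat \<Rightarrow> real) \<Rightarrow> (nat \<Rightarrow> 'a \<Rightarrow> real) \<Rightarrow> 'a \<Rightarrow> real" where
  "gap s t n p \<xi> \<omega> \<equiv> LBINT u:{s..t}. (simple_value n p \<xi> u \<omega> - H u \<omega>)\<^sup>2"

lemma simple_diff_H_integrable:
  "set_integrable lborel {s..t} (\<lambda>u. (simple_value n p \<xi> u \<omega> - H u \<omega>)\<^sup>2)"
proof -
  obtain K where K: "0 \<le> K" "\<And>u. u \<in> {s..t} \<Longrightarrow> X u \<omega> \<le> K" using X_bounded_on by blast
  define B where "B = (\<Sum>i<n. \<bar>\<xi> i \<omega>\<bar>) + \<sigma> * sqrt K"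
  show ?thesis
  proof (rule set_integrable_bounded_interval)
    show "(\<lambda>u. (simple_value n p \<xi> u \<omega> - H u \<omega>)\<^sup>2) \<in> borel_measurable borel"
      using simple_value_borel[of n p \<xi> \<omega>] by measurable
    fix u assume "u \<in> {s..t}"
    then have "\<bar>H u \<omega>\<bar> \<le> \<sigma> * sqrt K" using K pos X_nonneg[of u \<omega>] by (simp add: abs_mult)
    then have "\<bar>simple_value n p \<xi> u \<omega> - H u \<omega>\<bar> \<le> B"
      using simple_value_abs_le[of n p \<xi> u \<omega>] unfolding B_def by linarith
    from power_mono[OF this abs_ge_zero, of 2]
    show "\<bar>(simple_value n p \<xi> u \<omega> - H u \<omega>)\<^sup>2\<bar> \<le> B\<^sup>2" by simp
  qed
qed

lemma simple_diff_H_measurable: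
  assumes "simple_process F n p \<xi>"
  shows "(\<lambda>\<omega>. gap s t n p \<xi> \<omega>) \<in> borel_measurable M"
proof (rule set_integral_measurable_pair)
  have [measurable]: "(\<lambda>z. simple_value n p \<xi> (snd z) (fst z)) \<in> borel_measurable (M \<Otimes>\<^sub>M lborel)"
    by (rule simple_value_measurable_pair) (use simple_processD(3)[OF assms] measurable_F_M in auto)
  show "(\<lambda>z. (simple_value n p \<xi> (snd z) (fst z) - H (snd z) (fst z))\<^sup>2) \<in> borel_measurable (M \<Otimes>\<^sub>M lborel)"
    by measurable
qed

lemma simple_diff_le_H:
  "(LBINT u:{s..t}. (simple_value n p \<xi> u \<omega> - simple_value n' p' \<xi>' u \<omega>)\<^sup>2) \<le>
    2 * ((gap s t n p \<xi> \<omega>) +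
         (gap s t n' p' \<xi>' \<omega>))"
proof -
  note i = simple_diff_H_integrable[of s t n p \<xi> \<omega>] simple_diff_H_integrable[of s t n' p' \<xi>' \<omega>]
  have "(x - y)\<^sup>2 \<le> 2 * ((x - h)\<^sup>2 + (y - h)\<^sup>2)" for x y h :: real
    using zero_le_power2[of "(x - h) + (y - h)"] by (simp add: power2_eq_square algebra_simps)
  then have "(LBINT u:{s..t}. (simple_value n p \<xi> u \<omega> - simple_value n' p' \<xi>' u \<omega>)\<^sup>2) \<le>
     (LBINT u:{s..t}. 2 * ((simple_value n p \<xi> u \<omega> - H u \<omega>)\<^sup>2 + (simple_value n' p' \<xi>' u \<omega> - H u \<omega>)\<^sup>2))"
  proof (intro set_integral_mono)
    show "set_integrable lborel {s..t} (\<lambda>u. (simple_value n p \<xi> u \<omega> - simple_value n' p' \<xi>' u \<omega>)\<^sup>2)"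
    proof (rule set_integrable_bounded_interval)
      show "(\<lambda>u. (simple_value n p \<xi> u \<omega> - simple_value n' p' \<xi>' u \<omega>)\<^sup>2) \<in> borel_measurable borel"
        by (intro borel_measurable_power borel_measurable_diff simple_value_borel)
      fix u
      have "\<bar>simple_value n p \<xi> u \<omega> - simple_value n' p' \<xi>' u \<omega>\<bar> \<le> (\<Sum>i<n. \<bar>\<xi> i \<omega>\<bar>) + (\<Sum>i<n'. \<bar>\<xi>' i \<omega>\<bar>)"
        using simple_value_abs_le[of n p \<xi> u \<omega>] simple_value_abs_le[of n' p' \<xi>' u \<omega>] by linarith
      from power_mono[OF this abs_ge_zero, of 2]
      show "\<bar>(simple_value n p \<xi> u \<omega> - simple_value n' p' \<xi>' u \<omega>)\<^sup>2\<bar> \<le> ((\<Sum>i<n. \<bar>\<xi> i \<omega>\<bar>) + (\<Sum>i<n'. \<bar>\<xi>' i \<omega>\<bar>))\<^sup>2"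
        by simp
    qed
  qed (auto intro!: set_integral_add i)
  also have "\<dots> = 2 * ((gap s t n p \<xi> \<omega>) +
         (gap s t n' p' \<xi>' \<omega>))"
    unfolding set_integral_mult_right set_integral_add(2)[OF i] ..
  finally show ?thesis .
qed

lemma diff_H_interval_mono:
  assumes "0 \<le> s" "t \<le> t'"
  shows "(gap s t n p \<xi> \<omega>) \<le> (gap 0 t' n p \<xi> \<omega>)"
proof -
  have "indicator {s..t} u *\<^sub>R y \<le> indicator {0..t'} u *\<^sub>R y" if "0 \<le> y" for u y :: real
    using assms that by (auto simp: indicator_def)
  then show ?thesis
    using simple_diff_H_integrable unfolding set_integrable_def set_lebesgue_integral_def
    by (intro integral_mono) auto
qed

lemma set_integral_square_nonneg: "0 \<le> (LBINT u:{s..t}. (f u :: real)\<^sup>2)" for s t :: real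
  unfolding set_lebesgue_integral_def by (intro Bochner_Integration.integral_nonneg) auto

text \<open>The sequence belonging to the final time \<open>t\<close> serves all earlier times. On
  [0,u] it and the sequence belonging to \<open>u\<close> are both close to \<open>H\<close> in mean
  square over time, hence close to each other, and the Lenglart inequality makes their integrals
  agree in the limit.\<close>

lemma I_approx_path:
  assumes "0 < t"
  obtains n s \<xi> where "\<And>k::nat. simple_process F (n k) (s k) (\<xi> k)"
    "tendsto_in_probability M
        (\<lambda>k \<omega>. gap 0 t (n k) (s k) (\<xi> k) \<omega>) (\<lambda>_. 0)"
    "\<And>u. 0 \<le> u \<Longrightarrow> u \<le> t \<Longrightarrow>
      tendsto_in_probability M (\<lambda>k \<omega>. simple_integral_process W (n k) (s k) (\<xi> k) u \<omega> - I u \<omega>) (\<lambda>_. 0)"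
proof -
  obtain n p \<xi> where 1: "\<And>k::nat. simple_process F (n k) (p k) (\<xi> k)"
    "tendsto_in_probability M
        (\<lambda>k \<omega>. gap 0 t (n k) (p k) (\<xi> k) \<omega>) (\<lambda>_. 0)"
    using I_approx[of t] assms by auto
  have "tendsto_in_probability M (\<lambda>k \<omega>. simple_integral_process W (n k) (p k) (\<xi> k) u \<omega> - I u \<omega>) (\<lambda>_. 0)"
    if u: "0 \<le> u" "u \<le> t" for u
  proof -
    obtain n' p' \<xi>' where 2: "\<And>k::nat. simple_process F (n' k) (p' k) (\<xi>' k)"
      "tendsto_in_probability M
        (\<lambda>k \<omega>. gap 0 u (n' k) (p' k) (\<xi>' k) \<omega>) (\<lambda>_. 0)"
      "tendsto_in_probability M (\<lambda>k. simple_integral_process W (n' k) (p' k) (\<xi>' k) u) (I u)"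
      using I_approx[OF u(1)] by auto
    define S where "S = (\<lambda>k. simple_integral_process W (n k) (p k) (\<xi> k))"
    define S' where "S' = (\<lambda>k. simple_integral_process W (n' k) (p' k) (\<xi>' k))"
    have S_M [measurable]: "S k u \<in> borel_measurable M" "S' k u \<in> borel_measurable M" for k
      unfolding S_def S'_def using 1(1) 2(1) u by (auto intro: simple_integral_process_measurable)
    have [measurable]: "I u \<in> borel_measurable M" by (rule I_M[OF u(1)])
    have S0: "S k 0 = (\<lambda>_. 0)" "S' k 0 = (\<lambda>_. 0)" for k
      using simple_processD(5)[OF 1(1)] simple_processD(5)[OF 2(1)]
      by (auto simp: S_def S'_def simple_integral_process_def fun_eq_iff intro!: sum.neutral)
    have A: "tendsto_in_probability M (\<lambda>k \<omega>. S k u \<omega> - S' k u \<omega>) (\<lambda>_. 0)"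
    \<comment> \<open>At time 0 both integrals vanish; the Lenglart lemma needs an interval of
      positive length.\<close>
    proof (cases "u = 0")
      case True
      then show ?thesis using S0 by (simp add: tendsto_in_probability_def)
    next
      case False
      then have "0 < u" using u by simp
      have lim: "tendsto_in_probability M (\<lambda>k \<omega>. LBINT v:{0..u}.
        (simple_value (n k) (p k) (\<xi> k) v \<omega> - simple_value (n' k) (p' k) (\<xi>' k) v \<omega>)\<^sup>2) (\<lambda>_. 0)"
      proof (rule tendsto_in_probability_zero_le[OF 1(2) 2(2), of _ 2])
        fix k
        show "AE \<omega> in M. \<bar>LBINT v:{0..u}. (simple_value (n k) (p k) (\<xi> k) v \<omega> - simple_value (n' k) (p' k) (\<xi>' k) v \<omega>)\<^sup>2\<bar> \<le>
           2 * (\<bar>gap 0 t (n k) (p k) (\<xi> k) \<omega>\<bar> +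
           \<bar>gap 0 u (n' k) (p' k) (\<xi>' k) \<omega>\<bar>)"
        proof (rule AE_I2)
          fix \<omega>
          show "\<bar>LBINT v:{0..u}. (simple_value (n k) (p k) (\<xi> k) v \<omega> - simple_value (n' k) (p' k) (\<xi>' k) v \<omega>)\<^sup>2\<bar> \<le>
           2 * (\<bar>gap 0 t (n k) (p k) (\<xi> k) \<omega>\<bar> +
           \<bar>gap 0 u (n' k) (p' k) (\<xi>' k) \<omega>\<bar>)"
            using simple_diff_le_H[of 0 u "n k" "p k" "\<xi> k" \<omega> "n' k" "p' k" "\<xi>' k"]
              diff_H_interval_mono[of 0 u t "n k" "p k" "\<xi> k" \<omega>] u
            by (simp add: set_integral_square_nonneg)
        qed
        show "(\<lambda>\<omega>. LBINT v:{0..u}. (simple_value (n k) (p k) (\<xi> k) v \<omega> - simple_value (n' k) (p' k) (\<xi>' k) v \<omega>)\<^sup>2)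
          \<in> borel_measurable M"
        proof (rule set_integral_measurable_pair)
          show "(\<lambda>z. (simple_value (n k) (p k) (\<xi> k) (snd z) (fst z) - simple_value (n' k) (p' k) (\<xi>' k) (snd z) (fst z))\<^sup>2)
             \<in> borel_measurable (M \<Otimes>\<^sub>M lborel)"
            using simple_processD(3)[OF 1(1)] simple_processD(3)[OF 2(1)]
            by (intro borel_measurable_power borel_measurable_diff simple_value_measurable_pair) (blast intro: measurable_F_M)+
        qed
      qed simp
      show ?thesis
        unfolding tendsto_in_probability_def
      proof (intro conjI allI impI)
        fix \<epsilon> :: real assume "0 < \<epsilon>"
        have "{u} \<subseteq> {0..u}" using u by simp
        from lenglart_simple_diff_tendsto[OF 1(1) 2(1) order_refl \<open>0 < u\<close> _ this \<open>0 < \<epsilon>\<close> lim]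
        show "(\<lambda>k. prob {\<omega>\<in>space M. \<epsilon> < \<bar>S k u \<omega> - S' k u \<omega> - 0\<bar>}) \<longlonglongrightarrow> 0"
          using S0 unfolding S_def S'_def by simp
      qed auto
    qed
    have B: "tendsto_in_probability M (\<lambda>k \<omega>. S' k u \<omega> - I u \<omega>) (\<lambda>_. 0)"
      using 2(3) S_M(2) unfolding tendsto_in_probability_def S'_def by auto
    have "tendsto_in_probability M (\<lambda>k \<omega>. S k u \<omega> - I u \<omega>) (\<lambda>_. 0)"
      by (rule tendsto_in_probability_zero_le[OF A B, of _ 1]) auto
    then show ?thesis unfolding S_def .
  qed
  with 1 show ?thesis by (rule that)
qed

text \<open>The value is frozen at the left node, which makes it adapted, and cut off at
  \<open>k + 1\<close>, which supplies the bound that \<open>simple_process\<close> demands.\<close>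

definition vol :: "real \<Rightarrow> real \<Rightarrow> nat \<Rightarrow> nat \<Rightarrow> 'a \<Rightarrow> real" where
  "vol s t k i \<omega> = \<sigma> * sqrt (min (X (ugrid s t k i) \<omega>) (real (Suc k)))"

definition drift :: "real \<Rightarrow> real \<Rightarrow> nat \<Rightarrow> nat \<Rightarrow> 'a \<Rightarrow> real" where
  "drift s t k i \<omega> = a - b * min (X (ugrid s t k i) \<omega>) (real (Suc k))"

lemma vol_bounds: "0 \<le> vol s t k i \<omega>" "vol s t k i \<omega> \<le> \<sigma> * sqrt (real (Suc k))"
  using pos X_nonneg by (auto simp: vol_def simp del: of_nat_Suc)

lemma vol_F: "ugrid s t k i \<le> u \<Longrightarrow> vol s t k i \<in> borel_measurable (F u)"
  using X_F'[of "ugrid s t k i" u] unfolding vol_def by measurable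

lemma drift_F: "ugrid s t k i \<le> u \<Longrightarrow> drift s t k i \<in> borel_measurable (F u)"
  using X_F'[of "ugrid s t k i" u] unfolding drift_def by measurable

lemma simple_process_vol:
  assumes "0 \<le> s" "s < t"
  shows "simple_process F (cells k) (ugrid s t k) (vol s t k)"
  unfolding simple_process_def
proof (intro conjI allI impI)
  fix i
  show "\<exists>C. \<forall>\<omega>\<in>space (F (ugrid s t k i)). \<bar>vol s t k i \<omega>\<bar> \<le> C"
    using vol_bounds[of s t k i] by (intro exI[of _ "\<sigma> * sqrt (real (Suc k))"]) (simp add: abs_of_nonneg)
qed (use assms ugrid_less[of s t] in \<open>auto intro: vol_F\<close>)

text \<open>Dominated convergence for each single path: a continuous path is bounded on [s,t], and
  its values at left nodes converge, the cut-off being passed by no value from some \<open>k\<close>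
  on.\<close>

lemma vol_converges:
  assumes "s < t"
  shows "(\<lambda>k. gap s t (cells k) (ugrid s t k) (vol s t k) \<omega>) \<longlonglongrightarrow> 0"
proof -
  obtain K where K: "0 \<le> K" "\<And>u. u \<in> {s..t} \<Longrightarrow> X u \<omega> \<le> K" using X_bounded_on by blast
  have vK: "ustep s t k (vol s t k) u \<omega> \<in> {0..\<sigma> * sqrt K}" if "u \<in> {s..t}" for u k
  proof (cases "u = s")
    case True
    then have "ustep s t k (vol s t k) u \<omega> = 0"
      by (intro simple_value_outside ugrid_less assms) auto
    then show ?thesis using K pos by simp
  next
    case False
    then have u: "u \<in> {s<..t}" using that by auto
    obtain idx where idx: "\<And>k. idx k < cells k"
      "\<And>k c (\<omega>::'a). ustep s t k c u \<omega> = c (idx k) \<omega>"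
      by (rule ugrid_index[OF assms u]) (rule that)
    have "min (X (ugrid s t k (idx k)) \<omega>) (real (Suc k)) \<le> K"
      using K(2)[of "ugrid s t k (idx k)"] ugrid_bounds[OF assms less_imp_le[OF idx(1)[of k]]] by auto
    then show ?thesis using vol_bounds(1)[of s t k "idx k" \<omega>] pos
      unfolding idx(2) by (auto simp: vol_def)
  qed
  have "(\<lambda>k. gap s t (cells k) (ugrid s t k) (vol s t k) \<omega>) \<longlonglongrightarrow> (LBINT u:{s..t}. 0)"
  proof (rule set_integral_bounded_convergence)
    show "(\<lambda>u. (ustep s t k (vol s t k) u \<omega> - H u \<omega>)\<^sup>2) \<in> borel_measurable borel" for k
      using simple_value_borel[of "cells k" "ugrid s t k" "vol s t k" \<omega>] by measurable
    show "\<bar>(ustep s t k (vol s t k) u \<omega> - H u \<omega>)\<^sup>2\<bar> \<le> (\<sigma> * sqrt K)\<^sup>2" if "u \<in> {s..t}" for k u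
    proof -
      have "H u \<omega> \<in> {0..\<sigma> * sqrt K}" using K(2)[OF that] pos X_nonneg[of u \<omega>] by auto
      with vK[OF that, of k] have "\<bar>ustep s t k (vol s t k) u \<omega> - H u \<omega>\<bar> \<le> \<sigma> * sqrt K"
        by auto
      from power_mono[OF this abs_ge_zero, of 2] show ?thesis by simp
    qed
    fix u assume u: "u \<in> {s<..t}"
    obtain idx where idx: "\<And>k c (\<omega>::'a). ustep s t k c u \<omega> = c (idx k) \<omega>"
      "(\<lambda>k. ugrid s t k (idx k)) \<longlonglongrightarrow> u"
      by (rule ugrid_index[OF assms u]) (rule that)
    have "(\<lambda>k. min (X (ugrid s t k (idx k)) \<omega>) (real (Suc k))) \<longlonglongrightarrow> X u \<omega>"
      by (intro tendsto_min_Suc isCont_tendsto_compose[OF X_isCont idx(2)])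
    then have "(\<lambda>k. (vol s t k (idx k) \<omega> - H u \<omega>)\<^sup>2) \<longlonglongrightarrow> (\<sigma> * sqrt (X u \<omega>) - H u \<omega>)\<^sup>2"
      unfolding vol_def by (intro tendsto_intros)
    then show "(\<lambda>k. (ustep s t k (vol s t k) u \<omega> - H u \<omega>)\<^sup>2) \<longlonglongrightarrow> 0"
      unfolding idx(1) by simp
  qed simp
  then show ?thesis by simp
qed

lemma drift_converges:
  assumes "s < t"
  shows "(\<lambda>k. LBINT u:{s..t}. \<bar>(a - b * X u \<omega>) - ustep s t k (drift s t k) u \<omega>\<bar>) \<longlonglongrightarrow> 0"
proof -
  obtain K where K: "0 \<le> K" "\<And>u. u \<in> {s..t} \<Longrightarrow> X u \<omega> \<le> K" using X_bounded_on by blast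
  have dK: "\<bar>ustep s t k (drift s t k) u \<omega>\<bar> \<le> a + b * K" if "u \<in> {s..t}" for u k
  proof (cases "u = s")
    case True
    then have "ustep s t k (drift s t k) u \<omega> = 0"
      by (intro simple_value_outside ugrid_less assms) auto
    then show ?thesis using K pos by simp
  next
    case False
    then have u: "u \<in> {s<..t}" using that by auto
    obtain idx where idx: "\<And>k. idx k < cells k"
      "\<And>k c (\<omega>::'a). ustep s t k c u \<omega> = c (idx k) \<omega>"
      by (rule ugrid_index[OF assms u]) (rule that)
    have "min (X (ugrid s t k (idx k)) \<omega>) (real (Suc k)) \<in> {0..K}"
      using K(2)[of "ugrid s t k (idx k)"] ugrid_bounds[OF assms less_imp_le[OF idx(1)[of k]]] X_nonneg by auto
    then have "0 \<le> b * min (X (ugrid s t k (idx k)) \<omega>) (real (Suc k))"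
      "b * min (X (ugrid s t k (idx k)) \<omega>) (real (Suc k)) \<le> b * K"
      using pos unfolding atLeastAtMost_iff by (blast intro: mult_nonneg_nonneg less_imp_le, intro mult_left_mono) auto
    then show ?thesis using pos(1) unfolding idx(2) drift_def abs_le_iff by linarith
  qed
  have "(\<lambda>k. LBINT u:{s..t}. \<bar>(a - b * X u \<omega>) - ustep s t k (drift s t k) u \<omega>\<bar>) \<longlonglongrightarrow> (LBINT u:{s..t}. 0)"
  proof (rule set_integral_bounded_convergence)
    show "(\<lambda>u. \<bar>(a - b * X u \<omega>) - ustep s t k (drift s t k) u \<omega>\<bar>) \<in> borel_measurable borel" for k
      using simple_value_borel[of "cells k" "ugrid s t k" "drift s t k" \<omega>] by measurable
    show "\<bar>\<bar>(a - b * X u \<omega>) - ustep s t k (drift s t k) u \<omega>\<bar>\<bar> \<le> 2 * (a + b * K)" if "u \<in> {s..t}" for k u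
    proof -
      have "0 \<le> b * X u \<omega>" "b * X u \<omega> \<le> b * K" using K(2)[OF that] pos X_nonneg[of u \<omega>] by auto
      with dK[OF that, of k] pos(1) show ?thesis unfolding abs_abs distrib_left abs_le_iff by linarith
    qed
    fix u assume u: "u \<in> {s<..t}"
    obtain idx where idx: "\<And>k c (\<omega>::'a). ustep s t k c u \<omega> = c (idx k) \<omega>"
      "(\<lambda>k. ugrid s t k (idx k)) \<longlonglongrightarrow> u"
      by (rule ugrid_index[OF assms u]) (rule that)
    have "(\<lambda>k. min (X (ugrid s t k (idx k)) \<omega>) (real (Suc k))) \<longlonglongrightarrow> X u \<omega>"
      by (intro tendsto_min_Suc isCont_tendsto_compose[OF X_isCont idx(2)])
    then have "(\<lambda>k. \<bar>(a - b * X u \<omega>) - drift s t k (idx k) \<omega>\<bar>) \<longlonglongrightarrow> \<bar>(a - b * X u \<omega>) - (a - b * X u \<omega>)\<bar>"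
      unfolding drift_def by (intro tendsto_intros)
    then show "(\<lambda>k. \<bar>(a - b * X u \<omega>) - ustep s t k (drift s t k) u \<omega>\<bar>) \<longlonglongrightarrow> 0"
      unfolding idx(1) by simp
  qed simp
  then show ?thesis by simp
qed

end

lemma Max_abs_nonneg:
  fixes f :: "'b \<Rightarrow> real"
  assumes "finite A" "A \<noteq> {}"
  shows "0 \<le> Max ((\<lambda>j. \<bar>f j\<bar>) ` A)"
proof -
  obtain x where "x \<in> A" using assms by blast
  then have "\<bar>f x\<bar> \<le> Max ((\<lambda>j. \<bar>f j\<bar>) ` A)" using assms by (intro Max_ge) auto
  then show ?thesis by (rule order_trans[OF abs_ge_zero])
qed

context cir
begin

lemma simple_integral_vol:
  assumes "s < t" "j \<le> cells k"
  shows "simple_integral_process W (cells k) (ugrid s t k) (vol s t k) (ugrid s t k j) \<omega> -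
      simple_integral_process W (cells k) (ugrid s t k) (vol s t k) s \<omega> =
    (\<Sum>i<j. vol s t k i \<omega> * (W (ugrid s t k (Suc i)) \<omega> - W (ugrid s t k i) \<omega>))"
proof -
  have "refines_grid (cells k) (ugrid s t k) (cells k) (ugrid s t k)"
    by (rule refines_gridI[where s = s and t = t]) (use ugrid_less[OF assms(1)] in simp_all)
  from simple_integral_refined[OF this ugrid_less[OF assms(1)] ugrid_less[OF assms(1)] assms(2), of W "vol s t k" \<omega>]
  have "simple_integral_process W (cells k) (ugrid s t k) (vol s t k) (ugrid s t k j) \<omega> -
      simple_integral_process W (cells k) (ugrid s t k) (vol s t k) s \<omega> =
    (\<Sum>i<j. ustep s t k (vol s t k) (ugrid s t k (Suc i)) \<omega> *
       (W (ugrid s t k (Suc i)) \<omega> - W (ugrid s t k i) \<omega>))" by simp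
  also have "\<dots> = (\<Sum>i<j. vol s t k i \<omega> * (W (ugrid s t k (Suc i)) \<omega> - W (ugrid s t k i) \<omega>))"
    using assms by (intro sum.cong arg_cong2[where f = "(*)"] simple_value_eq ugrid_less) auto
  finally show ?thesis .
qed

definition noise :: "real \<Rightarrow> real \<Rightarrow> nat \<Rightarrow> nat \<Rightarrow> 'a \<Rightarrow> real" where
  "noise s t k j \<omega> = (\<Sum>i<j. vol s t k i \<omega> * (W (ugrid s t k (Suc i)) \<omega> - W (ugrid s t k i) \<omega>))"

lemma ugrid_nonneg: "0 \<le> s \<Longrightarrow> s < t \<Longrightarrow> 0 \<le> ugrid s t k i"
  using cells_pos[of k] by (simp add: ugrid_def)

lemma noise_M:
  assumes "0 \<le> s" "s < t"
  shows "noise s t k j \<in> borel_measurable M"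
  unfolding noise_def
  using measurable_F_M[OF vol_F[OF order_refl]] ugrid_nonneg[OF assms]
  by (intro borel_measurable_sum borel_measurable_times borel_measurable_diff measurable_W) auto

text \<open>With \<open>k\<close> fixed, \<open>I\<close> is replaced at the finitely many grid
  times by the integrals of the simple processes from \<open>I_approx_path\<close>. Their distance
  from \<open>noise\<close> is controlled by the Lenglart inequality uniformly over the grid, and
  the replacement error vanishes as \<open>m\<close> tends to infinity.\<close>

lemma noise_bound:
  assumes st: "0 \<le> s" "s < t" and "0 < \<epsilon>" "0 < \<delta>"
  shows "prob {\<omega>\<in>space M. \<exists>j\<in>{..cells k}. 2 * \<epsilon> < \<bar>(I (ugrid s t k j) \<omega> - I s \<omega>) - noise s t k j \<omega>\<bar>} \<le>
    \<delta> / \<epsilon>\<^sup>2 + prob {\<omega>\<in>space M. \<delta> / 4 < (gap s t (cells k) (ugrid s t k) (vol s t k) \<omega>)}"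
    (is "?P \<le> _ + ?R")
proof -
  have t: "0 < t" using st by simp
  obtain n p \<xi> where 1: "\<And>m::nat. simple_process F (n m) (p m) (\<xi> m)"
    and 2: "tendsto_in_probability M
        (\<lambda>m \<omega>. gap 0 t (n m) (p m) (\<xi> m) \<omega>) (\<lambda>_. 0)"
    and 3: "\<And>u. 0 \<le> u \<Longrightarrow> u \<le> t \<Longrightarrow>
      tendsto_in_probability M (\<lambda>m \<omega>. simple_integral_process W (n m) (p m) (\<xi> m) u \<omega> - I u \<omega>) (\<lambda>_. 0)"
    by (rule I_approx_path[OF t]) (rule that)
  note vp = simple_process_vol[OF st, of k]
  define S where "S = (\<lambda>m u \<omega>. simple_integral_process W (n m) (p m) (\<xi> m) u \<omega>)"
  define q where "q = ugrid s t k"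
  have q: "s \<le> q j" "q j \<le> t" "0 \<le> q j" if "j \<le> cells k" for j
    using ugrid_bounds[OF st(2) that] st unfolding q_def by auto
  have q0: "q 0 = s" unfolding q_def by simp
  define P1 where "P1 = (\<lambda>m j. prob {\<omega>\<in>space M. \<epsilon> / 2 < \<bar>S m (q j) \<omega> - I (q j) \<omega>\<bar>})"
  define Q where "Q = (\<lambda>m. prob {\<omega>\<in>space M. \<delta> / 4 < \<bar>gap 0 t (n m) (p m) (\<xi> m) \<omega>\<bar>})"
  have S_M: "S m u \<in> borel_measurable M" if "0 \<le> u" for m u
    using simple_integral_process_measurable[OF 1 that] unfolding S_def .
  define A where "A = (\<lambda>m j. {\<omega>\<in>space M. \<epsilon> / 2 < \<bar>S m (q j) \<omega> - I (q j) \<omega>\<bar>})"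
  have A_M: "A m j \<in> events" if "j \<le> cells k" for m j
  proof -
    have [measurable]: "S m (q j) \<in> borel_measurable M" "I (q j) \<in> borel_measurable M"
      using q[OF that] by (auto intro: S_M I_M)
    show ?thesis unfolding A_def by measurable
  qed
  define B where "B = (\<lambda>m. {\<omega>\<in>space M. \<exists>j\<in>{..cells k}. \<epsilon> < \<bar>(S m (q j) \<omega> - S m s \<omega>) - noise s t k j \<omega>\<bar>})"
  have B_M: "B m \<in> events" for m
    unfolding B_def
  proof (rule sets.sets_Collect_finite_Ex)
    fix j assume "j \<in> {..cells k}"
    then have [measurable]: "S m (q j) \<in> borel_measurable M" "S m s \<in> borel_measurable M"
      using q[of j] st by (auto intro: S_M)
    have [measurable]: "noise s t k j \<in> borel_measurable M" by (rule noise_M[OF st])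
    show "{\<omega>\<in>space M. \<epsilon> < \<bar>(S m (q j) \<omega> - S m s \<omega>) - noise s t k j \<omega>\<bar>} \<in> events" by measurable
  qed simp
  have B_le: "prob (B m) \<le> \<delta> / \<epsilon>\<^sup>2 + (Q m + ?R)" for m
  proof -
    have [measurable]: "(\<lambda>\<omega>. gap 0 t (n m) (p m) (\<xi> m) \<omega>) \<in> borel_measurable M"
      "(\<lambda>\<omega>. gap s t (cells k) (ugrid s t k) (vol s t k) \<omega>) \<in> borel_measurable M"
      by (rule simple_diff_H_measurable[OF 1] simple_diff_H_measurable[OF vp])+
    have "prob (B m) \<le> prob {\<omega>\<in>space M. \<exists>u\<in>q ` {..cells k}. \<epsilon> <
      \<bar>(simple_integral_process W (n m) (p m) (\<xi> m) u \<omega> - simple_integral_process W (n m) (p m) (\<xi> m) s \<omega>) -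
      (simple_integral_process W (cells k) (ugrid s t k) (vol s t k) u \<omega> -
       simple_integral_process W (cells k) (ugrid s t k) (vol s t k) s \<omega>)\<bar>}" (is "_ \<le> prob ?E")
    proof -
      have "B m = ?E"
        unfolding B_def S_def noise_def bex_simps q_def
        using simple_integral_vol[OF st(2)] by auto
      then show ?thesis by simp
    qed
    also have "\<dots> \<le> \<delta> / \<epsilon>\<^sup>2 + prob {\<omega>\<in>space M. \<delta> < (LBINT u:{s..t}.
        (simple_value (n m) (p m) (\<xi> m) u \<omega> - ustep s t k (vol s t k) u \<omega>)\<^sup>2)}"
      by (rule lenglart_simple_diff[OF 1 vp st _ _ \<open>0 < \<epsilon>\<close> \<open>0 < \<delta>\<close>]) (use q in auto)
    also have "prob {\<omega>\<in>space M. \<delta> < (LBINT u:{s..t}.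
        (simple_value (n m) (p m) (\<xi> m) u \<omega> - ustep s t k (vol s t k) u \<omega>)\<^sup>2)} \<le> 
      prob ({\<omega>\<in>space M. \<delta> / 4 < \<bar>gap 0 t (n m) (p m) (\<xi> m) \<omega>\<bar>} \<union>
        {\<omega>\<in>space M. \<delta> / 4 < (gap s t (cells k) (ugrid s t k) (vol s t k) \<omega>)})"
    proof (rule finite_measure_mono)
      show "{\<omega>\<in>space M. \<delta> / 4 < \<bar>gap 0 t (n m) (p m) (\<xi> m) \<omega>\<bar>} \<union>
        {\<omega>\<in>space M. \<delta> / 4 < (gap s t (cells k) (ugrid s t k) (vol s t k) \<omega>)} \<in> events"
        by measurable
      show "{\<omega>\<in>space M. \<delta> < (LBINT u:{s..t}.
        (simple_value (n m) (p m) (\<xi> m) u \<omega> - ustep s t k (vol s t k) u \<omega>)\<^sup>2)} \<subseteq>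
        {\<omega>\<in>space M. \<delta> / 4 < \<bar>gap 0 t (n m) (p m) (\<xi> m) \<omega>\<bar>} \<union>
        {\<omega>\<in>space M. \<delta> / 4 < (gap s t (cells k) (ugrid s t k) (vol s t k) \<omega>)}"
      proof
        fix \<omega> assume \<omega>: "\<omega> \<in> {\<omega>\<in>space M. \<delta> < (LBINT u:{s..t}.
          (simple_value (n m) (p m) (\<xi> m) u \<omega> - ustep s t k (vol s t k) u \<omega>)\<^sup>2)}"
        \<comment> \<open>If the squared distance \<open>l\<close> exceeds \<delta> and is at most
          twice the sum of two gaps, one of the gaps exceeds \<delta> / 4.\<close>
        have arith: "\<delta> < l \<Longrightarrow> l \<le> 2 * (x' + y) \<Longrightarrow> x' \<le> x \<Longrightarrow> \<delta> / 4 < \<bar>x\<bar> \<or> \<delta> / 4 < y" for l x x' y :: real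
          using abs_ge_self[of x] by argo
        have "\<delta> < (LBINT u:{s..t}.
          (simple_value (n m) (p m) (\<xi> m) u \<omega> - ustep s t k (vol s t k) u \<omega>)\<^sup>2)" "\<omega> \<in> space M"
          using \<omega> by auto
        from arith[OF this(1) simple_diff_le_H[of s t "n m" "p m" "\<xi> m" \<omega> "cells k" "ugrid s t k" "vol s t k"]
          diff_H_interval_mono[of s t t "n m" "p m" "\<xi> m" \<omega>, OF st(1) order_refl]] this(2)
        show "\<omega> \<in> {\<omega>\<in>space M. \<delta> / 4 < \<bar>gap 0 t (n m) (p m) (\<xi> m) \<omega>\<bar>} \<union>
          {\<omega>\<in>space M. \<delta> / 4 < (gap s t (cells k) (ugrid s t k) (vol s t k) \<omega>)}"
          unfolding Un_iff mem_Collect_eq by blast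
      qed
    qed
    also have "\<dots> \<le> Q m + ?R"
      unfolding Q_def
      by (intro measure_Un_le) measurable
    finally show ?thesis by simp
  qed
  \<comment> \<open>The threshold \<open>2 * \<epsilon>\<close> is split into \<epsilon> / 2 for
    replacing \<open>I\<close> at each of the two times and \<epsilon> for the Lenglart event
    \<open>B m\<close>.\<close>
  have main: "?P \<le> (\<Sum>j\<le>cells k. P1 m j) + P1 m 0 + (\<delta> / \<epsilon>\<^sup>2 + (Q m + ?R))" for m
  proof -
    have P1_nonneg: "0 \<le> P1 m 0" unfolding P1_def by (rule measure_nonneg)
    have "?P \<le> prob ((\<Union>j\<in>{..cells k}. A m j) \<union> B m)"
    proof (rule finite_measure_mono)
      show "(\<Union>j\<in>{..cells k}. A m j) \<union> B m \<in> events"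
        using A_M B_M by (intro sets.Un sets.finite_UN) auto
      show "{\<omega>\<in>space M. \<exists>j\<in>{..cells k}. 2 * \<epsilon> < \<bar>(I (ugrid s t k j) \<omega> - I s \<omega>) - noise s t k j \<omega>\<bar>}
          \<subseteq> (\<Union>j\<in>{..cells k}. A m j) \<union> B m"
      proof
        fix \<omega> assume "\<omega> \<in> {\<omega>\<in>space M. \<exists>j\<in>{..cells k}. 2 * \<epsilon> < \<bar>(I (ugrid s t k j) \<omega> - I s \<omega>) - noise s t k j \<omega>\<bar>}"
        then obtain j where j: "j \<le> cells k" "\<omega> \<in> space M" "2 * \<epsilon> < \<bar>(I (q j) \<omega> - I s \<omega>) - noise s t k j \<omega>\<bar>"
          by (auto simp: q_def)
        show "\<omega> \<in> (\<Union>j\<in>{..cells k}. A m j) \<union> B m"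
        proof (rule ccontr)
          assume "\<omega> \<notin> (\<Union>j\<in>{..cells k}. A m j) \<union> B m"
          then have "\<omega> \<notin> A m j" "\<omega> \<notin> A m 0" "\<omega> \<notin> B m" using j(1) by auto
          then have "\<bar>S m (q j) \<omega> - I (q j) \<omega>\<bar> \<le> \<epsilon> / 2" "\<bar>S m s \<omega> - I s \<omega>\<bar> \<le> \<epsilon> / 2"
            "\<bar>(S m (q j) \<omega> - S m s \<omega>) - noise s t k j \<omega>\<bar> \<le> \<epsilon>"
            using j(1,2) q0 by (auto simp: A_def B_def not_less)
          with j(3) show False by linarith
        qed
      qed
    qed
    also have "\<dots> \<le> prob (\<Union>j\<in>{..cells k}. A m j) + prob (B m)"
      using A_M B_M by (intro measure_Un_le sets.finite_UN) auto
    also have "prob (\<Union>j\<in>{..cells k}. A m j) \<le> (\<Sum>j\<le>cells k. prob (A m j))"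
      using A_M by (intro measure_UNION_le) auto
    also have "(\<Sum>j\<le>cells k. prob (A m j)) = (\<Sum>j\<le>cells k. P1 m j)" by (simp add: P1_def A_def)
    finally show ?thesis using B_le[of m] P1_nonneg by linarith
  qed
  have P1_lim: "(\<lambda>m. P1 m j) \<longlonglongrightarrow> 0" if "j \<le> cells k" for j
    unfolding P1_def S_def by (rule tendsto_in_probability_zeroD(2)[OF 3[OF q(3,2)[OF that]]]) (use \<open>0 < \<epsilon>\<close> in simp)
  have Q_lim: "Q \<longlonglongrightarrow> 0"
    unfolding Q_def by (rule tendsto_in_probability_zeroD(2)[OF 2]) (use \<open>0 < \<delta>\<close> in simp)
  have "(\<lambda>m. (\<Sum>j\<le>cells k. P1 m j) + P1 m 0 + (\<delta> / \<epsilon>\<^sup>2 + (Q m + ?R))) \<longlonglongrightarrow>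
      (\<Sum>j\<le>cells k. 0) + 0 + (\<delta> / \<epsilon>\<^sup>2 + (0 + ?R))"
    by (intro tendsto_add tendsto_sum tendsto_const P1_lim Q_lim) auto
  from LIMSEQ_le_const[OF this] main show ?thesis by simp
qed

definition noise_error :: "real \<Rightarrow> real \<Rightarrow> nat \<Rightarrow> 'a \<Rightarrow> real" where
  "noise_error s t k \<omega> = Max ((\<lambda>j. \<bar>(I (ugrid s t k j) \<omega> - I s \<omega>) - noise s t k j \<omega>\<bar>) ` {..cells k})"

lemma noise_error_tendsto:
  assumes st: "0 \<le> s" "s < t"
  shows "tendsto_in_probability M (noise_error s t) (\<lambda>_. 0)"
  unfolding tendsto_in_probability_def
proof (intro conjI allI impI)
  show meas: "noise_error s t k \<in> borel_measurable M" for k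
    unfolding noise_error_def
  proof (rule borel_measurable_Max)
    fix j assume "j \<in> {..cells k}"
    have "I (ugrid s t k j) \<in> borel_measurable M" "I s \<in> borel_measurable M"
      using ugrid_nonneg[OF st] st by (auto intro: I_M)
    then show "(\<lambda>\<omega>. \<bar>(I (ugrid s t k j) \<omega> - I s \<omega>) - noise s t k j \<omega>\<bar>) \<in> borel_measurable M"
      using noise_M[OF st] by (intro borel_measurable_abs borel_measurable_diff)
  qed simp
  define J where "J = (\<lambda>k \<omega>. gap s t (cells k) (ugrid s t k) (vol s t k) \<omega>)"
  have J: "tendsto_in_probability M J (\<lambda>_. 0)"
    unfolding J_def
    by (rule tendsto_in_probability_AE)
      (use vol_converges[OF st(2)] simple_diff_H_measurable[OF simple_process_vol[OF st]] in auto)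
  have J_nonneg: "\<bar>J k \<omega>\<bar> = J k \<omega>" for k \<omega>
    unfolding J_def by (simp add: set_integral_square_nonneg)
  fix \<epsilon> :: real assume "0 < \<epsilon>"
  show "(\<lambda>k. prob {\<omega>\<in>space M. \<epsilon> < \<bar>noise_error s t k \<omega> - 0\<bar>}) \<longlonglongrightarrow> 0"
  proof (rule LIMSEQ_I)
    fix e :: real assume "0 < e"
    define \<delta> where "\<delta> = e * (\<epsilon> / 2)\<^sup>2 / 2"
    have \<delta>: "0 < \<delta>" "\<delta> / (\<epsilon> / 2)\<^sup>2 = e / 2" using \<open>0 < e\<close> \<open>0 < \<epsilon>\<close> by (auto simp: \<delta>_def)
    have "\<forall>\<^sub>F k in sequentially. prob {\<omega>\<in>space M. \<delta> / 4 < \<bar>J k \<omega>\<bar>} < e / 2"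
      using order_tendstoD(2)[OF tendsto_in_probability_zeroD(2)[OF J, of "\<delta> / 4"], of "e / 2"] \<delta>(1) \<open>0 < e\<close> by simp
    then obtain K where K: "\<And>k. k \<ge> K \<Longrightarrow> prob {\<omega>\<in>space M. \<delta> / 4 < \<bar>J k \<omega>\<bar>} < e / 2"
      by (auto simp: eventually_sequentially)
    have "prob {\<omega>\<in>space M. \<epsilon> < \<bar>noise_error s t k \<omega> - 0\<bar>} < e" if "k \<ge> K" for k
    proof -
      have "\<bar>noise_error s t k \<omega> - 0\<bar> = noise_error s t k \<omega>" for \<omega>
        unfolding noise_error_def by (simp add: Max_abs_nonneg)
      then have "{\<omega>\<in>space M. \<epsilon> < \<bar>noise_error s t k \<omega> - 0\<bar>} =
          {\<omega>\<in>space M. \<exists>j\<in>{..cells k}. 2 * (\<epsilon> / 2) < \<bar>(I (ugrid s t k j) \<omega> - I s \<omega>) - noise s t k j \<omega>\<bar>}"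
        unfolding noise_error_def by (simp add: Max_gr_iff)
      then have "prob {\<omega>\<in>space M. \<epsilon> < \<bar>noise_error s t k \<omega> - 0\<bar>} \<le> \<delta> / (\<epsilon> / 2)\<^sup>2 + prob {\<omega>\<in>space M. \<delta> / 4 < J k \<omega>}"
        using noise_bound[OF st _ \<delta>(1), of "\<epsilon> / 2" k] \<open>0 < \<epsilon>\<close> unfolding J_def by simp
      also have "\<dots> < e" using K[OF that] \<delta>(2) by (simp add: J_nonneg)
      finally show ?thesis .
    qed
    then show "\<exists>no. \<forall>k\<ge>no. norm (prob {\<omega>\<in>space M. \<epsilon> < \<bar>noise_error s t k \<omega> - 0\<bar>} - 0) < e" by auto
  qed
qed simp

text \<open>Not a recursion: drift and noise coefficients are read off \<open>X\<close>, so
  \<open>euler\<close> discretises the two integrals in the equation for \<open>X\<close> and not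
  the equation itself.\<close>

definition euler :: "real \<Rightarrow> real \<Rightarrow> nat \<Rightarrow> nat \<Rightarrow> 'a \<Rightarrow> real" where
  "euler s t k j \<omega> = X s \<omega> + (\<Sum>i<j. drift s t k i \<omega> * ((t - s) / real (cells k))) + noise s t k j \<omega>"

definition euler_error :: "real \<Rightarrow> real \<Rightarrow> nat \<Rightarrow> 'a \<Rightarrow> real" where
  "euler_error s t k \<omega> = Max ((\<lambda>j. \<bar>X (ugrid s t k j) \<omega> - euler s t k j \<omega>\<bar>) ` {..cells k})"

lemma euler_M:
  assumes st: "0 \<le> s" "s < t"
  shows "euler s t k j \<in> borel_measurable M"
proof -
  have [measurable]: "drift s t k i \<in> borel_measurable M" for i
    by (rule measurable_F_M[OF drift_F[OF order_refl]])
  have [measurable]: "noise s t k j \<in> borel_measurable M" by (rule noise_M[OF st])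
  show ?thesis unfolding euler_def by measurable
qed

lemma drift_sum_integral:
  assumes "s < t" "j \<le> cells k"
  shows "set_integrable lborel {s..ugrid s t k j} (\<lambda>u. ustep s t k (drift s t k) u \<omega>)"
    and "(LBINT u:{s..ugrid s t k j}. ustep s t k (drift s t k) u \<omega>) =
     (\<Sum>i<j. drift s t k i \<omega> * ((t - s) / real (cells k)))"
proof -
  have "has_bochner_integral lborel (\<lambda>u. indicator {s..ugrid s t k j} u *\<^sub>R ustep s t k (drift s t k) u \<omega>)
     (\<Sum>i<j. drift s t k i \<omega> * (ugrid s t k (Suc i) - ugrid s t k i))"
  proof (rule set_integral_step)
    show "ugrid s t k i < ugrid s t k (Suc i)" for i by (rule ugrid_less[OF assms(1)])
    fix i u assume "i < j" "ugrid s t k i < u" "u \<le> ugrid s t k (Suc i)"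
    then show "ustep s t k (drift s t k) u \<omega> = drift s t k i \<omega>"
      using assms by (intro simple_value_eq ugrid_less) auto
  qed auto
  then show "set_integrable lborel {s..ugrid s t k j} (\<lambda>u. ustep s t k (drift s t k) u \<omega>)"
    "(LBINT u:{s..ugrid s t k j}. ustep s t k (drift s t k) u \<omega>) =
     (\<Sum>i<j. drift s t k i \<omega> * ((t - s) / real (cells k)))"
    unfolding set_integrable_def set_lebesgue_integral_def
    by (auto simp: has_bochner_integral_iff ugrid_diff)
qed

lemma drift_integrable: "set_integrable lborel {s..t} (\<lambda>u. a - b * X u \<omega>)"
  by (rule borel_integrable_atLeastAtMost') (intro continuous_intros continuous_on_subset[OF X_cont], simp)

lemma X_increment:
  "AE \<omega> in M. \<forall>s t. 0 \<le> s \<longrightarrow> s \<le> t \<longrightarrow> X t \<omega> - X s \<omega> = (LBINT u:{s..t}. a - b * X u \<omega>) + (I t \<omega> - I s \<omega>)"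
  using X_eq
proof eventually_elim
  case (elim \<omega>)
  show ?case
  proof (intro allI impI)
    fix s t :: real assume st: "0 \<le> s" "s \<le> t"
    have "(LBINT u:{0..t}. a - b * X u \<omega>) = (LBINT u:{0..s}. a - b * X u \<omega>) + (LBINT u:{s..t}. a - b * X u \<omega>)"
      using st by (intro set_integral_split_interval drift_integrable)
    then show "X t \<omega> - X s \<omega> = (LBINT u:{s..t}. a - b * X u \<omega>) + (I t \<omega> - I s \<omega>)"
      using elim st by simp
  qed
qed

text \<open>Subtracting the integral equation on [s,q] leaves a drift error and a noise error. The
  first tends to 0 on every path, the second in probability, and both are bounded independently of
  the grid point.\<close>

lemma euler_error_tendsto:
  assumes st: "0 \<le> s" "s < t"
  shows "tendsto_in_probability M (euler_error s t) (\<lambda>_. 0)"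
proof -
  define A where "A = (\<lambda>k \<omega>. LBINT u:{s..t}. \<bar>(a - b * X u \<omega>) - ustep s t k (drift s t k) u \<omega>\<bar>)"
  have A: "tendsto_in_probability M A (\<lambda>_. 0)"
  proof (rule tendsto_in_probability_AE)
    show "A k \<in> borel_measurable M" for k
      unfolding A_def
    proof (rule set_integral_measurable_pair)
      have [measurable]: "(\<lambda>z. ustep s t k (drift s t k) (snd z) (fst z)) \<in> borel_measurable (M \<Otimes>\<^sub>M lborel)"
        by (rule simple_value_measurable_pair) (rule measurable_F_M[OF drift_F[OF order_refl]])
      show "(\<lambda>z. \<bar>(a - b * X (snd z) (fst z)) - ustep s t k (drift s t k) (snd z) (fst z)\<bar>)
        \<in> borel_measurable (M \<Otimes>\<^sub>M lborel)" by measurable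
    qed
    show "AE \<omega> in M. (\<lambda>k. A k \<omega>) \<longlonglongrightarrow> 0"
      unfolding A_def using drift_converges[OF st(2)] by simp
  qed
  show ?thesis
  proof (rule tendsto_in_probability_zero_le[OF A noise_error_tendsto[OF st], of _ 1])
    show "euler_error s t k \<in> borel_measurable M" for k
      unfolding euler_error_def
      by (intro borel_measurable_Max borel_measurable_abs borel_measurable_diff X_M euler_M st) auto
    fix k
    show "AE \<omega> in M. \<bar>euler_error s t k \<omega>\<bar> \<le> 1 * (\<bar>A k \<omega>\<bar> + \<bar>noise_error s t k \<omega>\<bar>)"
      using X_increment
    proof eventually_elim
      case (elim \<omega>)
      have "\<bar>X (ugrid s t k j) \<omega> - euler s t k j \<omega>\<bar> \<le> \<bar>A k \<omega>\<bar> + \<bar>noise_error s t k \<omega>\<bar>" if j: "j \<le> cells k" for j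
      proof -
        define q where "q = ugrid s t k j"
        define g where "g = (\<lambda>u. ustep s t k (drift s t k) u \<omega>)"
        have q: "s \<le> q" "q \<le> t" using ugrid_bounds[OF st(2) j] unfolding q_def by auto
        note ds = drift_sum_integral[OF st(2) j, of \<omega>, folded q_def g_def]
        have gt: "set_integrable lborel {s..t} g"
          using drift_sum_integral(1)[OF st(2) order_refl, of k \<omega>] by (simp add: g_def)
        have "X q \<omega> - euler s t k j \<omega> = (LBINT u:{s..q}. a - b * X u \<omega>) - (LBINT u:{s..q}. g u) + ((I q \<omega> - I s \<omega>) - noise s t k j \<omega>)"
          using elim st q unfolding euler_def ds(2)[symmetric] by (simp add: algebra_simps)
        also have "(LBINT u:{s..q}. a - b * X u \<omega>) - (LBINT u:{s..q}. g u) = (LBINT u:{s..q}. (a - b * X u \<omega>) - g u)"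
          using set_integral_diff(2)[OF drift_integrable ds(1)] by simp
        finally have *: "X q \<omega> - euler s t k j \<omega> = (LBINT u:{s..q}. (a - b * X u \<omega>) - g u) + ((I q \<omega> - I s \<omega>) - noise s t k j \<omega>)" .
        have "\<bar>LBINT u:{s..q}. (a - b * X u \<omega>) - g u\<bar> \<le> (LBINT u:{s..t}. \<bar>(a - b * X u \<omega>) - g u\<bar>)"
        proof -
          have i: "set_integrable lborel {s..q} (\<lambda>u. (a - b * X u \<omega>) - g u)" "set_integrable lborel {s..t} (\<lambda>u. (a - b * X u \<omega>) - g u)"
            by (intro set_integral_diff drift_integrable ds gt)+
          have "\<bar>LBINT u:{s..q}. (a - b * X u \<omega>) - g u\<bar> \<le> (\<integral>u. norm (indicator {s..q} u *\<^sub>R ((a - b * X u \<omega>) - g u)) \<partial>lborel)"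
            unfolding set_lebesgue_integral_def real_norm_def[symmetric] by (rule integral_norm_bound)
          also have "\<dots> \<le> (\<integral>u. norm (indicator {s..t} u *\<^sub>R ((a - b * X u \<omega>) - g u)) \<partial>lborel)"
            using i q unfolding set_integrable_def
            by (intro integral_mono integrable_norm) (auto simp: indicator_def)
          also have "\<dots> = (LBINT u:{s..t}. \<bar>(a - b * X u \<omega>) - g u\<bar>)"
            unfolding set_lebesgue_integral_def by (simp add: abs_mult)
          finally show ?thesis .
        qed
        moreover have "\<bar>(I q \<omega> - I s \<omega>) - noise s t k j \<omega>\<bar> \<le> noise_error s t k \<omega>"
          unfolding noise_error_def q_def using j by (intro Max_ge) auto
        ultimately show ?thesis using * unfolding A_def g_def q_def by linarith
      qed
      moreover have "\<bar>euler_error s t k \<omega>\<bar> = euler_error s t k \<omega>"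
        unfolding euler_error_def by (simp add: Max_abs_nonneg)
      ultimately show ?case by (simp add: euler_error_def)
    qed
  qed simp
qed

end

section \<open>Dynkin's formula for test functions\<close>

text \<open>The weighted bounds match the linear growth of drift and squared volatility. They start
  at -1 because an active tracker may lie up to 1 below the nonnegative \<open>X\<close>. The Taylor
  bound is global since a Gaussian step has no bounded range.\<close>

definition test_function :: "(real \<Rightarrow> real) \<Rightarrow> (real \<Rightarrow> real) \<Rightarrow> (real \<Rightarrow> real) \<Rightarrow> real \<Rightarrow> bool" where
  "test_function f f1 f2 K \<longleftrightarrow>
    continuous_on UNIV f \<and> continuous_on UNIV f1 \<and> continuous_on UNIV f2 \<and>
    (\<forall>x. \<bar>f x\<bar> \<le> K \<and> \<bar>f1 x\<bar> \<le> K \<and> \<bar>f2 x\<bar> \<le> K) \<and>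
    (\<forall>x\<ge>-1. \<bar>f1 x\<bar> * (1 + \<bar>x\<bar>) \<le> K \<and> \<bar>f2 x\<bar> * (1 + \<bar>x\<bar>) \<le> K) \<and>
    (\<forall>x h. \<bar>f (x + h) - f x - f1 x * h - f2 x * h\<^sup>2 / 2\<bar> \<le> K * \<bar>h\<bar> ^ 3)"

lemma abs_add_cube_le: "\<bar>x + y\<bar> ^ 3 \<le> 4 * (\<bar>x\<bar> ^ 3 + \<bar>y\<bar> ^ 3)" for x y :: real
proof -
  have "\<bar>x + y\<bar> ^ 3 \<le> (\<bar>x\<bar> + \<bar>y\<bar>) ^ 3" by (intro power_mono abs_triangle_ineq) auto
  also have "\<dots> \<le> 4 * (\<bar>x\<bar> ^ 3 + \<bar>y\<bar> ^ 3)"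
  proof -
    have "0 \<le> 3 * (\<bar>x\<bar> + \<bar>y\<bar>) * (\<bar>x\<bar> - \<bar>y\<bar>)\<^sup>2" by simp
    also have "\<dots> = 4 * (\<bar>x\<bar> ^ 3 + \<bar>y\<bar> ^ 3) - (\<bar>x\<bar> + \<bar>y\<bar>) ^ 3"
      by (simp add: power2_eq_square power3_eq_cube algebra_simps del: power2_abs abs_mult_self_eq)
    finally show ?thesis by simp
  qed
  finally show ?thesis .
qed

context cir
begin

text \<open>The Euler scheme, frozen while it is further than \<open>1\<close> from \<open>X\<close>. Its local characteristics
  are then controlled by its own position, so the generator terms of a test function stay bounded
  although no moments of \<open>X\<close> are known yet.\<close>

primrec tracker :: "real \<Rightarrow> real \<Rightarrow> nat \<Rightarrow> nat \<Rightarrow> 'a \<Rightarrow> real" where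
  "tracker s t k 0 \<omega> = X s \<omega>"
| "tracker s t k (Suc j) \<omega> = tracker s t k j \<omega> +
    of_bool (\<bar>tracker s t k j \<omega> - X (ugrid s t k j) \<omega>\<bar> \<le> 1) *
      (drift s t k j \<omega> * ((t - s) / real (cells k)) +
       vol s t k j \<omega> * (W (ugrid s t k (Suc j)) \<omega> - W (ugrid s t k j) \<omega>))"

definition active :: "real \<Rightarrow> real \<Rightarrow> nat \<Rightarrow> nat \<Rightarrow> 'a \<Rightarrow> real" where
  "active s t k j \<omega> = of_bool (\<bar>tracker s t k j \<omega> - X (ugrid s t k j) \<omega>\<bar> \<le> 1)"

lemma tracker_F:
  assumes st: "0 \<le> s" "s < t"
  shows "tracker s t k j \<in> borel_measurable (F (ugrid s t k j))"
proof (induction j)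
  case 0
  have "tracker s t k 0 = X s" by (simp add: fun_eq_iff)
  then show ?case using X_F'[of s s] by simp
next
  case (Suc j)
  have le: "ugrid s t k j \<le> ugrid s t k (Suc j)" using ugrid_less[OF st(2)] by (rule less_imp_le)
  note ug = ugrid_nonneg[OF st]
  have [measurable]: "tracker s t k j \<in> borel_measurable (F (ugrid s t k (Suc j)))"
    "X (ugrid s t k j) \<in> borel_measurable (F (ugrid s t k (Suc j)))"
    "drift s t k j \<in> borel_measurable (F (ugrid s t k (Suc j)))"
    "vol s t k j \<in> borel_measurable (F (ugrid s t k (Suc j)))"
    "W (ugrid s t k j) \<in> borel_measurable (F (ugrid s t k (Suc j)))"
    "W (ugrid s t k (Suc j)) \<in> borel_measurable (F (ugrid s t k (Suc j)))"
    using le ug by (auto intro: measurable_F_mono[OF Suc] X_F' drift_F vol_F measurable_F_W)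
  show ?case unfolding tracker.simps by measurable
qed

lemma active_F:
  assumes st: "0 \<le> s" "s < t"
  shows "active s t k j \<in> borel_measurable (F (ugrid s t k j))"
proof -
  have [measurable]: "tracker s t k j \<in> borel_measurable (F (ugrid s t k j))" by (rule tracker_F[OF st])
  have [measurable]: "X (ugrid s t k j) \<in> borel_measurable (F (ugrid s t k j))" by (rule X_F') simp
  show ?thesis unfolding active_def by measurable
qed

lemma drift_bound: "\<bar>drift s t k j \<omega>\<bar> \<le> (a + b) * real (Suc k)"
proof -
  have m: "0 \<le> min (X (ugrid s t k j) \<omega>) (real (Suc k))" "min (X (ugrid s t k j) \<omega>) (real (Suc k)) \<le> real (Suc k)"
    using X_nonneg[of "ugrid s t k j" \<omega>] by auto
  have "0 \<le> b * min (X (ugrid s t k j) \<omega>) (real (Suc k))" "b * min (X (ugrid s t k j) \<omega>) (real (Suc k)) \<le> b * real (Suc k)"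
    using pos m by (auto intro: mult_left_mono mult_nonneg_nonneg)
  moreover have "a * 1 \<le> a * real (Suc k)" using pos by (intro mult_left_mono) auto
  ultimately show ?thesis using pos(1) unfolding drift_def abs_le_iff distrib_right by linarith
qed

definition gen :: "(real \<Rightarrow> real) \<Rightarrow> (real \<Rightarrow> real) \<Rightarrow> real \<Rightarrow> real" where
  "gen f1 f2 x = f1 x * (a - b * x) + f2 x * (\<sigma>\<^sup>2 * x) / 2"

definition local_gen :: "(real \<Rightarrow> real) \<Rightarrow> (real \<Rightarrow> real) \<Rightarrow> real \<Rightarrow> real \<Rightarrow> nat \<Rightarrow> nat \<Rightarrow> 'a \<Rightarrow> real" where
  "local_gen f1 f2 s t k j \<omega> = active s t k j \<omega> *
    (f1 (tracker s t k j \<omega>) * drift s t k j \<omega> + f2 (tracker s t k j \<omega>) * (vol s t k j \<omega>)\<^sup>2 / 2)"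

text \<open>While the tracker \<open>y\<close> is active, \<bar>y - x\<bar> \<le> 1 and x \<ge> 0
  give y \<ge> -1 and x \<le> 1 + \<bar>y\<bar>. The weight \<open>1 + \<bar>y\<bar>\<close> in
  \<open>test_function\<close> then absorbs the coefficients, with a bound free of
  \<open>k\<close>.\<close>

lemma local_gen_bound:
  assumes "test_function f f1 f2 K"
  shows "\<bar>local_gen f1 f2 s t k j \<omega>\<bar> \<le> (a + b) * K + \<sigma>\<^sup>2 * K / 2"
proof (cases "\<bar>tracker s t k j \<omega> - X (ugrid s t k j) \<omega>\<bar> \<le> 1")
  case True
  define y where "y = tracker s t k j \<omega>"
  define x where "x = X (ugrid s t k j) \<omega>"
  define m where "m = min x (real (Suc k))"
  have x: "0 \<le> x" "\<bar>y - x\<bar> \<le> 1" using X_nonneg True by (auto simp: x_def y_def)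
  then have y: "-1 \<le> y" "x \<le> 1 + \<bar>y\<bar>" by linarith+
  have m: "0 \<le> m" "m \<le> 1 + \<bar>y\<bar>" using x y unfolding m_def by auto
  have f: "\<bar>f1 y\<bar> * (1 + \<bar>y\<bar>) \<le> K" "\<bar>f2 y\<bar> * (1 + \<bar>y\<bar>) \<le> K"
    using assms y(1) by (auto simp: test_function_def)
  have "\<bar>a - b * m\<bar> \<le> (a + b) * (1 + \<bar>y\<bar>)"
  proof -
    have "0 \<le> b * m" "b * m \<le> b * (1 + \<bar>y\<bar>)" using pos m by (auto intro: mult_left_mono mult_nonneg_nonneg)
    moreover have "a * 1 \<le> a * (1 + \<bar>y\<bar>)" using pos by (intro mult_left_mono) auto
    ultimately show ?thesis using pos(1) unfolding abs_le_iff distrib_right by linarith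
  qed
  then have "\<bar>f1 y\<bar> * \<bar>a - b * m\<bar> \<le> \<bar>f1 y\<bar> * ((a + b) * (1 + \<bar>y\<bar>))" by (intro mult_left_mono) auto
  also have "\<dots> = (a + b) * (\<bar>f1 y\<bar> * (1 + \<bar>y\<bar>))" by simp
  also have "\<dots> \<le> (a + b) * K" using f pos by (intro mult_left_mono) auto
  finally have 1: "\<bar>f1 y * (a - b * m)\<bar> \<le> (a + b) * K" by (simp add: abs_mult)
  have "\<bar>f2 y\<bar> * (\<sigma>\<^sup>2 * m) \<le> \<bar>f2 y\<bar> * (\<sigma>\<^sup>2 * (1 + \<bar>y\<bar>))" using m by (intro mult_left_mono) auto
  also have "\<dots> = \<sigma>\<^sup>2 * (\<bar>f2 y\<bar> * (1 + \<bar>y\<bar>))" by simp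
  also have "\<dots> \<le> \<sigma>\<^sup>2 * K" using f by (intro mult_left_mono) auto
  finally have 2: "\<bar>f2 y * (\<sigma>\<^sup>2 * m) / 2\<bar> \<le> \<sigma>\<^sup>2 * K / 2" using m by (simp add: abs_mult)
  have "local_gen f1 f2 s t k j \<omega> = f1 y * (a - b * m) + f2 y * (\<sigma>\<^sup>2 * m) / 2"
    using True m(1) unfolding local_gen_def active_def drift_def vol_def y_def[symmetric] x_def[symmetric] m_def[symmetric]
    by (simp add: power_mult_distrib)
  then show ?thesis using 1 2 abs_triangle_ineq[of "f1 y * (a - b * m)" "f2 y * (\<sigma>\<^sup>2 * m) / 2"] by linarith
next
  case False
  have "0 \<le> K" using assms abs_ge_zero[of "f 0"] unfolding test_function_def by (meson order_trans)
  then show ?thesis using False pos by (simp add: local_gen_def active_def)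
qed

text \<open>Taylor expansion around the tracker, tested against the past. Terms linear in the
  increment have mean 0, and the squared increment has mean \<open>h\<close>, which is what
  \<open>local_gen\<close> subtracts. Only the squared drift and the cubic remainder
  survive.\<close>

lemma one_step:
  assumes st: "0 \<le> s" "s < t" and f: "test_function f f1 f2 K"
    and Z: "Z \<in> borel_measurable (F s)" "\<And>\<omega>. \<omega> \<in> space M \<Longrightarrow> \<bar>Z \<omega>\<bar> \<le> C"
  shows "\<bar>\<integral>\<omega>. Z \<omega> * (f (tracker s t k (Suc j) \<omega>) - f (tracker s t k j \<omega>) -
      local_gen f1 f2 s t k j \<omega> * ((t - s) / real (cells k))) \<partial>M\<bar> \<le>
    C * K * (((a + b) * real (Suc k))\<^sup>2 * ((t - s) / real (cells k))\<^sup>2 / 2 +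
      4 * (((a + b) * real (Suc k)) ^ 3 * ((t - s) / real (cells k)) ^ 3 +
        (\<sigma> * sqrt (real (Suc k))) ^ 3 * (2 * sqrt (2 / pi) * sqrt ((t - s) / real (cells k)) ^ 3)))"
proof -
  define h where "h = (t - s) / real (cells k)"
  have h: "0 < h" using st cells_pos[of k] by (simp add: h_def)
  define p where "p = ugrid s t k j"
  define p' where "p' = ugrid s t k (Suc j)"
  have p: "0 \<le> p" "p < p'" "p' - p = h" "s \<le> p"
    using ugrid_nonneg[OF st] ugrid_less[OF st(2)] ugrid_diff[of s t k j] st h
    by (auto simp: p_def p'_def h_def ugrid_def)
  define mb where "mb = (a + b) * real (Suc k)"
  define vb where "vb = \<sigma> * sqrt (real (Suc k))"
  define y where "y = tracker s t k j"
  define m where "m = drift s t k j"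
  define v where "v = vol s t k j"
  define e where "e = active s t k j"
  define dW where "dW = (\<lambda>\<omega>. W p' \<omega> - W p \<omega>)"
  have C: "0 \<le> C" using Z(2) not_empty by (meson abs_ge_zero all_not_in_conv order_trans)
  have K: "0 \<le> K" using f abs_ge_zero[of "f 0"] unfolding test_function_def by (meson order_trans)
  have mv: "\<bar>m \<omega>\<bar> \<le> mb" "0 \<le> v \<omega>" "v \<omega> \<le> vb" for \<omega>
    using drift_bound[of s t k j \<omega>] vol_bounds[of s t k j \<omega>] by (auto simp: m_def v_def mb_def vb_def)
  have mvb: "0 \<le> mb" "0 \<le> vb" using pos by (auto simp: mb_def vb_def)
  have e: "e \<omega> = 0 \<or> e \<omega> = 1" for \<omega> by (simp add: e_def active_def)
  have ftest: "\<bar>f x\<bar> \<le> K" "\<bar>f1 x\<bar> \<le> K" "\<bar>f2 x\<bar> \<le> K" "\<bar>f (x + z) - f x - f1 x * z - f2 x * z\<^sup>2 / 2\<bar> \<le> K * \<bar>z\<bar> ^ 3" for x z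
    using f by (auto simp: test_function_def)
  have [measurable]: "f \<in> borel_measurable borel" "f1 \<in> borel_measurable borel" "f2 \<in> borel_measurable borel"
    using f by (auto simp: test_function_def intro: borel_measurable_continuous_onI)
  have yF [measurable]: "y \<in> borel_measurable (F p)" "m \<in> borel_measurable (F p)" "v \<in> borel_measurable (F p)"
    "e \<in> borel_measurable (F p)" "Z \<in> borel_measurable (F p)"
    unfolding y_def m_def v_def e_def p_def
    using tracker_F[OF st] active_F[OF st] p(4) by (auto intro: drift_F vol_F measurable_F_mono[OF Z(1)] simp: p_def)
  \<comment> \<open>\<open>A1\<close>, \<open>A2\<close>, \<open>A3\<close> collect the coefficient
    of \<open>dW\<close>, the coefficient of its square and the second-order term free of it;
    \<open>R\<close> is the Taylor remainder.\<close>
  define A1 where "A1 = (\<lambda>\<omega>. Z \<omega> * f1 (y \<omega>) * e \<omega> * v \<omega> + Z \<omega> * f2 (y \<omega>) * e \<omega> * m \<omega> * v \<omega> * h)"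
  define A2 where "A2 = (\<lambda>\<omega>. Z \<omega> * f2 (y \<omega>) * e \<omega> * (v \<omega>)\<^sup>2 / 2)"
  define A3 where "A3 = (\<lambda>\<omega>. Z \<omega> * f2 (y \<omega>) * e \<omega> * (m \<omega>)\<^sup>2 * h\<^sup>2 / 2)"
  define R where "R = (\<lambda>\<omega>. f (tracker s t k (Suc j) \<omega>) - f (y \<omega>) - f1 (y \<omega>) * (e \<omega> * (m \<omega> * h + v \<omega> * dW \<omega>))
     - f2 (y \<omega>) * (e \<omega> * (m \<omega> * h + v \<omega> * dW \<omega>))\<^sup>2 / 2)"
  have AF [measurable]: "A1 \<in> borel_measurable (F p)" "A2 \<in> borel_measurable (F p)" "A3 \<in> borel_measurable (F p)"
    unfolding A1_def A2_def A3_def by measurable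
  note AM = AF[THEN measurable_F_M]
  have bnd: "\<bar>Z \<omega> * g * e \<omega>\<bar> \<le> C * K" if "\<omega> \<in> space M" "\<bar>g\<bar> \<le> K" for \<omega> g
  proof -
    have "\<bar>Z \<omega>\<bar> * \<bar>g\<bar> \<le> C * K" using Z(2)[OF that(1)] that(2) C by (intro mult_mono) auto
    then show ?thesis using e[of \<omega>] C K by (auto simp: abs_mult)
  qed
  have A1b: "\<bar>A1 \<omega>\<bar> \<le> C * K * vb + C * K * mb * vb * h" if "\<omega> \<in> space M" for \<omega>
  proof -
    have "\<bar>Z \<omega> * f1 (y \<omega>) * e \<omega>\<bar> * \<bar>v \<omega>\<bar> \<le> C * K * vb"
      using mv[of \<omega>] mvb bnd[OF that ftest(2)] C K by (intro mult_mono) auto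
    moreover have "\<bar>Z \<omega> * f2 (y \<omega>) * e \<omega>\<bar> * \<bar>m \<omega>\<bar> * \<bar>v \<omega>\<bar> * h \<le> C * K * mb * vb * h"
      using mv[of \<omega>] mvb bnd[OF that ftest(3)] C K h by (intro mult_mono mult_nonneg_nonneg) auto
    ultimately show ?thesis using h
      unfolding A1_def by (intro order_trans[OF abs_triangle_ineq] add_mono) (auto simp: abs_mult)
  qed
  have A2b: "\<bar>A2 \<omega>\<bar> \<le> C * K * vb\<^sup>2" if "\<omega> \<in> space M" for \<omega>
  proof -
    have "(v \<omega>)\<^sup>2 \<le> vb\<^sup>2" using mv[of \<omega>] mvb by (intro power_mono) auto
    then have "\<bar>Z \<omega> * f2 (y \<omega>) * e \<omega>\<bar> * (v \<omega>)\<^sup>2 \<le> C * K * vb\<^sup>2"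
      using bnd[OF that ftest(3)] C K mvb by (intro mult_mono) auto
    moreover have "0 \<le> \<bar>Z \<omega> * f2 (y \<omega>) * e \<omega>\<bar> * (v \<omega>)\<^sup>2" by simp
    moreover have "\<bar>A2 \<omega>\<bar> = \<bar>Z \<omega> * f2 (y \<omega>) * e \<omega>\<bar> * (v \<omega>)\<^sup>2 / 2"
      unfolding A2_def by (simp add: abs_mult)
    ultimately show ?thesis by linarith
  qed
  have A3b: "\<bar>A3 \<omega>\<bar> \<le> C * K * (mb\<^sup>2 * h\<^sup>2 / 2)" if "\<omega> \<in> space M" for \<omega>
  proof -
    have "(m \<omega>)\<^sup>2 \<le> mb\<^sup>2" using mv[of \<omega>] power_mono[of "\<bar>m \<omega>\<bar>" mb 2] by simp
    then have "\<bar>Z \<omega> * f2 (y \<omega>) * e \<omega>\<bar> * (m \<omega>)\<^sup>2 * h\<^sup>2 \<le> C * K * mb\<^sup>2 * h\<^sup>2"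
      using bnd[OF that ftest(3)] C K mvb by (intro mult_mono mult_nonneg_nonneg) auto
    then show ?thesis unfolding A3_def by (simp add: abs_mult)
  qed
  have int: "integrable M A1" "integrable M A2" "integrable M A3"
    by (rule integrable_const_bound[OF AE_I2 AM(1)], unfold real_norm_def, erule A1b)
      (rule integrable_const_bound[OF AE_I2 AM(2)], unfold real_norm_def, erule A2b,
        rule integrable_const_bound[OF AE_I2 AM(3)], unfold real_norm_def, erule A3b)
  note m1 = F_increment_moments(1,2)[OF p(1,2) AF(1) int(1)]
  note m2 = F_increment_moments(3,4)[OF p(1,2) AF(2) int(2)]
  have "(\<lambda>_. 1) \<in> borel_measurable (F p)" "integrable M (\<lambda>_. 1 :: real)" by auto
  note m3 = F_increment_moments(5,6)[OF p(1,2) this]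
  have i3: "integrable M (\<lambda>\<omega>. \<bar>dW \<omega>\<bar> ^ 3)" "(\<integral>\<omega>. \<bar>dW \<omega>\<bar> ^ 3 \<partial>M) = 2 * sqrt (2 / pi) * sqrt h ^ 3"
    using m3 p(3) by (simp_all add: dW_def prob_space)
  have dW_M [measurable]: "dW \<in> borel_measurable M"
    unfolding dW_def using p by (intro borel_measurable_diff measurable_W) auto
  have ZM [measurable]: "Z \<in> borel_measurable M" by (rule measurable_F_M[OF Z(1)])
  have yM [measurable]: "tracker s t k i \<in> borel_measurable M" for i by (rule measurable_F_M[OF tracker_F[OF st]])
  have [measurable]: "y \<in> borel_measurable M" "m \<in> borel_measurable M" "v \<in> borel_measurable M" "e \<in> borel_measurable M"
    using yF[THEN measurable_F_M] by auto
  have R_M [measurable]: "R \<in> borel_measurable M" unfolding R_def by measurable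
  have Rb: "\<bar>Z \<omega> * R \<omega>\<bar> \<le> C * (K * (4 * (mb ^ 3 * h ^ 3 + vb ^ 3 * \<bar>dW \<omega>\<bar> ^ 3)))" if "\<omega> \<in> space M" for \<omega>
  proof -
    define z where "z = e \<omega> * (m \<omega> * h + v \<omega> * dW \<omega>)"
    have tr: "tracker s t k (Suc j) \<omega> = y \<omega> + z"
      by (simp add: z_def y_def m_def v_def e_def active_def dW_def p_def p'_def h_def)
    have "\<bar>z\<bar> ^ 3 \<le> \<bar>m \<omega> * h + v \<omega> * dW \<omega>\<bar> ^ 3" using e[of \<omega>] by (auto simp: z_def)
    also have "\<dots> \<le> 4 * (\<bar>m \<omega> * h\<bar> ^ 3 + \<bar>v \<omega> * dW \<omega>\<bar> ^ 3)" by (rule abs_add_cube_le)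
    also have "\<dots> \<le> 4 * (mb ^ 3 * h ^ 3 + vb ^ 3 * \<bar>dW \<omega>\<bar> ^ 3)"
    proof -
      have "\<bar>m \<omega>\<bar> ^ 3 \<le> mb ^ 3" "\<bar>v \<omega>\<bar> ^ 3 \<le> vb ^ 3" using mv[of \<omega>] mvb by (auto intro!: power_mono)
      then show ?thesis using h
        by (auto simp: abs_mult power_mult_distrib intro!: add_mono mult_right_mono)
    qed
    finally have "\<bar>z\<bar> ^ 3 \<le> 4 * (mb ^ 3 * h ^ 3 + vb ^ 3 * \<bar>dW \<omega>\<bar> ^ 3)" .
    then have "K * \<bar>z\<bar> ^ 3 \<le> K * (4 * (mb ^ 3 * h ^ 3 + vb ^ 3 * \<bar>dW \<omega>\<bar> ^ 3))" using K by (rule mult_left_mono)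
    moreover have "\<bar>R \<omega>\<bar> \<le> K * \<bar>z\<bar> ^ 3"
      using ftest(4)[of "y \<omega>" z] unfolding R_def tr z_def[symmetric] .
    ultimately have "\<bar>R \<omega>\<bar> \<le> K * (4 * (mb ^ 3 * h ^ 3 + vb ^ 3 * \<bar>dW \<omega>\<bar> ^ 3))" by simp
    then have "\<bar>Z \<omega>\<bar> * \<bar>R \<omega>\<bar> \<le> C * (K * (4 * (mb ^ 3 * h ^ 3 + vb ^ 3 * \<bar>dW \<omega>\<bar> ^ 3)))"
      using Z(2)[OF that] C by (intro mult_mono) auto
    then show ?thesis by (simp add: abs_mult)
  qed
  have iB: "integrable M (\<lambda>\<omega>. C * (K * (4 * (mb ^ 3 * h ^ 3 + vb ^ 3 * \<bar>dW \<omega>\<bar> ^ 3))))"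
    using i3(1) by (intro integrable_mult_right Bochner_Integration.integrable_add) auto
  have iR: "integrable M (\<lambda>\<omega>. Z \<omega> * R \<omega>)"
    by (rule Bochner_Integration.integrable_bound[OF iB])
      (use Rb in \<open>auto intro!: AE_I2 intro: order_trans[OF _ abs_ge_self]\<close>)
  \<comment> \<open>The switch \<open>e\<close> is 0 or 1 and so equals its square, which makes the
    second-order term match the one in \<open>local_gen\<close>.\<close>
  have decomp: "Z \<omega> * (f (tracker s t k (Suc j) \<omega>) - f (tracker s t k j \<omega>) - local_gen f1 f2 s t k j \<omega> * h) =
     A1 \<omega> * dW \<omega> + A2 \<omega> * (dW \<omega>)\<^sup>2 - h * A2 \<omega> + A3 \<omega> + Z \<omega> * R \<omega>" for \<omega>
  proof -
    have lg: "local_gen f1 f2 s t k j \<omega> = e \<omega> * (f1 (y \<omega>) * m \<omega> + f2 (y \<omega>) * (v \<omega>)\<^sup>2 / 2)"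
      by (simp add: local_gen_def e_def y_def m_def v_def)
    show ?thesis
      using e[of \<omega>] unfolding lg A1_def A2_def A3_def R_def y_def[symmetric]
      by (elim disjE) (simp_all add: power2_eq_square algebra_simps)
  qed
  have "(\<integral>\<omega>. Z \<omega> * (f (tracker s t k (Suc j) \<omega>) - f (tracker s t k j \<omega>) - local_gen f1 f2 s t k j \<omega> * h) \<partial>M) =
      (\<integral>\<omega>. A3 \<omega> \<partial>M) + (\<integral>\<omega>. Z \<omega> * R \<omega> \<partial>M)"
  proof -
    have i: "integrable M (\<lambda>\<omega>. A1 \<omega> * dW \<omega>)" "integrable M (\<lambda>\<omega>. A2 \<omega> * (dW \<omega>)\<^sup>2)" "integrable M (\<lambda>\<omega>. h * A2 \<omega>)"
      "(\<integral>\<omega>. A1 \<omega> * dW \<omega> \<partial>M) = 0" "(\<integral>\<omega>. A2 \<omega> * (dW \<omega>)\<^sup>2 \<partial>M) = h * (\<integral>\<omega>. A2 \<omega> \<partial>M)"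
      using m1 m2 int p(3) by (simp_all add: dW_def)
    show ?thesis unfolding decomp
      using i int iR by simp
  qed
  moreover have "\<bar>\<integral>\<omega>. A3 \<omega> \<partial>M\<bar> \<le> C * K * (mb\<^sup>2 * h\<^sup>2 / 2)"
  proof -
    have "\<bar>\<integral>\<omega>. A3 \<omega> \<partial>M\<bar> \<le> (\<integral>\<omega>. \<bar>A3 \<omega>\<bar> \<partial>M)" by (rule integral_abs_bound)
    also have "\<dots> \<le> (\<integral>\<omega>. C * K * (mb\<^sup>2 * h\<^sup>2 / 2) \<partial>M)"
      using int A3b by (intro integral_mono) auto
    finally show ?thesis by (simp add: prob_space)
  qed
  moreover have "\<bar>\<integral>\<omega>. Z \<omega> * R \<omega> \<partial>M\<bar> \<le> C * (K * (4 * (mb ^ 3 * h ^ 3 + vb ^ 3 * (2 * sqrt (2 / pi) * sqrt h ^ 3))))"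
  proof -
    have "\<bar>\<integral>\<omega>. Z \<omega> * R \<omega> \<partial>M\<bar> \<le> (\<integral>\<omega>. \<bar>Z \<omega> * R \<omega>\<bar> \<partial>M)" by (rule integral_abs_bound)
    also have "\<dots> \<le> (\<integral>\<omega>. C * (K * (4 * (mb ^ 3 * h ^ 3 + vb ^ 3 * \<bar>dW \<omega>\<bar> ^ 3))) \<partial>M)"
      using iR iB Rb by (intro integral_mono integrable_abs) auto
    also have "\<dots> = C * (K * (4 * (mb ^ 3 * h ^ 3 + vb ^ 3 * (2 * sqrt (2 / pi) * sqrt h ^ 3))))"
      using i3 by (simp add: prob_space)
    finally show ?thesis .
  qed
  ultimately show ?thesis
    unfolding h_def[symmetric] mb_def[symmetric] vb_def[symmetric] by (simp add: algebra_simps)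
qed

end

text \<open>With N = k + 1 and step \<tau> / N^4 the three accumulated errors are of order N^(-2),
  N^(-5) and N^(-1/2). The last one, from the Gaussian third moment, dictates the grid: with N^p
  cells it has order N^((3 - p) / 2), so p must exceed 3.\<close>

lemma taylor_errors_tendsto:
  fixes c d e \<tau> :: real
  assumes "0 \<le> \<tau>"
  shows "(\<lambda>k. real (cells k) * ((c * real (Suc k))\<^sup>2 * (\<tau> / real (cells k))\<^sup>2 / 2 +
      4 * ((c * real (Suc k)) ^ 3 * (\<tau> / real (cells k)) ^ 3 +
        (d * sqrt (real (Suc k))) ^ 3 * (e * sqrt (\<tau> / real (cells k)) ^ 3)))) \<longlonglongrightarrow> 0"
proof -
  have eq: "real (cells k) * ((c * real (Suc k))\<^sup>2 * (\<tau> / real (cells k))\<^sup>2 / 2 +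
      4 * ((c * real (Suc k)) ^ 3 * (\<tau> / real (cells k)) ^ 3 +
        (d * sqrt (real (Suc k))) ^ 3 * (e * sqrt (\<tau> / real (cells k)) ^ 3))) =
     c\<^sup>2 * \<tau>\<^sup>2 / 2 * (1 / real (Suc k))\<^sup>2 + 4 * c ^ 3 * \<tau> ^ 3 * (1 / real (Suc k)) ^ 5 +
       4 * d ^ 3 * e * sqrt \<tau> ^ 3 * (1 / sqrt (real (Suc k)))" for k
  proof -
    \<comment> \<open>In terms of the square root of \<open>k + 1\<close> all exponents become
      integers.\<close>
    define x where "x = sqrt (real (Suc k))"
    have x: "0 < x" unfolding x_def by (simp del: of_nat_Suc)
    have N: "real (Suc k) = x\<^sup>2" unfolding x_def by (simp del: of_nat_Suc)
    have n: "real (cells k) = x ^ 8" unfolding cells_def of_nat_power N by (simp flip: power_mult)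
    have s: "sqrt (\<tau> / x ^ 8) = sqrt \<tau> / x ^ 4"
      using x by (simp add: real_sqrt_divide real_sqrt_power_even real_sqrt_unique power_mult[of x 4 2, simplified])
    show ?thesis
      unfolding n s unfolding x_def[symmetric] unfolding N using x
      by (simp add: field_simps power_mult_distrib power_divide flip: power_mult power_add) (simp flip: power_Suc)
  qed
  have 1: "(\<lambda>k. 1 / real (Suc k)) \<longlonglongrightarrow> 0" by (rule LIMSEQ_Suc[OF lim_1_over_n])
  have "(\<lambda>k. sqrt (1 / real (Suc k))) \<longlonglongrightarrow> sqrt 0" by (intro tendsto_real_sqrt 1)
  then have 2: "(\<lambda>k. 1 / sqrt (real (Suc k))) \<longlonglongrightarrow> 0" by (simp add: real_sqrt_divide del: of_nat_Suc)
  have "(\<lambda>k. c\<^sup>2 * \<tau>\<^sup>2 / 2 * (1 / real (Suc k))\<^sup>2 + 4 * c ^ 3 * \<tau> ^ 3 * (1 / real (Suc k)) ^ 5 +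
       4 * d ^ 3 * e * sqrt \<tau> ^ 3 * (1 / sqrt (real (Suc k)))) \<longlonglongrightarrow>
     c\<^sup>2 * \<tau>\<^sup>2 / 2 * 0\<^sup>2 + 4 * c ^ 3 * \<tau> ^ 3 * 0 ^ 5 + 4 * d ^ 3 * e * sqrt \<tau> ^ 3 * 0"
    by (intro tendsto_add tendsto_mult tendsto_power tendsto_const 1 2)
  then show ?thesis unfolding eq by simp
qed

context cir
begin

text \<open>The freezing rule does not interfere as long as the Euler error is at most 1: by
  induction the tracker still equals \<open>euler\<close>, hence is within 1 of \<open>X\<close> and
  keeps moving.\<close>

lemma tracker_eq_euler:
  assumes "euler_error s t k \<omega> \<le> 1" "j \<le> cells k"
  shows "tracker s t k j \<omega> = euler s t k j \<omega>"
  using assms(2)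
proof (induction j)
  case 0
  show ?case by (simp add: euler_def noise_def)
next
  case (Suc j)
  have "\<bar>X (ugrid s t k j) \<omega> - euler s t k j \<omega>\<bar> \<le> euler_error s t k \<omega>"
    unfolding euler_error_def using Suc.prems by (intro Max_ge) auto
  then have "\<bar>tracker s t k j \<omega> - X (ugrid s t k j) \<omega>\<bar> \<le> 1"
    using assms(1) Suc by (simp add: abs_minus_commute)
  then show ?case using Suc by (simp add: euler_def noise_def algebra_simps)
qed

lemma tracker_close:
  assumes "euler_error s t k \<omega> \<le> 1" "j \<le> cells k"
  shows "\<bar>tracker s t k j \<omega> - X (ugrid s t k j) \<omega>\<bar> \<le> euler_error s t k \<omega>" "active s t k j \<omega> = 1"
proof -
  have "\<bar>X (ugrid s t k j) \<omega> - euler s t k j \<omega>\<bar> \<le> euler_error s t k \<omega>"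
    unfolding euler_error_def using assms by (intro Max_ge) auto
  then show 1: "\<bar>tracker s t k j \<omega> - X (ugrid s t k j) \<omega>\<bar> \<le> euler_error s t k \<omega>"
    by (simp add: tracker_eq_euler[OF assms] abs_minus_commute)
  show "active s t k j \<omega> = 1" using 1 assms(1) by (simp add: active_def)
qed

lemma local_gen_M:
  assumes st: "0 \<le> s" "s < t" and f: "test_function f f1 f2 K"
  shows "local_gen f1 f2 s t k j \<in> borel_measurable M"
proof -
  have [measurable]: "f1 \<in> borel_measurable borel" "f2 \<in> borel_measurable borel"
    using f by (auto simp: test_function_def intro: borel_measurable_continuous_onI)
  have [measurable]: "tracker s t k j \<in> borel_measurable M" "active s t k j \<in> borel_measurable M"
    "drift s t k j \<in> borel_measurable M" "vol s t k j \<in> borel_measurable M"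
    using measurable_F_M[OF tracker_F[OF st]] measurable_F_M[OF active_F[OF st]]
      measurable_F_M[OF drift_F[OF order_refl]] measurable_F_M[OF vol_F[OF order_refl]] by auto
  show ?thesis unfolding local_gen_def by measurable
qed

lemma gen_continuous:
  assumes "test_function f f1 f2 K"
  shows "continuous_on UNIV (gen f1 f2)"
  using assms unfolding gen_def test_function_def by (intro continuous_intros) auto

lemma gen_bound:
  assumes "test_function f f1 f2 K" "0 \<le> x"
  shows "\<bar>gen f1 f2 x\<bar> \<le> (a + b) * K + \<sigma>\<^sup>2 * K / 2"
proof -
  have f: "\<bar>f1 x\<bar> * (1 + x) \<le> K" "\<bar>f2 x\<bar> * (1 + x) \<le> K"
    using assms by (auto simp: test_function_def dest!: spec[of _ x])
  have "\<bar>a - b * x\<bar> \<le> (a + b) * (1 + x)"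
  proof -
    have "0 \<le> b * x" "0 \<le> a * x" using pos assms(2) by auto
    then show ?thesis using pos(1,2) unfolding abs_le_iff by (simp add: algebra_simps)
  qed
  then have "\<bar>f1 x\<bar> * \<bar>a - b * x\<bar> \<le> \<bar>f1 x\<bar> * ((a + b) * (1 + x))" by (intro mult_left_mono) auto
  also have "\<dots> = (a + b) * (\<bar>f1 x\<bar> * (1 + x))" by simp
  also have "\<dots> \<le> (a + b) * K" using f pos by (intro mult_left_mono) auto
  finally have 1: "\<bar>f1 x * (a - b * x)\<bar> \<le> (a + b) * K" by (simp add: abs_mult)
  have "\<bar>f2 x\<bar> * (\<sigma>\<^sup>2 * x) \<le> \<bar>f2 x\<bar> * (\<sigma>\<^sup>2 * (1 + x))" by (intro mult_left_mono) auto
  also have "\<dots> = \<sigma>\<^sup>2 * (\<bar>f2 x\<bar> * (1 + x))" by simp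
  also have "\<dots> \<le> \<sigma>\<^sup>2 * K" using f by (intro mult_left_mono) auto
  finally have 2: "\<bar>f2 x * (\<sigma>\<^sup>2 * x) / 2\<bar> \<le> \<sigma>\<^sup>2 * K / 2" using assms(2) by (simp add: abs_mult)
  show ?thesis unfolding gen_def
    using 1 2 abs_triangle_ineq[of "f1 x * (a - b * x)" "f2 x * (\<sigma>\<^sup>2 * x) / 2"] by linarith
qed

lemma path_integral_M:
  assumes "g \<in> borel_measurable borel"
  shows "(\<lambda>\<omega>. LBINT u:{s..t}. (g (X u \<omega>) :: real)) \<in> borel_measurable M"
  by (rule set_integral_measurable_pair) (use assms in measurable)

text \<open>The expectations of \<open>D k\<close> tend to 0 by summing \<open>one_step\<close>. On
  a subsequence along which the Euler error vanishes almost surely, dominated convergence identifies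
  their limit as the left-hand side.\<close>

lemma dynkin_test:
  assumes st: "0 \<le> s" "s \<le> t" and f: "test_function f f1 f2 K"
    and Z: "Z \<in> borel_measurable (F s)" "\<And>\<omega>. \<omega> \<in> space M \<Longrightarrow> \<bar>Z \<omega>\<bar> \<le> C"
  shows "(\<integral>\<omega>. Z \<omega> * (f (X t \<omega>) - f (X s \<omega>) - (LBINT u:{s..t}. gen f1 f2 (X u \<omega>))) \<partial>M) = 0"
proof (cases "s = t")
  case True
  have "(LBINT u:{t..t}. gen f1 f2 (X u \<omega>)) = 0" for \<omega>
    using has_bochner_integral_integral_eq[OF lborel_integral_at_point[of t "\<lambda>u. gen f1 f2 (X u \<omega>)"]]
    by (simp add: set_lebesgue_integral_def)
  then show ?thesis using True by simp
next
  case False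
  then have st': "s < t" using st by simp
  define h where "h = (\<lambda>k. (t - s) / real (cells k))"
  have h: "0 < h k" for k using st' cells_pos[of k] by (simp add: h_def)
  define B where "B = (a + b) * K + \<sigma>\<^sup>2 * K / 2"
  define G where "G = local_gen f1 f2 s t"
  define Y where "Y = tracker s t"
  have C: "0 \<le> C" using Z(2) not_empty by (meson abs_ge_zero all_not_in_conv order_trans)
  have K: "0 \<le> K" using f abs_ge_zero[of "f 0"] unfolding test_function_def by (meson order_trans)
  have B: "0 \<le> B" using K pos by (auto simp: B_def)
  have fb: "\<bar>f x\<bar> \<le> K" for x using f by (auto simp: test_function_def)
  have f_M [measurable]: "f \<in> borel_measurable borel"
    using f by (auto simp: test_function_def intro: borel_measurable_continuous_onI)
  have Gb: "\<bar>G k j \<omega>\<bar> \<le> B" for k j \<omega> unfolding G_def B_def by (rule local_gen_bound[OF f])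
  have G_M [measurable]: "G k j \<in> borel_measurable M" for k j unfolding G_def by (rule local_gen_M[OF st(1) st' f])
  have Y_M [measurable]: "Y k j \<in> borel_measurable M" for k j
    unfolding Y_def by (rule measurable_F_M[OF tracker_F[OF st(1) st']])
  have Z_M [measurable]: "Z \<in> borel_measurable M" by (rule measurable_F_M[OF Z(1)])
  define D where "D = (\<lambda>k \<omega>. Z \<omega> * (f (Y k (cells k) \<omega>) - f (X s \<omega>) - (\<Sum>j<cells k. G k j \<omega> * h k)))"
  have D_M [measurable]: "D k \<in> borel_measurable M" for k unfolding D_def by measurable
  have D_lim: "(\<lambda>k. \<integral>\<omega>. D k \<omega> \<partial>M) \<longlonglongrightarrow> 0"
  proof (rule Lim_null_comparison)
    define err where "err = (\<lambda>k. ((a + b) * real (Suc k))\<^sup>2 * (h k)\<^sup>2 / 2 +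
      4 * (((a + b) * real (Suc k)) ^ 3 * (h k) ^ 3 +
        (\<sigma> * sqrt (real (Suc k))) ^ 3 * (2 * sqrt (2 / pi) * sqrt (h k) ^ 3)))"
    have "(\<lambda>k. C * K * (real (cells k) * err k)) \<longlonglongrightarrow> C * K * 0"
      unfolding err_def h_def by (intro tendsto_mult tendsto_const taylor_errors_tendsto) (use st' in simp)
    then show "(\<lambda>k. C * K * (real (cells k) * err k)) \<longlonglongrightarrow> 0" by simp
    show "\<forall>\<^sub>F k in sequentially. norm (\<integral>\<omega>. D k \<omega> \<partial>M) \<le> C * K * (real (cells k) * err k)"
    proof (rule always_eventually, rule allI)
      fix k
      define d where "d = (\<lambda>j \<omega>. Z \<omega> * (f (Y k (Suc j) \<omega>) - f (Y k j \<omega>) - G k j \<omega> * h k))"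
      have int: "integrable M (d j)" for j
      proof (rule integrable_const_bound)
        show "AE \<omega> in M. norm (d j \<omega>) \<le> C * (2 * K + B * h k)"
        proof (rule AE_I2)
          fix \<omega> assume "\<omega> \<in> space M"
          have "\<bar>G k j \<omega> * h k\<bar> \<le> B * h k" using Gb h[of k] by (simp add: abs_mult mult_right_mono)
          then have "\<bar>f (Y k (Suc j) \<omega>) - f (Y k j \<omega>) - G k j \<omega> * h k\<bar> \<le> 2 * K + B * h k"
            using fb[of "Y k (Suc j) \<omega>"] fb[of "Y k j \<omega>"] by linarith
          then show "norm (d j \<omega>) \<le> C * (2 * K + B * h k)"
            unfolding d_def real_norm_def abs_mult using Z(2)[OF \<open>\<omega> \<in> space M\<close>] C by (intro mult_mono) auto
        qed
        show "d j \<in> borel_measurable M" unfolding d_def by measurable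
      qed
      have "D k \<omega> = (\<Sum>j<cells k. d j \<omega>)" for \<omega>
      proof -
        have "f (Y k (cells k) \<omega>) - f (X s \<omega>) = (\<Sum>j<cells k. f (Y k (Suc j) \<omega>) - f (Y k j \<omega>))"
          by (subst sum_lessThan_telescope) (simp add: Y_def)
        then show ?thesis unfolding D_def d_def
          by (simp add: sum_subtractf sum_distrib_left right_diff_distrib)
      qed
      then have "(\<integral>\<omega>. D k \<omega> \<partial>M) = (\<Sum>j<cells k. \<integral>\<omega>. d j \<omega> \<partial>M)"
        using int by (simp add: Bochner_Integration.integral_sum)
      then have "norm (\<integral>\<omega>. D k \<omega> \<partial>M) \<le> (\<Sum>j<cells k. \<bar>\<integral>\<omega>. d j \<omega> \<partial>M\<bar>)"
        by (simp add: sum_abs)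
      also have "\<dots> \<le> (\<Sum>j<cells k. C * K * err k)"
        unfolding d_def Y_def G_def err_def h_def
        by (intro sum_mono one_step[OF st(1) st' f Z])
      also have "\<dots> = C * K * (real (cells k) * err k)" by simp
      finally show "norm (\<integral>\<omega>. D k \<omega> \<partial>M) \<le> C * K * (real (cells k) * err k)" .
    qed
  qed
  obtain r where r: "strict_mono r" "AE \<omega> in M. (\<lambda>k. euler_error s t (r k) \<omega>) \<longlonglongrightarrow> 0"
    using tendsto_in_probability_subseq[OF euler_error_tendsto[OF st(1) st']] by blast
  have gen_cont: "isCont (gen f1 f2) x" for x
    using gen_continuous[OF f] continuous_on_eq_continuous_at[OF open_UNIV] by blast
  have gen_M [measurable]: "gen f1 f2 \<in> borel_measurable borel"
    by (rule borel_measurable_continuous_onI[OF gen_continuous[OF f]])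
  have f_cont: "isCont f x" "isCont f1 x" "isCont f2 x" for x
    using f continuous_on_eq_continuous_at[OF open_UNIV] unfolding test_function_def by blast+
  have "(\<lambda>k. \<integral>\<omega>. D (r k) \<omega> \<partial>M) \<longlonglongrightarrow>
     (\<integral>\<omega>. Z \<omega> * (f (X t \<omega>) - f (X s \<omega>) - (LBINT u:{s..t}. gen f1 f2 (X u \<omega>))) \<partial>M)"
  proof (rule integral_dominated_convergence[where w = "\<lambda>_. C * (2 * K + B * (t - s))"])
    have "(\<lambda>\<omega>. LBINT u:{s..t}. gen f1 f2 (X u \<omega>)) \<in> borel_measurable M"
      by (rule path_integral_M[OF gen_M])
    then show "(\<lambda>\<omega>. Z \<omega> * (f (X t \<omega>) - f (X s \<omega>) - (LBINT u:{s..t}. gen f1 f2 (X u \<omega>)))) \<in> borel_measurable M"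
      by measurable
    show "AE \<omega> in M. norm (D (r k) \<omega>) \<le> C * (2 * K + B * (t - s))" for k
    proof (rule AE_I2)
      fix \<omega> assume "\<omega> \<in> space M"
      have "\<bar>\<Sum>j<cells (r k). G (r k) j \<omega> * h (r k)\<bar> \<le> (\<Sum>j<cells (r k). B * h (r k))"
        using Gb h[of "r k"] by (intro order_trans[OF sum_abs] sum_mono) (simp add: abs_mult mult_right_mono)
      also have "\<dots> = B * (t - s)" using cells_pos[of "r k"] by (simp add: h_def)
      finally have "\<bar>f (Y (r k) (cells (r k)) \<omega>) - f (X s \<omega>) - (\<Sum>j<cells (r k). G (r k) j \<omega> * h (r k))\<bar> \<le> 2 * K + B * (t - s)"
        using fb[of "Y (r k) (cells (r k)) \<omega>"] fb[of "X s \<omega>"] by linarith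
      then show "norm (D (r k) \<omega>) \<le> C * (2 * K + B * (t - s))"
        unfolding D_def real_norm_def abs_mult using Z(2)[OF \<open>\<omega> \<in> space M\<close>] C by (intro mult_mono) auto
    qed
    show "AE \<omega> in M. (\<lambda>k. D (r k) \<omega>) \<longlonglongrightarrow> Z \<omega> * (f (X t \<omega>) - f (X s \<omega>) - (LBINT u:{s..t}. gen f1 f2 (X u \<omega>)))"
      using r(2)
    proof eventually_elim
      case (elim \<omega>)
      \<comment> \<open>From some index on the tracker is active at all nodes of the grid and
        follows this path of \<open>X\<close>.\<close>
      have ev1: "\<forall>\<^sub>F k in sequentially. euler_error s t (r k) \<omega> \<le> 1"
        using order_tendstoD(2)[OF elim, of 1] by (auto elim: eventually_mono)
      have Y_lim: "(\<lambda>k. Y (r k) (j k) \<omega>) \<longlonglongrightarrow> x"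
        if j: "\<And>k. j k \<le> cells (r k)" and x: "(\<lambda>k. X (ugrid s t (r k) (j k)) \<omega>) \<longlonglongrightarrow> x" for j x
      proof -
        have "(\<lambda>k. Y (r k) (j k) \<omega> - X (ugrid s t (r k) (j k)) \<omega>) \<longlonglongrightarrow> 0"
          by (rule Lim_null_comparison[OF _ elim])
            (use ev1 tracker_close(1)[OF _ j] in \<open>auto elim!: eventually_mono simp: Y_def\<close>)
        from tendsto_add[OF this x] show ?thesis by simp
      qed
      have "(\<lambda>k. Y (r k) (cells (r k)) \<omega>) \<longlonglongrightarrow> X t \<omega>" by (rule Y_lim) auto
      then have lim1: "(\<lambda>k. f (Y (r k) (cells (r k)) \<omega>)) \<longlonglongrightarrow> f (X t \<omega>)"
        by (rule isCont_tendsto_compose[OF f_cont(1)])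
      \<comment> \<open>The generator sum is the integral of a step function, so bounded convergence
        in time replaces a Riemann sum argument.\<close>
      have sum_eq: "(\<Sum>j<cells k. G k j \<omega> * h k) =
          (LBINT u:{s..t}. ustep s t k (G k) u \<omega>)" for k
      proof -
        have "has_bochner_integral lborel (\<lambda>u. indicator {s..t} u *\<^sub>R ustep s t k (G k) u \<omega>)
          (\<Sum>i<cells k. G k i \<omega> * (ugrid s t k (Suc i) - ugrid s t k i))"
          by (rule set_integral_step) (auto intro!: ugrid_less simple_value_eq st')
        then show ?thesis
          unfolding set_lebesgue_integral_def by (simp add: has_bochner_integral_iff ugrid_diff h_def)
      qed
      have lim2: "(\<lambda>k. LBINT u:{s..t}. ustep s t (r k) (G (r k)) u \<omega>) \<longlonglongrightarrow>
          (LBINT u:{s..t}. gen f1 f2 (X u \<omega>))"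
      proof (rule set_integral_bounded_convergence[where B = B])
        show "(\<lambda>u. ustep s t (r k) (G (r k)) u \<omega>) \<in> borel_measurable borel" for k
          by (rule simple_value_borel)
        show "(\<lambda>u. gen f1 f2 (X u \<omega>)) \<in> borel_measurable borel" by measurable
        show "\<bar>ustep s t (r k) (G (r k)) u \<omega>\<bar> \<le> B" if "u \<in> {s..t}" for k u
        proof (cases "u = s")
          case True
          then have "ustep s t (r k) (G (r k)) u \<omega> = 0"
            by (intro simple_value_outside ugrid_less st') auto
          then show ?thesis using B by simp
        next
          case False
          then have u: "u \<in> {s<..t}" using that by auto
          obtain idx where idx: "\<And>k c (\<omega>::'a). ustep s t k c u \<omega> = c (idx k) \<omega>"
            by (rule ugrid_index[OF st' u]) (rule that)
          show ?thesis unfolding idx by (rule Gb)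
        qed
        fix u assume u: "u \<in> {s<..t}"
        obtain idx where idx: "\<And>k. idx k < cells k"
          "\<And>k c (\<omega>::'a). ustep s t k c u \<omega> = c (idx k) \<omega>"
          "(\<lambda>k. ugrid s t k (idx k)) \<longlonglongrightarrow> u"
          by (rule ugrid_index[OF st' u]) (rule that)
        define j where "j = (\<lambda>k. idx (r k))"
        have j: "j k \<le> cells (r k)" for k using idx(1)[of "r k"] by (simp add: j_def)
        have "(\<lambda>k. X (ugrid s t k (idx k)) \<omega>) \<longlonglongrightarrow> X u \<omega>"
          by (rule isCont_tendsto_compose[OF X_isCont idx(3)])
        from LIMSEQ_subseq_LIMSEQ[OF this r(1)] LIMSEQ_subseq_LIMSEQ[OF tendsto_min_Suc[OF this] r(1)]
        have X_lim: "(\<lambda>k. X (ugrid s t (r k) (j k)) \<omega>) \<longlonglongrightarrow> X u \<omega>"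
          and m_lim: "(\<lambda>k. min (X (ugrid s t (r k) (j k)) \<omega>) (real (Suc (r k)))) \<longlonglongrightarrow> X u \<omega>"
          by (simp_all add: j_def comp_def)
        have YX: "(\<lambda>k. Y (r k) (j k) \<omega>) \<longlonglongrightarrow> X u \<omega>" by (rule Y_lim[OF j X_lim])
        have "(\<lambda>k. f1 (Y (r k) (j k) \<omega>) * drift s t (r k) (j k) \<omega> +
            f2 (Y (r k) (j k) \<omega>) * (vol s t (r k) (j k) \<omega>)\<^sup>2 / 2) \<longlonglongrightarrow>
          f1 (X u \<omega>) * (a - b * X u \<omega>) + f2 (X u \<omega>) * (\<sigma> * sqrt (X u \<omega>))\<^sup>2 / 2"
          unfolding drift_def vol_def
          by (intro tendsto_intros m_lim isCont_tendsto_compose[OF f_cont(2) YX] isCont_tendsto_compose[OF f_cont(3) YX]) simp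
        also have "f1 (X u \<omega>) * (a - b * X u \<omega>) + f2 (X u \<omega>) * (\<sigma> * sqrt (X u \<omega>))\<^sup>2 / 2 = gen f1 f2 (X u \<omega>)"
          using X_nonneg[of u \<omega>] by (simp add: gen_def power_mult_distrib)
        finally have "(\<lambda>k. f1 (Y (r k) (j k) \<omega>) * drift s t (r k) (j k) \<omega> +
            f2 (Y (r k) (j k) \<omega>) * (vol s t (r k) (j k) \<omega>)\<^sup>2 / 2) \<longlonglongrightarrow> gen f1 f2 (X u \<omega>)" .
        moreover have "\<forall>\<^sub>F k in sequentially. f1 (Y (r k) (j k) \<omega>) * drift s t (r k) (j k) \<omega> +
            f2 (Y (r k) (j k) \<omega>) * (vol s t (r k) (j k) \<omega>)\<^sup>2 / 2 = G (r k) (j k) \<omega>"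
          using ev1
        proof eventually_elim
          case (elim k)
          from tracker_close(2)[OF this j] show ?case by (simp add: G_def local_gen_def Y_def)
        qed
        ultimately have "(\<lambda>k. G (r k) (j k) \<omega>) \<longlonglongrightarrow> gen f1 f2 (X u \<omega>)"
          by (rule Lim_transform_eventually)
        then show "(\<lambda>k. ustep s t (r k) (G (r k)) u \<omega>) \<longlonglongrightarrow> gen f1 f2 (X u \<omega>)"
          unfolding idx(2) j_def .
      qed
      show ?case unfolding D_def sum_eq by (intro tendsto_intros lim1 lim2)
    qed
  qed (use D_M in auto)
  moreover have "(\<lambda>k. \<integral>\<omega>. D (r k) \<omega> \<partial>M) \<longlonglongrightarrow> 0"
    using LIMSEQ_subseq_LIMSEQ[OF D_lim r(1)] by (simp add: comp_def)
  ultimately show ?thesis by (rule LIMSEQ_unique)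
qed

end

section \<open>A bounded smooth continuation of the exponential\<close>

lemma DERIV_piecewise_at_zero:
  fixes p q :: "real \<Rightarrow> real"
  assumes p: "\<And>x. DERIV p x :> p' x" and q: "\<And>x. DERIV q x :> q' x" and "p 0 = q 0" "p' 0 = q' 0"
  shows "DERIV (\<lambda>x. if 0 \<le> x then p x else q x) x :> (if 0 \<le> x then p' x else q' x)"
proof (cases x "0 :: real" rule: linorder_cases)
  case less
  have "\<forall>\<^sub>F y in nhds x. (if 0 \<le> y then p y else q y) = q y"
    by (rule eventually_mono[OF eventually_nhds_in_open[of "{..<0}" x]]) (use less in auto)
  from DERIV_cong_ev[OF refl this refl] q[of x] less show ?thesis by simp
next
  case greater
  have "\<forall>\<^sub>F y in nhds x. (if 0 \<le> y then p y else q y) = p y"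
    by (rule eventually_mono[OF eventually_nhds_in_open[of "{0<..}" x]]) (use greater in auto)
  from DERIV_cong_ev[OF refl this refl] p[of x] greater show ?thesis by simp
next
  case equal
  have lp: "(\<lambda>h. (p (0 + h) - p 0) / h) \<midarrow>0\<rightarrow> p' 0" and lq: "(\<lambda>h. (q (0 + h) - q 0) / h) \<midarrow>0\<rightarrow> q' 0"
    using p[of 0] q[of 0] by (simp_all add: DERIV_def)
  have "((\<lambda>h. ((if 0 \<le> 0 + h then p (0 + h) else q (0 + h)) - p 0) / h) \<longlongrightarrow> p' 0) (at 0)"
  proof (rule filterlim_split_at_real)
    show "((\<lambda>h. ((if 0 \<le> 0 + h then p (0 + h) else q (0 + h)) - p 0) / h) \<longlongrightarrow> p' 0) (at_left 0)"
    proof (rule Lim_transform_eventually)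
      show "((\<lambda>h. (q (0 + h) - q 0) / h) \<longlongrightarrow> p' 0) (at_left 0)"
        unfolding assms(4) by (rule tendsto_within_subset[OF lq subset_UNIV])
      show "\<forall>\<^sub>F h in at_left 0. (q (0 + h) - q 0) / h = ((if 0 \<le> 0 + h then p (0 + h) else q (0 + h)) - p 0) / h"
        by (rule eventually_at_leftI[of "-1"]) (simp_all add: assms(3))
    qed
    show "((\<lambda>h. ((if 0 \<le> 0 + h then p (0 + h) else q (0 + h)) - p 0) / h) \<longlongrightarrow> p' 0) (at_right 0)"
    proof (rule Lim_transform_eventually)
      show "((\<lambda>h. (p (0 + h) - p 0) / h) \<longlongrightarrow> p' 0) (at_right 0)"
        by (rule tendsto_within_subset[OF lp subset_UNIV])
      show "\<forall>\<^sub>F h in at_right 0. (p (0 + h) - p 0) / h = ((if 0 \<le> 0 + h then p (0 + h) else q (0 + h)) - p 0) / h"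
        by (rule eventually_at_rightI[of _ 1]) simp_all
    qed
  qed
  then show ?thesis using equal by (simp add: DERIV_def)
qed

text \<open>The mean value bound is applied twice, so a Lipschitz second derivative is enough. This
  matters because the third derivative of \<open>bexp\<close> jumps at 0 from \<open>l ^ 3\<close>
  to \<open>- (l ^ 3)\<close>; the factor 1/6 is given away.\<close>

lemma taylor2_lipschitz:
  fixes f f1 f2 :: "real \<Rightarrow> real"
  assumes f: "\<And>x. DERIV f x :> f1 x" and f1: "\<And>x. DERIV f1 x :> f2 x"
    and lip: "\<And>x y. \<bar>f2 x - f2 y\<bar> \<le> L * \<bar>x - y\<bar>" and "0 \<le> L"
  shows "\<bar>f (x + h) - f x - f1 x * h - f2 x * h\<^sup>2 / 2\<bar> \<le> L * \<bar>h\<bar> ^ 3"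
proof -
  define S where "S = {-\<bar>h\<bar>..\<bar>h\<bar>}"
  have S: "convex S" "0 \<in> S" "h \<in> S" by (auto simp: S_def)
  have f': "((\<lambda>z. f (x + z)) has_field_derivative f1 (x + z)) (at z within S)" for z
    using DERIV_shift[of f "f1 (x + z)" z x] f[of "x + z"] by (simp add: add.commute has_field_derivative_at_within)
  have f1': "((\<lambda>z. f1 (x + z)) has_field_derivative f2 (x + z)) (at z within S)" for z
    using DERIV_shift[of f1 "f2 (x + z)" z x] f1[of "x + z"] by (simp add: add.commute has_field_derivative_at_within)
  have 1: "norm (f1 (x + z) - f1 x - f2 x * z) \<le> L * \<bar>h\<bar> * \<bar>h\<bar>" if z: "z \<in> S" for z
  proof -
    have "norm ((f1 (x + z) - f2 x * z) - (f1 (x + 0) - f2 x * 0)) \<le> L * \<bar>h\<bar> * norm (z - 0)"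
    proof (rule field_differentiable_bound[OF S(1) _ _ z S(2)])
      fix w assume "w \<in> S"
      show "((\<lambda>z. f1 (x + z) - f2 x * z) has_field_derivative (f2 (x + w) - f2 x)) (at w within S)"
        by (auto intro!: derivative_eq_intros f1')
      have "\<bar>f2 (x + w) - f2 x\<bar> \<le> L * \<bar>w\<bar>" using lip[of "x + w" x] by simp
      also have "\<dots> \<le> L * \<bar>h\<bar>" using \<open>w \<in> S\<close> \<open>0 \<le> L\<close> by (intro mult_left_mono) (auto simp: S_def)
      finally show "norm (f2 (x + w) - f2 x) \<le> L * \<bar>h\<bar>" by simp
    qed
    also have "\<dots> \<le> L * \<bar>h\<bar> * \<bar>h\<bar>" using z \<open>0 \<le> L\<close> by (intro mult_left_mono) (auto simp: S_def)
    finally show ?thesis by (simp add: algebra_simps)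
  qed
  have "norm ((f (x + h) - f1 x * h - f2 x * h\<^sup>2 / 2) - (f (x + 0) - f1 x * 0 - f2 x * 0\<^sup>2 / 2)) \<le> L * \<bar>h\<bar> * \<bar>h\<bar> * norm (h - 0)"
  proof (rule field_differentiable_bound[OF S(1) _ _ S(3) S(2)])
    fix w assume "w \<in> S"
    show "((\<lambda>z. f (x + z) - f1 x * z - f2 x * z\<^sup>2 / 2) has_field_derivative (f1 (x + w) - f1 x - f2 x * w)) (at w within S)"
      by (auto intro!: derivative_eq_intros f')
    show "norm (f1 (x + w) - f1 x - f2 x * w) \<le> L * \<bar>h\<bar> * \<bar>h\<bar>" by (rule 1[OF \<open>w \<in> S\<close>])
  qed
  then show ?thesis by (simp add: power3_eq_cube algebra_simps)
qed

lemma DERIV_imp_lipschitz: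
  fixes f :: "real \<Rightarrow> real"
  assumes f: "\<And>x. DERIV f x :> f' x" and S: "convex S" "x \<in> S" "y \<in> S" and B: "\<And>z. z \<in> S \<Longrightarrow> \<bar>f' z\<bar> \<le> B"
  shows "\<bar>f x - f y\<bar> \<le> B * \<bar>x - y\<bar>"
  using field_differentiable_bound[OF S(1) _ _ S(2,3), of f f' B] f B
  by (auto intro: has_field_derivative_at_within)

text \<open>Points on opposite sides are compared through 0, where the branches agree; their
  distances to 0 add up, so the constant is not enlarged.\<close>

lemma lipschitz_piecewise_at_zero:
  fixes p q :: "real \<Rightarrow> real"
  assumes p: "\<And>x y. 0 \<le> x \<Longrightarrow> 0 \<le> y \<Longrightarrow> \<bar>p x - p y\<bar> \<le> L * \<bar>x - y\<bar>"
    and q: "\<And>x y. x \<le> 0 \<Longrightarrow> y \<le> 0 \<Longrightarrow> \<bar>q x - q y\<bar> \<le> L * \<bar>x - y\<bar>" and eq: "p 0 = q 0"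
  shows "\<bar>(if 0 \<le> x then p x else q x) - (if 0 \<le> y then p y else q y)\<bar> \<le> L * \<bar>x - y\<bar>"
proof -
  have mixed: "\<bar>p x - q y\<bar> \<le> L * \<bar>x - y\<bar>" if "0 \<le> x" "y < 0" for x y
  proof -
    have "\<bar>p x - q y\<bar> \<le> \<bar>p x - p 0\<bar> + \<bar>q 0 - q y\<bar>" using eq by linarith
    also have "\<dots> \<le> L * \<bar>x - 0\<bar> + L * \<bar>0 - y\<bar>" using p[of x 0] q[of 0 y] that by (intro add_mono) auto
    also have "\<dots> = L * \<bar>x - y\<bar>" using that by (simp add: algebra_simps)
    finally show ?thesis .
  qed
  show ?thesis using p[of x y] q[of x y] mixed[of x y] mixed[of y x]
    by (auto simp: abs_minus_commute not_le)
qed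

text \<open>The exponential, continued to the negative axis by a bounded function with matching first
  and second derivatives at \<open>0\<close>; the values there are irrelevant for \<open>X\<close>.\<close>

definition bexp :: "real \<Rightarrow> real \<Rightarrow> real" where
  "bexp l x = (if 0 \<le> x then exp (- (l * x)) else 2 - cos (l * x) - sin (l * x))"

definition bexp1 :: "real \<Rightarrow> real \<Rightarrow> real" where
  "bexp1 l x = (if 0 \<le> x then - l * exp (- (l * x)) else l * sin (l * x) - l * cos (l * x))"

definition bexp2 :: "real \<Rightarrow> real \<Rightarrow> real" where
  "bexp2 l x = (if 0 \<le> x then l\<^sup>2 * exp (- (l * x)) else l\<^sup>2 * cos (l * x) + l\<^sup>2 * sin (l * x))"

lemma DERIV_bexp: "DERIV (bexp l) x :> bexp1 l x"
proof -
  have "DERIV (\<lambda>x. exp (- (l * x))) x :> - l * exp (- (l * x))" for x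
    by (auto intro!: derivative_eq_intros)
  moreover have "DERIV (\<lambda>x. 2 - cos (l * x) - sin (l * x)) x :> l * sin (l * x) - l * cos (l * x)" for x
    by (auto intro!: derivative_eq_intros)
  ultimately have "DERIV (\<lambda>x. if 0 \<le> x then exp (- (l * x)) else 2 - cos (l * x) - sin (l * x)) x :>
      (if 0 \<le> x then - l * exp (- (l * x)) else l * sin (l * x) - l * cos (l * x))"
    by (rule DERIV_piecewise_at_zero) simp_all
  then show ?thesis unfolding bexp_def[abs_def] bexp1_def .
qed

lemma DERIV_bexp1: "DERIV (bexp1 l) x :> bexp2 l x"
proof -
  have "DERIV (\<lambda>x. - l * exp (- (l * x))) x :> l\<^sup>2 * exp (- (l * x))" for x
    by (auto intro!: derivative_eq_intros simp: power2_eq_square)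
  moreover have "DERIV (\<lambda>x. l * sin (l * x) - l * cos (l * x)) x :> l\<^sup>2 * cos (l * x) + l\<^sup>2 * sin (l * x)" for x
    by (auto intro!: derivative_eq_intros simp: power2_eq_square)
  ultimately have "DERIV (\<lambda>x. if 0 \<le> x then - l * exp (- (l * x)) else l * sin (l * x) - l * cos (l * x)) x :>
      (if 0 \<le> x then l\<^sup>2 * exp (- (l * x)) else l\<^sup>2 * cos (l * x) + l\<^sup>2 * sin (l * x))"
    by (rule DERIV_piecewise_at_zero) simp_all
  then show ?thesis unfolding bexp1_def[abs_def] bexp2_def .
qed

lemma bexp2_lipschitz:
  assumes "0 < l"
  shows "\<bar>bexp2 l x - bexp2 l y\<bar> \<le> 2 * l ^ 3 * \<bar>x - y\<bar>"
proof -
  define p where "p = (\<lambda>x. l\<^sup>2 * exp (- (l * x)))"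
  define q where "q = (\<lambda>x. l\<^sup>2 * cos (l * x) + l\<^sup>2 * sin (l * x))"
  have dp: "DERIV p x :> - (l ^ 3 * exp (- (l * x)))" for x
    unfolding p_def by (auto intro!: derivative_eq_intros simp: power2_eq_square power3_eq_cube)
  have dq: "DERIV q x :> l ^ 3 * (cos (l * x) - sin (l * x))" for x
  proof -
    have "DERIV q x :> l\<^sup>2 * (- sin (l * x) * l) + l\<^sup>2 * (cos (l * x) * l)"
      unfolding q_def by (auto intro!: derivative_eq_intros)
    moreover have "l\<^sup>2 * (- sin (l * x) * l) + l\<^sup>2 * (cos (l * x) * l) = l ^ 3 * (cos (l * x) - sin (l * x))"
      unfolding power2_eq_square power3_eq_cube by (simp add: algebra_simps)
    ultimately show ?thesis by simp
  qed
  have bp: "\<bar>- (l ^ 3 * exp (- (l * z)))\<bar> \<le> 2 * l ^ 3" if "z \<in> {0..}" for z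
  proof -
    have "exp (- (l * z)) \<le> exp 0" using assms that by (subst exp_le_cancel_iff) simp
    then have "exp (- (l * z)) \<le> 2" unfolding exp_zero by linarith
    then have "l ^ 3 * exp (- (l * z)) \<le> l ^ 3 * 2" using assms by (intro mult_left_mono) simp_all
    then show ?thesis using assms by (simp add: abs_mult)
  qed
  have bq: "\<bar>l ^ 3 * (cos (l * z) - sin (l * z))\<bar> \<le> 2 * l ^ 3" for z
  proof -
    have "\<bar>cos (l * z) - sin (l * z)\<bar> \<le> 2" using abs_cos_le_one[of "l * z"] abs_sin_le_one[of "l * z"] by linarith
    then have "l ^ 3 * \<bar>cos (l * z) - sin (l * z)\<bar> \<le> l ^ 3 * 2" using assms by (intro mult_left_mono) simp_all
    then show ?thesis using assms by (simp add: abs_mult)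
  qed
  have "\<bar>(if 0 \<le> x then p x else q x) - (if 0 \<le> y then p y else q y)\<bar> \<le> 2 * l ^ 3 * \<bar>x - y\<bar>"
  proof (rule lipschitz_piecewise_at_zero)
    show "\<bar>p x - p y\<bar> \<le> 2 * l ^ 3 * \<bar>x - y\<bar>" if "0 \<le> x" "0 \<le> y" for x y
      by (rule DERIV_imp_lipschitz[OF dp convex_real_interval(1) _ _ bp]) (use that in simp_all)
    show "\<bar>q x - q y\<bar> \<le> 2 * l ^ 3 * \<bar>x - y\<bar>" for x y
      by (rule DERIV_imp_lipschitz[OF dq convex_UNIV _ _ bq]) simp_all
    show "p 0 = q 0" by (simp add: p_def q_def)
  qed
  then show ?thesis unfolding bexp2_def p_def q_def .
qed

lemma mult_exp_le_one: "0 \<le> y \<Longrightarrow> y * exp (- y) \<le> (1 :: real)"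
proof -
  assume "0 \<le> y"
  have "y \<le> exp y" using exp_ge_add_one_self[of y] by linarith
  then have "y * exp (- y) \<le> exp y * exp (- y)" by (intro mult_right_mono) auto
  then show ?thesis by (simp add: exp_minus)
qed

text \<open>On the positive axis the weight is absorbed by \<open>mult_exp_le_one\<close>; on [-1,0)
  it is at most 2 and the trigonometric branch is bounded. The constant is a crude sum of the bounds
  that occur.\<close>

lemma test_function_bexp:
  assumes l: "0 < l"
  shows "test_function (bexp l) (bexp1 l) (bexp2 l) (4 + 4 * l + 4 * l\<^sup>2 + 2 * l ^ 3)"
    (is "test_function _ _ _ ?K")
proof -
  have sc: "\<bar>cos (l * x)\<bar> \<le> 1" "\<bar>sin (l * x)\<bar> \<le> 1" for x by auto
  have e: "0 < exp (- (l * x))" "exp (- (l * x)) \<le> 1" if "0 \<le> x" for x using l that by auto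
  have l3: "0 < l\<^sup>2" "0 < l ^ 3" using l by auto
  have b0: "\<bar>bexp l x\<bar> \<le> 4" for x
  proof (cases "0 \<le> x")
    case True
    then show ?thesis using e[of x] unfolding bexp_def by (simp add: order_trans[of _ 1 4])
  next
    case False
    have "\<bar>2 - cos (l * x) - sin (l * x)\<bar> \<le> 4" using sc[of x] by linarith
    then show ?thesis using False by (simp add: bexp_def)
  qed
  have b1: "\<bar>bexp1 l x\<bar> \<le> 2 * l" for x
  proof (cases "0 \<le> x")
    case True
    then have "l * exp (- (l * x)) \<le> l * 1" using e l by (intro mult_left_mono) auto
    moreover have "\<bar>bexp1 l x\<bar> = l * exp (- (l * x))" using True l by (simp add: bexp1_def abs_mult)
    ultimately show ?thesis using l by linarith
  next
    case False
    have "\<bar>sin (l * x) - cos (l * x)\<bar> \<le> 2" using sc[of x] by linarith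
    then have "l * \<bar>sin (l * x) - cos (l * x)\<bar> \<le> l * 2" using l by (intro mult_left_mono) auto
    then show ?thesis using False l by (simp add: bexp1_def abs_mult flip: right_diff_distrib)
  qed
  have b2: "\<bar>bexp2 l x\<bar> \<le> 2 * l\<^sup>2" for x
  proof (cases "0 \<le> x")
    case True
    then have "l\<^sup>2 * exp (- (l * x)) \<le> l\<^sup>2 * 1" using e by (intro mult_left_mono) auto
    moreover have "\<bar>bexp2 l x\<bar> = l\<^sup>2 * exp (- (l * x))" using True by (simp add: bexp2_def abs_mult)
    ultimately show ?thesis using l3 by linarith
  next
    case False
    have "\<bar>cos (l * x) + sin (l * x)\<bar> \<le> 2" using sc[of x] by linarith
    then have "l\<^sup>2 * \<bar>cos (l * x) + sin (l * x)\<bar> \<le> l\<^sup>2 * 2" using l by (intro mult_left_mono) auto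
    then show ?thesis using False l by (simp add: bexp2_def abs_mult flip: distrib_left)
  qed
  have c1: "\<bar>bexp1 l x\<bar> * (1 + \<bar>x\<bar>) \<le> ?K" if "-1 \<le> x" for x
  proof (cases "0 \<le> x")
    case True
    have "\<bar>bexp1 l x\<bar> * (1 + \<bar>x\<bar>) = l * exp (- (l * x)) + (l * x) * exp (- (l * x))"
      using True l by (simp add: bexp1_def abs_mult algebra_simps)
    also have "\<dots> \<le> l * 1 + 1"
      using True l e by (intro add_mono mult_left_mono mult_exp_le_one) auto
    finally show ?thesis using l l3 by linarith
  next
    case False
    then have "\<bar>bexp1 l x\<bar> * (1 + \<bar>x\<bar>) \<le> (2 * l) * 2" using b1 that l by (intro mult_mono) auto
    then show ?thesis using l l3 by linarith
  qed
  have c2: "\<bar>bexp2 l x\<bar> * (1 + \<bar>x\<bar>) \<le> ?K" if "-1 \<le> x" for x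
  proof (cases "0 \<le> x")
    case True
    have "\<bar>bexp2 l x\<bar> * (1 + \<bar>x\<bar>) = l\<^sup>2 * exp (- (l * x)) + l * ((l * x) * exp (- (l * x)))"
      using True l by (simp add: bexp2_def abs_mult power2_eq_square algebra_simps)
    also have "\<dots> \<le> l\<^sup>2 * 1 + l * 1"
      using True l e by (intro add_mono mult_left_mono mult_exp_le_one) auto
    finally show ?thesis using l l3 by linarith
  next
    case False
    then have "\<bar>bexp2 l x\<bar> * (1 + \<bar>x\<bar>) \<le> (2 * l\<^sup>2) * 2" using b2 that l by (intro mult_mono) auto
    then show ?thesis using l l3 by linarith
  qed
  have b2_cont: "continuous_on UNIV (bexp2 l)"
  proof (rule lipschitz_on_continuous_on)
    show "(2 * l ^ 3)-lipschitz_on UNIV (bexp2 l)"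
      using bexp2_lipschitz[OF l] l by (auto simp: lipschitz_on_def dist_real_def)
  qed
  have tay: "\<bar>bexp l (x + h) - bexp l x - bexp1 l x * h - bexp2 l x * h\<^sup>2 / 2\<bar> \<le> ?K * \<bar>h\<bar> ^ 3" for x h
  proof -
    have "\<bar>bexp l (x + h) - bexp l x - bexp1 l x * h - bexp2 l x * h\<^sup>2 / 2\<bar> \<le> 2 * l ^ 3 * \<bar>h\<bar> ^ 3"
      by (rule taylor2_lipschitz[OF DERIV_bexp DERIV_bexp1 bexp2_lipschitz[OF l]]) (use l in simp)
    also have "\<dots> \<le> ?K * \<bar>h\<bar> ^ 3" using l by (intro mult_right_mono) auto
    finally show ?thesis .
  qed
  have bounds: "\<bar>bexp l x\<bar> \<le> ?K \<and> \<bar>bexp1 l x\<bar> \<le> ?K \<and> \<bar>bexp2 l x\<bar> \<le> ?K" for x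
    using b0[of x] b1[of x] b2[of x] l l3 by linarith
  show ?thesis
    unfolding test_function_def
  proof (intro conjI allI impI bounds[THEN conjunct1] bounds[THEN conjunct2, THEN conjunct1]
      bounds[THEN conjunct2, THEN conjunct2] b2_cont tay c1 c2)
    show "continuous_on UNIV (bexp l)" "continuous_on UNIV (bexp1 l)"
      using DERIV_bexp DERIV_bexp1 by (meson DERIV_isCont continuous_at_imp_continuous_on)+
  qed
qed

text \<open>\<open>sat l\<close> increases to the identity as \<open>l\<close> decreases to \<open>0\<close>, and its powers are linear
  combinations of exponentials.\<close>

definition sat :: "real \<Rightarrow> real \<Rightarrow> real" where
  "sat l x = (1 - exp (- (l * x))) / l"

text \<open>The third bound is \<open>(1 + y) * exp (- y) \<le> 1\<close> at
  \<open>y = l * x\<close>. It squeezes \<open>sat\<close> from below in the limit and lets the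
  diffusion term of the fourth-moment estimate be expressed through \<open>sat\<close>.\<close>

lemma sat_bounds:
  assumes "0 < l" "0 \<le> x"
  shows "0 \<le> sat l x" "sat l x \<le> x" "x * exp (- (l * x)) \<le> sat l x" "l * sat l x \<le> 1"
proof -
  have "1 - l * x \<le> exp (- (l * x))" using exp_ge_add_one_self[of "- (l * x)"] by simp
  then show "sat l x \<le> x" using assms by (simp add: sat_def field_simps)
  show "0 \<le> sat l x" "l * sat l x \<le> 1" using assms by (auto simp: sat_def)
  have "(1 + l * x) * exp (- (l * x)) \<le> exp (l * x) * exp (- (l * x))"
    using exp_ge_add_one_self[of "l * x"] by (intro mult_right_mono) auto
  then have "(1 + l * x) * exp (- (l * x)) \<le> 1" by (simp flip: exp_add)
  then show "x * exp (- (l * x)) \<le> sat l x" using assms by (simp add: sat_def field_simps)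
qed

lemma exp_scale_tendsto: "(\<lambda>n. exp (- ((1 / real (Suc n)) * x))) \<longlonglongrightarrow> 1"
proof -
  have "(\<lambda>n. exp (- ((1 / real (Suc n)) * x))) \<longlonglongrightarrow> exp (- (0 * x))"
    by (intro tendsto_exp tendsto_minus tendsto_mult tendsto_const LIMSEQ_Suc[OF lim_1_over_n])
  then show ?thesis by simp
qed

lemma sat_tendsto:
  assumes "0 \<le> x"
  shows "(\<lambda>n. sat (1 / real (Suc n)) x) \<longlonglongrightarrow> x"
proof (rule real_tendsto_sandwich)
  show "\<forall>\<^sub>F n in sequentially. x * exp (- ((1 / real (Suc n)) * x)) \<le> sat (1 / real (Suc n)) x"
    using assms by (intro always_eventually allI sat_bounds) auto
  show "\<forall>\<^sub>F n in sequentially. sat (1 / real (Suc n)) x \<le> x"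
    using assms by (intro always_eventually allI sat_bounds) auto
  have "(\<lambda>n. x * exp (- ((1 / real (Suc n)) * x))) \<longlonglongrightarrow> x * 1"
    by (intro tendsto_mult tendsto_const exp_scale_tendsto)
  then show "(\<lambda>n. x * exp (- ((1 / real (Suc n)) * x))) \<longlonglongrightarrow> x" by simp
qed simp

section \<open>The martingale problem for bounded functions\<close>

context cir
begin

text \<open>The martingale problem for a function and its generator image. Stated without
  derivatives it is stable under linear combinations, and boundedness is asked on [0,\<infinity>),
  where \<open>X\<close> lives.\<close>

definition bdynkin :: "(real \<Rightarrow> real) \<Rightarrow> (real \<Rightarrow> real) \<Rightarrow> bool" where
  "bdynkin f L \<longleftrightarrow> f \<in> borel_measurable borel \<and> L \<in> borel_measurable borel \<and>
    (\<exists>B. \<forall>x\<ge>0. \<bar>f x\<bar> \<le> B \<and> \<bar>L x\<bar> \<le> B) \<and>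
    (\<forall>s t Z C. 0 \<le> s \<longrightarrow> s \<le> t \<longrightarrow> Z \<in> borel_measurable (F s) \<longrightarrow> (\<forall>\<omega>\<in>space M. \<bar>Z \<omega>\<bar> \<le> C) \<longrightarrow>
      (\<integral>\<omega>. Z \<omega> * (f (X t \<omega>) - f (X s \<omega>) - (LBINT u:{s..t}. L (X u \<omega>))) \<partial>M) = 0)"

lemma bounded_path_integrable:
  fixes L :: "real \<Rightarrow> real"
  assumes "L \<in> borel_measurable borel" "\<And>x. 0 \<le> x \<Longrightarrow> \<bar>L x\<bar> \<le> B"
  shows "set_integrable lborel {s..t} (\<lambda>u. L (X u \<omega>))"
  by (rule set_integrable_bounded_interval[where B = B]) (use assms X_nonneg in auto)

lemma bounded_path_integral_le:
  fixes L :: "real \<Rightarrow> real"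
  assumes "L \<in> borel_measurable borel" "\<And>x. 0 \<le> x \<Longrightarrow> \<bar>L x\<bar> \<le> B" "s \<le> t"
  shows "\<bar>LBINT u:{s..t}. L (X u \<omega>)\<bar> \<le> B * (t - s)"
proof -
  note i = bounded_path_integrable[OF assms(1,2)]
  have "\<bar>LBINT u:{s..t}. L (X u \<omega>)\<bar> \<le> (\<integral>u. norm (indicator {s..t} u *\<^sub>R L (X u \<omega>)) \<partial>lborel)"
    unfolding set_lebesgue_integral_def real_norm_def[symmetric] by (rule integral_norm_bound)
  also have "\<dots> \<le> (\<integral>u. B * indicator {s..t} u \<partial>lborel)"
    using i[unfolded set_integrable_def] assms(2) X_nonneg
    by (intro integral_mono integrable_norm integrable_const_interval) (auto simp: indicator_def)
  also have "\<dots> = B * (t - s)" using assms(3) by simp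
  finally show ?thesis .
qed

lemma bdynkin_integrable:
  fixes f L :: "real \<Rightarrow> real" and Z :: "'a \<Rightarrow> real"
  assumes f: "f \<in> borel_measurable borel" "L \<in> borel_measurable borel"
    and B: "\<And>x. 0 \<le> x \<Longrightarrow> \<bar>f x\<bar> \<le> B \<and> \<bar>L x\<bar> \<le> B"
    and Z: "Z \<in> borel_measurable M" "\<And>\<omega>. \<omega> \<in> space M \<Longrightarrow> \<bar>Z \<omega>\<bar> \<le> C" and "s \<le> t"
  shows "integrable M (\<lambda>\<omega>. Z \<omega> * (f (X t \<omega>) - f (X s \<omega>) - (LBINT u:{s..t}. L (X u \<omega>))))"
proof (rule integrable_const_bound)
  have C: "0 \<le> C" using Z(2) not_empty by (meson abs_ge_zero all_not_in_conv order_trans)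
  show "AE \<omega> in M. norm (Z \<omega> * (f (X t \<omega>) - f (X s \<omega>) - (LBINT u:{s..t}. L (X u \<omega>)))) \<le> C * (2 * B + B * (t - s))"
  proof (rule AE_I2)
    fix \<omega> assume "\<omega> \<in> space M"
    have "\<bar>f (X t \<omega>) - f (X s \<omega>) - (LBINT u:{s..t}. L (X u \<omega>))\<bar> \<le> 2 * B + B * (t - s)"
      using bounded_path_integral_le[OF f(2) _ \<open>s \<le> t\<close>, of B \<omega>] B[of "X t \<omega>"] B[of "X s \<omega>"] B X_nonneg
      by (smt (verit))
    then show "norm (Z \<omega> * (f (X t \<omega>) - f (X s \<omega>) - (LBINT u:{s..t}. L (X u \<omega>)))) \<le> C * (2 * B + B * (t - s))"
      unfolding real_norm_def abs_mult using Z(2)[OF \<open>\<omega> \<in> space M\<close>] C by (intro mult_mono) auto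
  qed
  have [measurable]: "(\<lambda>\<omega>. LBINT u:{s..t}. L (X u \<omega>)) \<in> borel_measurable M" by (rule path_integral_M[OF f(2)])
  show "(\<lambda>\<omega>. Z \<omega> * (f (X t \<omega>) - f (X s \<omega>) - (LBINT u:{s..t}. L (X u \<omega>)))) \<in> borel_measurable M"
    using f(1) Z(1) by measurable
qed

lemma bdynkin_lincomb:
  assumes 1: "bdynkin f L" and 2: "bdynkin g K"
  shows "bdynkin (\<lambda>x. \<alpha> * f x + \<beta> * g x) (\<lambda>x. \<alpha> * L x + \<beta> * K x)"
proof -
  obtain B where B: "\<And>x. 0 \<le> x \<Longrightarrow> \<bar>f x\<bar> \<le> B \<and> \<bar>L x\<bar> \<le> B" using 1 by (auto simp: bdynkin_def)
  obtain B' where B': "\<And>x. 0 \<le> x \<Longrightarrow> \<bar>g x\<bar> \<le> B' \<and> \<bar>K x\<bar> \<le> B'" using 2 by (auto simp: bdynkin_def)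
  have m [measurable]: "f \<in> borel_measurable borel" "L \<in> borel_measurable borel"
    "g \<in> borel_measurable borel" "K \<in> borel_measurable borel" using 1 2 by (auto simp: bdynkin_def)
  have lin: "\<bar>\<alpha> * y + \<beta> * z\<bar> \<le> \<bar>\<alpha>\<bar> * B + \<bar>\<beta>\<bar> * B'" if "\<bar>y\<bar> \<le> B" "\<bar>z\<bar> \<le> B'" for y z
    by (rule order_trans[OF abs_triangle_ineq]) (unfold abs_mult, intro add_mono mult_left_mono that abs_ge_zero)
  have "\<exists>B. \<forall>x\<ge>0. \<bar>\<alpha> * f x + \<beta> * g x\<bar> \<le> B \<and> \<bar>\<alpha> * L x + \<beta> * K x\<bar> \<le> B"
    using lin B B' by blast
  moreover have "(\<integral>\<omega>. Z \<omega> * ((\<alpha> * f (X t \<omega>) + \<beta> * g (X t \<omega>)) - (\<alpha> * f (X s \<omega>) + \<beta> * g (X s \<omega>)) -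
      (LBINT u:{s..t}. \<alpha> * L (X u \<omega>) + \<beta> * K (X u \<omega>))) \<partial>M) = 0"
    if st: "0 \<le> s" "s \<le> t" and Z: "Z \<in> borel_measurable (F s)" "\<forall>\<omega>\<in>space M. \<bar>Z \<omega>\<bar> \<le> C" for s t Z C
  proof -
    define D1 where "D1 = (\<lambda>\<omega>. Z \<omega> * (f (X t \<omega>) - f (X s \<omega>) - (LBINT u:{s..t}. L (X u \<omega>))))"
    define D2 where "D2 = (\<lambda>\<omega>. Z \<omega> * (g (X t \<omega>) - g (X s \<omega>) - (LBINT u:{s..t}. K (X u \<omega>))))"
    note ZM = measurable_F_M[OF Z(1)]
    have i: "integrable M D1" "integrable M D2"
      unfolding D1_def D2_def
      by (rule bdynkin_integrable[OF m(1,2) B ZM _ st(2)], use Z(2) in auto)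
        (rule bdynkin_integrable[OF m(3,4) B' ZM _ st(2)], use Z(2) in auto)
    have z: "(\<integral>\<omega>. D1 \<omega> \<partial>M) = 0" "(\<integral>\<omega>. D2 \<omega> \<partial>M) = 0"
      using 1 2 st Z unfolding bdynkin_def D1_def D2_def by blast+
    have "set_integrable lborel {s..t} (\<lambda>u. L (X u \<omega>))" "set_integrable lborel {s..t} (\<lambda>u. K (X u \<omega>))" for \<omega>
      using bounded_path_integrable[OF m(2), of B] bounded_path_integrable[OF m(4), of B'] B B' by auto
    then have "(LBINT u:{s..t}. \<alpha> * L (X u \<omega>) + \<beta> * K (X u \<omega>)) =
        \<alpha> * (LBINT u:{s..t}. L (X u \<omega>)) + \<beta> * (LBINT u:{s..t}. K (X u \<omega>))" for \<omega>
      by (subst set_integral_add(2)) simp_all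
    then have "(\<lambda>\<omega>. Z \<omega> * ((\<alpha> * f (X t \<omega>) + \<beta> * g (X t \<omega>)) - (\<alpha> * f (X s \<omega>) + \<beta> * g (X s \<omega>)) -
      (LBINT u:{s..t}. \<alpha> * L (X u \<omega>) + \<beta> * K (X u \<omega>)))) = (\<lambda>\<omega>. \<alpha> * D1 \<omega> + \<beta> * D2 \<omega>)"
      unfolding D1_def D2_def by (simp add: fun_eq_iff algebra_simps)
    then show ?thesis using i z by simp
  qed
  ultimately show ?thesis unfolding bdynkin_def using m by auto
qed

text \<open>Changes on the negative axis are invisible to \<open>X\<close>; this is how
  \<open>bexp\<close> gives way to the plain exponential.\<close>

lemma bdynkin_cong:
  assumes 1: "bdynkin f L" and "\<And>x. 0 \<le> x \<Longrightarrow> f x = g x" "\<And>x. 0 \<le> x \<Longrightarrow> L x = K x"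
    "g \<in> borel_measurable borel" "K \<in> borel_measurable borel"
  shows "bdynkin g K"
proof -
  have "f (X u \<omega>) = g (X u \<omega>)" "L (X u \<omega>) = K (X u \<omega>)" for u \<omega> using assms X_nonneg by auto
  then show ?thesis using assms unfolding bdynkin_def by simp
qed

lemma bdynkin_const: "bdynkin (\<lambda>_. c) (\<lambda>_. 0)"
  unfolding bdynkin_def by (auto intro!: exI[of _ "\<bar>c\<bar>"])

lemma bdynkin_exp:
  assumes "0 < l"
  shows "bdynkin (\<lambda>x. exp (- (l * x)))
    (\<lambda>x. - l * exp (- (l * x)) * (a - b * x) + l\<^sup>2 * exp (- (l * x)) * (\<sigma>\<^sup>2 * x) / 2)"
proof (rule bdynkin_cong)
  note T = test_function_bexp[OF assms]
  let ?K = "4 + 4 * l + 4 * l\<^sup>2 + 2 * l ^ 3"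
  show "bdynkin (bexp l) (gen (bexp1 l) (bexp2 l))"
    unfolding bdynkin_def
  proof (intro conjI allI impI)
    show "bexp l \<in> borel_measurable borel"
      using T by (auto simp: test_function_def intro: borel_measurable_continuous_onI)
    show "gen (bexp1 l) (bexp2 l) \<in> borel_measurable borel"
      by (rule borel_measurable_continuous_onI[OF gen_continuous[OF T]])
    have "\<bar>bexp l x\<bar> \<le> ?K" for x using T by (auto simp: test_function_def)
    then show "\<exists>B. \<forall>x\<ge>0. \<bar>bexp l x\<bar> \<le> B \<and> \<bar>gen (bexp1 l) (bexp2 l) x\<bar> \<le> B"
      using gen_bound[OF T] by (intro exI[of _ "max ?K ((a + b) * ?K + \<sigma>\<^sup>2 * ?K / 2)"]) (auto intro: max.coboundedI1 max.coboundedI2)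
    fix s t Z C
    assume "0 \<le> s" "s \<le> t" "Z \<in> borel_measurable (F s)" "\<forall>\<omega>\<in>space M. \<bar>Z \<omega>\<bar> \<le> (C :: real)"
    then show "(\<integral>\<omega>. Z \<omega> * (bexp l (X t \<omega>) - bexp l (X s \<omega>) - (LBINT u:{s..t}. gen (bexp1 l) (bexp2 l) (X u \<omega>))) \<partial>M) = 0"
      by (intro dynkin_test[OF _ _ T, of s t Z C]) auto
  qed
qed (auto simp: bexp_def bexp1_def bexp2_def gen_def)

text \<open>The power \<open>exp (- (l * x)) ^ Suc k\<close> is again an exponential, of rate
  \<open>Suc k * l\<close>, so all polynomials in \<open>exp (- (l * x))\<close> follow by
  linearity.\<close>

lemma bdynkin_exp_sum:
  assumes "0 < l"
  shows "bdynkin (\<lambda>x. c 0 + (\<Sum>k<n. c (Suc k) * exp (- (l * x)) ^ Suc k))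
    (\<lambda>x. \<Sum>k<n. c (Suc k) * (- (real (Suc k) * l) * exp (- (l * x)) ^ Suc k * (a - b * x) +
        (real (Suc k) * l)\<^sup>2 * exp (- (l * x)) ^ Suc k * (\<sigma>\<^sup>2 * x) / 2))"
proof (induction n)
  case 0
  show ?case using bdynkin_const by simp
next
  case (Suc n)
  have "0 < real (Suc n) * l" using assms by simp
  note D = bdynkin_lincomb[OF Suc bdynkin_exp[OF this], of 1 "c (Suc n)"]
  have E: "exp (- (real (Suc n) * l * x)) = exp (- (l * x)) ^ Suc n" for x
    using exp_of_nat_mult[of "Suc n" "- (l * x)"] by (simp add: mult_ac)
  show ?case
  proof (rule bdynkin_cong[OF D])
    fix x :: real
    show "1 * (c 0 + (\<Sum>k<n. c (Suc k) * exp (- (l * x)) ^ Suc k)) + c (Suc n) * exp (- (real (Suc n) * l * x)) =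
      c 0 + (\<Sum>k<Suc n. c (Suc k) * exp (- (l * x)) ^ Suc k)"
      unfolding E sum.lessThan_Suc mult_1 by (rule add.assoc)
  qed (unfold E sum.lessThan_Suc mult_1, rule refl, measurable)
qed

text \<open>With \<open>g = sat l\<close> and \<open>e = exp (- (l * x))\<close> the derivatives are
  \<open>g' = e\<close> and \<open>g'' = - l * e\<close>. This definition and the next two are the
  generator applied to \<open>g\<close>, \<open>g ^ 2\<close> and \<open>g ^ 4\<close>; as
  \<open>l\<close> tends to 0 they become the generator images of \<open>x\<close>,
  \<open>x ^ 2\<close> and \<open>x ^ 4\<close>.\<close>

definition sat_gen1 :: "real \<Rightarrow> real \<Rightarrow> real" where
  "sat_gen1 l x = exp (- (l * x)) * (a - b * x) - l * exp (- (l * x)) * (\<sigma>\<^sup>2 * x) / 2"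

definition sat_gen2 :: "real \<Rightarrow> real \<Rightarrow> real" where
  "sat_gen2 l x = 2 * sat l x * exp (- (l * x)) * (a - b * x) +
    (2 * exp (- (l * x)) ^ 2 - 2 * l * sat l x * exp (- (l * x))) * (\<sigma>\<^sup>2 * x) / 2"

definition sat_gen4 :: "real \<Rightarrow> real \<Rightarrow> real" where
  "sat_gen4 l x = 4 * sat l x ^ 3 * exp (- (l * x)) * (a - b * x) +
    (12 * sat l x ^ 2 * exp (- (l * x)) ^ 2 - 4 * l * sat l x ^ 3 * exp (- (l * x))) * (\<sigma>\<^sup>2 * x) / 2"

lemma sat_borel [measurable]: "sat l \<in> borel_measurable borel"
  unfolding sat_def[abs_def] by measurable

lemma sat_gen_borel [measurable]:
  "sat_gen1 l \<in> borel_measurable borel" "sat_gen2 l \<in> borel_measurable borel" "sat_gen4 l \<in> borel_measurable borel"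
  unfolding sat_gen1_def[abs_def] sat_gen2_def[abs_def] sat_gen4_def[abs_def] by measurable

text \<open>Here and in the next two lemmas the list contains the coefficients of
  \<open>(1 - e) ^ p / l ^ p\<close> in powers of \<open>e = exp (- (l * x))\<close>.\<close>

lemma bdynkin_sat:
  assumes "0 < l"
  shows "bdynkin (sat l) (sat_gen1 l)"
  by (rule bdynkin_cong[OF bdynkin_exp_sum[OF assms, of "(!) [1 / l, - 1 / l]" 1]])
    (use assms in \<open>simp_all add: sat_def sat_gen1_def power2_eq_square field_simps\<close>)

lemma bdynkin_sat2:
  assumes "0 < l"
  shows "bdynkin (\<lambda>x. sat l x ^ 2) (sat_gen2 l)"
proof (rule bdynkin_cong[OF bdynkin_exp_sum[OF assms, of "(!) [1 / l\<^sup>2, - 2 / l\<^sup>2, 1 / l\<^sup>2]" 2]])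
  fix x :: real
  define e where "e = exp (- (l * x))"
  show "[1 / l\<^sup>2, - 2 / l\<^sup>2, 1 / l\<^sup>2] ! 0 + (\<Sum>k<2. [1 / l\<^sup>2, - 2 / l\<^sup>2, 1 / l\<^sup>2] ! Suc k * exp (- (l * x)) ^ Suc k) = (sat l x)\<^sup>2"
    using assms unfolding sat_def e_def[symmetric]
    by (simp add: eval_nat_numeral field_simps)
  show "(\<Sum>k<2. [1 / l\<^sup>2, - 2 / l\<^sup>2, 1 / l\<^sup>2] ! Suc k * (- (real (Suc k) * l) * exp (- (l * x)) ^ Suc k * (a - b * x) +
        (real (Suc k) * l)\<^sup>2 * exp (- (l * x)) ^ Suc k * (\<sigma>\<^sup>2 * x) / 2)) = sat_gen2 l x"
    using assms unfolding sat_gen2_def sat_def e_def[symmetric]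
    by (simp add: eval_nat_numeral field_simps)
qed measurable

lemma bdynkin_sat4:
  assumes "0 < l"
  shows "bdynkin (\<lambda>x. sat l x ^ 4) (sat_gen4 l)"
proof (rule bdynkin_cong[OF bdynkin_exp_sum[OF assms, of "(!) [1 / l^4, - 4 / l^4, 6 / l^4, - 4 / l^4, 1 / l^4]" 4]])
  fix x :: real
  define e where "e = exp (- (l * x))"
  show "[1 / l^4, - 4 / l^4, 6 / l^4, - 4 / l^4, 1 / l^4] ! 0 +
      (\<Sum>k<4. [1 / l^4, - 4 / l^4, 6 / l^4, - 4 / l^4, 1 / l^4] ! Suc k * exp (- (l * x)) ^ Suc k) = (sat l x) ^ 4"
    using assms unfolding sat_def e_def[symmetric]
    by (simp add: eval_nat_numeral field_simps)
  show "(\<Sum>k<4. [1 / l^4, - 4 / l^4, 6 / l^4, - 4 / l^4, 1 / l^4] ! Suc k * (- (real (Suc k) * l) * exp (- (l * x)) ^ Suc k * (a - b * x) +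
        (real (Suc k) * l)\<^sup>2 * exp (- (l * x)) ^ Suc k * (\<sigma>\<^sup>2 * x) / 2)) = sat_gen4 l x"
    using assms unfolding sat_gen4_def sat_def e_def[symmetric]
    by (simp add: eval_nat_numeral field_simps)
qed measurable

text \<open>With \<open>c = 4 * a + 6 * \<sigma>\<^sup>2\<close> this bounds
  \<open>c * g ^ 3\<close> for \<open>0 \<le> g \<le> c / (2 * b)\<close>; beyond that threshold
  \<open>c * g ^ 3\<close> is at most \<open>2 * b * g ^ 4\<close>.\<close>

definition c4 :: real where "c4 = (4 * a + 6 * \<sigma>\<^sup>2) * ((4 * a + 6 * \<sigma>\<^sup>2) / (2 * b)) ^ 3"

lemma c4_nonneg: "0 \<le> c4"
  using pos unfolding c4_def by (intro mult_nonneg_nonneg zero_le_power divide_nonneg_nonneg) auto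

text \<open>The drift contributes \<open>- 4 * b * g ^ 4\<close> with \<open>g = sat l x\<close>, up
  to the factor \<open>exp (- (l * x))\<close>. Half of it absorbs all cubic terms at the price of
  \<open>c4\<close>, the other half remains as dissipation. The exponential factor stems from the
  derivative of \<open>sat\<close> and tends to 1 with \<open>l\<close>.\<close>

lemma sat_gen4_le:
  assumes "0 < l" "0 \<le> x"
  shows "sat_gen4 l x \<le> c4 - 2 * b * (exp (- (l * x)) * sat l x ^ 4)"
proof -
  define e where "e = exp (- (l * x))"
  define g where "g = sat l x"
  define c where "c = 4 * a + 6 * \<sigma>\<^sup>2"
  have e: "0 < e" "e \<le> 1" using assms by (auto simp: e_def)
  have g: "0 \<le> g" "g \<le> x" "x * e \<le> g" using sat_bounds[OF assms] by (auto simp: g_def e_def)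
  have c: "0 < c" using pos by (simp add: c_def add_pos_nonneg)
  have cube: "c * g ^ 3 \<le> c4 + 2 * b * g ^ 4"
  proof (cases "g \<le> c / (2 * b)")
    case True
    then have "g ^ 3 \<le> (c / (2 * b)) ^ 3" using g by (intro power_mono) auto
    then have "c * g ^ 3 \<le> c4" unfolding c4_def c_def[symmetric] using c by (intro mult_left_mono) auto
    moreover have "0 \<le> 2 * b * g ^ 4" using pos by simp
    ultimately show ?thesis by linarith
  next
    case False
    then have "c \<le> 2 * b * g" using pos by (simp add: field_simps)
    then have "c * g ^ 3 \<le> (2 * b * g) * g ^ 3" using g by (intro mult_right_mono) auto
    also have "\<dots> = 2 * b * g ^ 4" by (simp add: eval_nat_numeral)
    finally show ?thesis using c4_nonneg by linarith
  qed
  have "sat_gen4 l x = e * (4 * a * g ^ 3) - e * (4 * b * (x * g ^ 3)) + e * (6 * \<sigma>\<^sup>2 * (g\<^sup>2 * (x * e))) - 2 * l * g ^ 3 * e * (\<sigma>\<^sup>2 * x)"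
    unfolding sat_gen4_def e_def[symmetric] g_def[symmetric] by (simp add: power2_eq_square field_simps)
  \<comment> \<open>\<open>g \<le> x\<close> is used in the drift term, \<open>x * e \<le> g\<close>
    in the diffusion term, and the negative term from the second derivative of \<open>sat\<close> is
    dropped.\<close>
  also have "\<dots> \<le> e * (4 * a * g ^ 3) - e * (4 * b * (g * g ^ 3)) + e * (6 * \<sigma>\<^sup>2 * (g\<^sup>2 * g)) - 0"
    using e g pos assms
    by (intro add_mono diff_mono mult_left_mono mult_right_mono order_refl) (auto intro!: mult_nonneg_nonneg)
  also have "\<dots> = e * (c * g ^ 3 - 4 * b * g ^ 4)"
    by (simp add: c_def eval_nat_numeral algebra_simps)
  also have "\<dots> \<le> e * (c4 - 2 * b * g ^ 4)" using cube e by (intro mult_left_mono) auto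
  also have "\<dots> = e * c4 - 2 * b * (e * g ^ 4)" by (simp add: algebra_simps)
  also have "\<dots> \<le> 1 * c4 - 2 * b * (e * g ^ 4)" using e c4_nonneg by (intro diff_right_mono mult_right_mono) auto
  finally show ?thesis by (simp add: e_def g_def)
qed

text \<open>For fixed \<open>l\<close> every quantity is bounded, so the martingale identity can be
  used with the constant 1 for \<open>Z\<close> before any moment of \<open>X\<close> is
  known.\<close>

lemma sat4_moment_le:
  assumes st: "0 \<le> s" "s \<le> t" and l: "0 < l"
  shows "integrable M (\<lambda>\<omega>. sat l (X t \<omega>) ^ 4 + 2 * b * (LBINT u:{s..t}. exp (- (l * X u \<omega>)) * sat l (X u \<omega>) ^ 4))"
    "(\<integral>\<omega>. sat l (X t \<omega>) ^ 4 + 2 * b * (LBINT u:{s..t}. exp (- (l * X u \<omega>)) * sat l (X u \<omega>) ^ 4) \<partial>M) \<le>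
      (\<integral>\<omega>. sat l (X s \<omega>) ^ 4 \<partial>M) + c4 * (t - s)"
proof -
  define g where "g = (\<lambda>x. exp (- (l * x)) * sat l x ^ 4)"
  have g_M [measurable]: "g \<in> borel_measurable borel" unfolding g_def by measurable
  obtain B where B: "\<And>x. 0 \<le> x \<Longrightarrow> \<bar>sat l x ^ 4\<bar> \<le> B \<and> \<bar>sat_gen4 l x\<bar> \<le> B"
    using bdynkin_sat4[OF l] by (auto simp: bdynkin_def)
  have gB: "\<bar>g x\<bar> \<le> B" if "0 \<le> x" for x
  proof -
    have "exp (- (l * x)) \<le> 1" using l that by simp
    then have "exp (- (l * x)) * sat l x ^ 4 \<le> 1 * sat l x ^ 4" by (intro mult_right_mono) auto
    then show ?thesis using B[OF that] by (simp add: g_def)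
  qed
  have [measurable]: "(\<lambda>\<omega>. LBINT u:{s..t}. g (X u \<omega>)) \<in> borel_measurable M"
    "(\<lambda>\<omega>. LBINT u:{s..t}. sat_gen4 l (X u \<omega>)) \<in> borel_measurable M"
    by (rule path_integral_M, measurable)+
  have i4: "integrable M (\<lambda>\<omega>. sat l (X u \<omega>) ^ 4)" for u
    by (rule integrable_const_bound[of _ B]) (use B X_nonneg in auto)
  have ig: "integrable M (\<lambda>\<omega>. LBINT u:{s..t}. g (X u \<omega>))"
    by (rule integrable_const_bound[of _ "B * (t - s)"]) (use bounded_path_integral_le[OF g_M gB st(2)] in auto)
  have iL: "integrable M (\<lambda>\<omega>. LBINT u:{s..t}. sat_gen4 l (X u \<omega>))"
    by (rule integrable_const_bound[of _ "B * (t - s)"])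
      (use bounded_path_integral_le[OF sat_gen_borel(3) _ st(2)] B in auto)
  show "integrable M (\<lambda>\<omega>. sat l (X t \<omega>) ^ 4 + 2 * b * (LBINT u:{s..t}. exp (- (l * X u \<omega>)) * sat l (X u \<omega>) ^ 4))"
    using i4 ig unfolding g_def by auto
  have le: "(LBINT u:{s..t}. sat_gen4 l (X u \<omega>)) \<le> c4 * (t - s) - 2 * b * (LBINT u:{s..t}. g (X u \<omega>))" for \<omega>
  proof -
    have ig: "set_integrable lborel {s..t} (\<lambda>u. g (X u \<omega>))" by (rule bounded_path_integrable[OF g_M gB])
    have ic: "set_integrable lborel {s..t} (\<lambda>u. c4)"
      by (rule set_integrable_bounded_interval[of _ _ _ "\<bar>c4\<bar>"]) auto
    have "(LBINT u:{s..t}. sat_gen4 l (X u \<omega>)) \<le> (LBINT u:{s..t}. c4 - 2 * b * g (X u \<omega>))"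
    proof (rule set_integral_mono)
      show "set_integrable lborel {s..t} (\<lambda>u. sat_gen4 l (X u \<omega>))"
        by (rule bounded_path_integrable[of _ B]) (use B in auto)
      show "set_integrable lborel {s..t} (\<lambda>u. c4 - 2 * b * g (X u \<omega>))"
        using ig ic by (intro set_integral_diff(1)) auto
      show "sat_gen4 l (X u \<omega>) \<le> c4 - 2 * b * g (X u \<omega>)" for u
        unfolding g_def by (rule sat_gen4_le[OF l X_nonneg])
    qed
    also have "\<dots> = (LBINT u:{s..t}. c4) - (LBINT u:{s..t}. 2 * b * g (X u \<omega>))"
      using ig ic by (intro set_integral_diff(2)) auto
    also have "\<dots> = c4 * (t - s) - 2 * b * (LBINT u:{s..t}. g (X u \<omega>))"
      using st by (simp add: set_lebesgue_integral_def)
    finally show ?thesis .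
  qed
  have "(\<integral>\<omega>. 1 * (sat l (X t \<omega>) ^ 4 - sat l (X s \<omega>) ^ 4 - (LBINT u:{s..t}. sat_gen4 l (X u \<omega>))) \<partial>M) = 0"
    using bdynkin_sat4[OF l] st unfolding bdynkin_def by (elim conjE allE[of _ s] allE[of _ t] allE[of _ "\<lambda>_. 1"] allE[of _ 1]) auto
  then have "(\<integral>\<omega>. sat l (X t \<omega>) ^ 4 \<partial>M) = (\<integral>\<omega>. sat l (X s \<omega>) ^ 4 \<partial>M) + (\<integral>\<omega>. (LBINT u:{s..t}. sat_gen4 l (X u \<omega>)) \<partial>M)"
    using i4 iL by simp
  also have "(\<integral>\<omega>. (LBINT u:{s..t}. sat_gen4 l (X u \<omega>)) \<partial>M) \<le> (\<integral>\<omega>. c4 * (t - s) - 2 * b * (LBINT u:{s..t}. g (X u \<omega>)) \<partial>M)"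
    using iL ig le by (intro integral_mono) auto
  also have "(\<integral>\<omega>. c4 * (t - s) - 2 * b * (LBINT u:{s..t}. g (X u \<omega>)) \<partial>M) =
      c4 * (t - s) - 2 * b * (\<integral>\<omega>. (LBINT u:{s..t}. g (X u \<omega>)) \<partial>M)"
    using ig by (simp add: prob_space)
  also have "(\<integral>\<omega>. sat l (X t \<omega>) ^ 4 \<partial>M) =
      (\<integral>\<omega>. sat l (X t \<omega>) ^ 4 + 2 * b * (LBINT u:{s..t}. g (X u \<omega>)) \<partial>M) - 2 * b * (\<integral>\<omega>. (LBINT u:{s..t}. g (X u \<omega>)) \<partial>M)"
    using i4 ig by simp
  finally show "(\<integral>\<omega>. sat l (X t \<omega>) ^ 4 + 2 * b * (LBINT u:{s..t}. exp (- (l * X u \<omega>)) * sat l (X u \<omega>) ^ 4) \<partial>M) \<le>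
      (\<integral>\<omega>. sat l (X s \<omega>) ^ 4 \<partial>M) + c4 * (t - s)"
    unfolding g_def by linarith
qed

end

section \<open>Fourth moments\<close>

lemma fatou_real:
  fixes Q :: "nat \<Rightarrow> 'a \<Rightarrow> real"
  assumes Q: "\<And>n. integrable M (Q n)" "\<And>n \<omega>. \<omega> \<in> space M \<Longrightarrow> 0 \<le> Q n \<omega>"
    and lim: "\<And>\<omega>. \<omega> \<in> space M \<Longrightarrow> (\<lambda>n. Q n \<omega>) \<longlonglongrightarrow> q \<omega>"
    and le: "\<And>n. (\<integral>\<omega>. Q n \<omega> \<partial>M) \<le> A" and q: "q \<in> borel_measurable M"
  shows "integrable M q" "(\<integral>\<omega>. q \<omega> \<partial>M) \<le> A"
proof -
  have q0: "0 \<le> q \<omega>" if "\<omega> \<in> space M" for \<omega>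
    by (rule LIMSEQ_le_const[OF lim[OF that]]) (use Q(2)[OF that] in auto)
  have A: "0 \<le> A" using le[of 0] Q(2) by (meson Bochner_Integration.integral_nonneg order_trans)
  have "(\<integral>\<^sup>+\<omega>. ennreal (q \<omega>) \<partial>M) = (\<integral>\<^sup>+\<omega>. liminf (\<lambda>n. ennreal (Q n \<omega>)) \<partial>M)"
  proof (rule nn_integral_cong)
    fix \<omega> assume "\<omega> \<in> space M"
    from tendsto_ennrealI[OF lim[OF this]] show "ennreal (q \<omega>) = liminf (\<lambda>n. ennreal (Q n \<omega>))"
      by (simp add: lim_imp_Liminf)
  qed
  also have "\<dots> \<le> liminf (\<lambda>n. \<integral>\<^sup>+\<omega>. ennreal (Q n \<omega>) \<partial>M)"
    by (rule nn_integral_liminf) (use Q(1) in auto)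
  also have "\<dots> \<le> liminf (\<lambda>n. ennreal A)"
  proof (rule Liminf_mono, rule always_eventually, rule allI)
    fix n
    have "(\<integral>\<^sup>+\<omega>. ennreal (Q n \<omega>) \<partial>M) = ennreal (\<integral>\<omega>. Q n \<omega> \<partial>M)"
      using Q by (intro nn_integral_eq_integral) auto
    then show "(\<integral>\<^sup>+\<omega>. ennreal (Q n \<omega>) \<partial>M) \<le> ennreal A" using le[of n] by (simp add: ennreal_leI)
  qed
  also have "\<dots> = ennreal A" by (rule Liminf_const) simp
  finally have fin: "(\<integral>\<^sup>+\<omega>. ennreal (q \<omega>) \<partial>M) \<le> ennreal A" .
  show int: "integrable M q"
  proof (rule integrableI_nonneg[OF q])
    show "AE \<omega> in M. 0 \<le> q \<omega>" using q0 by (rule AE_I2)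
    show "(\<integral>\<^sup>+\<omega>. ennreal (q \<omega>) \<partial>M) < \<infinity>" using fin by (simp add: le_less_trans)
  qed
  have "ennreal (\<integral>\<omega>. q \<omega> \<partial>M) \<le> ennreal A"
    using fin nn_integral_eq_integral[OF int] q0 by (simp add: AE_I2)
  then show "(\<integral>\<omega>. q \<omega> \<partial>M) \<le> A" using A by (simp add: ennreal_le_iff)
qed

context cir
begin

lemma path_power_integrable: "set_integrable lborel {s..t} (\<lambda>u. X u \<omega> ^ n)"
proof -
  obtain K where K: "0 \<le> K" "\<And>u. u \<in> {s..t} \<Longrightarrow> X u \<omega> \<le> K" using X_bounded_on by blast
  show ?thesis
    by (rule set_integrable_bounded_interval[where B = "K ^ n"])
      (use K X_nonneg in \<open>auto simp: power_abs intro!: power_mono\<close>)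
qed

lemma path_power_integral_nonneg: "0 \<le> (LBINT u:{s..t}. X u \<omega> ^ n)"
  unfolding set_lebesgue_integral_def using X_nonneg by (intro Bochner_Integration.integral_nonneg) auto

text \<open>Fatou's lemma as \<open>l\<close> tends to 0, with a right-hand side independent of
  \<open>l\<close> because \<open>sat l x \<le> x\<close>. The moment at \<open>t\<close> and the
  dissipation are passed to the limit as one nonnegative variable \<open>q\<close>, which dominates
  each of them.\<close>

lemma fourth_moment_step:
  assumes st: "0 \<le> s" "s \<le> t" and Xs: "integrable M (\<lambda>\<omega>. X s \<omega> ^ 4)"
  shows "integrable M (\<lambda>\<omega>. X t \<omega> ^ 4)" "integrable M (\<lambda>\<omega>. LBINT u:{s..t}. X u \<omega> ^ 4)"
    "(\<integral>\<omega>. X t \<omega> ^ 4 \<partial>M) + 2 * b * (\<integral>\<omega>. (LBINT u:{s..t}. X u \<omega> ^ 4) \<partial>M) \<le> (\<integral>\<omega>. X s \<omega> ^ 4 \<partial>M) + c4 * (t - s)"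
proof -
  define l where "l = (\<lambda>n. 1 / real (Suc n))"
  have l: "0 < l n" for n by (simp add: l_def)
  define g where "g = (\<lambda>n x. exp (- (l n * x)) * sat (l n) x ^ 4)"
  have g_M [measurable]: "g n \<in> borel_measurable borel" for n unfolding g_def by measurable
  define Q where "Q = (\<lambda>n \<omega>. sat (l n) (X t \<omega>) ^ 4 + 2 * b * (LBINT u:{s..t}. g n (X u \<omega>)))"
  define q where "q = (\<lambda>\<omega>. X t \<omega> ^ 4 + 2 * b * (LBINT u:{s..t}. X u \<omega> ^ 4))"
  have g_bounds: "0 \<le> g n x" "g n x \<le> x ^ 4" if "0 \<le> x" for n x
  proof -
    show "0 \<le> g n x" by (simp add: g_def)
    have "g n x \<le> 1 * sat (l n) x ^ 4"
      unfolding g_def using l[of n] that by (intro mult_right_mono) auto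
    also have "\<dots> \<le> x ^ 4" using sat_bounds[OF l that] by (simp add: power_mono)
    finally show "g n x \<le> x ^ 4" .
  qed
  have int_M [measurable]: "(\<lambda>\<omega>. LBINT u:{s..t}. X u \<omega> ^ 4) \<in> borel_measurable M"
    using path_integral_M[of "\<lambda>x. x ^ 4"] by simp
  have Q1: "integrable M (Q n)" for n unfolding Q_def g_def by (rule sat4_moment_le(1)[OF st l])
  have Q2: "0 \<le> Q n \<omega>" for n \<omega>
    unfolding Q_def set_lebesgue_integral_def using g_bounds(1)[OF X_nonneg] pos
    by (intro add_nonneg_nonneg mult_nonneg_nonneg Bochner_Integration.integral_nonneg) auto
  have Q4: "(\<integral>\<omega>. Q n \<omega> \<partial>M) \<le> (\<integral>\<omega>. X s \<omega> ^ 4 \<partial>M) + c4 * (t - s)" for n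
  proof -
    have "(\<integral>\<omega>. Q n \<omega> \<partial>M) \<le> (\<integral>\<omega>. sat (l n) (X s \<omega>) ^ 4 \<partial>M) + c4 * (t - s)"
      unfolding Q_def g_def by (rule sat4_moment_le(2)[OF st l])
    also have "(\<integral>\<omega>. sat (l n) (X s \<omega>) ^ 4 \<partial>M) \<le> (\<integral>\<omega>. X s \<omega> ^ 4 \<partial>M)"
      by (rule integral_mono_AE'[OF Xs]) (auto intro!: AE_I2 power_mono sat_bounds l X_nonneg)
    finally show ?thesis by simp
  qed
  have Q5: "q \<in> borel_measurable M" unfolding q_def by measurable
  have Q3: "(\<lambda>n. Q n \<omega>) \<longlonglongrightarrow> q \<omega>" for \<omega>
  proof -
    obtain K where K: "0 \<le> K" "\<And>u. u \<in> {s..t} \<Longrightarrow> X u \<omega> \<le> K" using X_bounded_on by blast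
    have "(\<lambda>n. LBINT u:{s..t}. g n (X u \<omega>)) \<longlonglongrightarrow> (LBINT u:{s..t}. X u \<omega> ^ 4)"
    proof (rule set_integral_bounded_convergence[where B = "K ^ 4"])
      show "\<bar>g n (X u \<omega>)\<bar> \<le> K ^ 4" if "u \<in> {s..t}" for n u
        using g_bounds[OF X_nonneg, of n u \<omega>] power_mono[OF K(2)[OF that] X_nonneg, of 4] by simp
      show "(\<lambda>n. g n (X u \<omega>)) \<longlonglongrightarrow> X u \<omega> ^ 4" for u
      proof -
        have "(\<lambda>n. g n (X u \<omega>)) \<longlonglongrightarrow> 1 * X u \<omega> ^ 4"
          unfolding g_def l_def by (intro tendsto_mult tendsto_power exp_scale_tendsto sat_tendsto X_nonneg)
        then show ?thesis by simp
      qed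
    qed measurable
    then show ?thesis unfolding Q_def q_def l_def
      by (intro tendsto_add tendsto_mult tendsto_power tendsto_const sat_tendsto X_nonneg)
  qed
  note q = fatou_real[where Q = Q, OF Q1 Q2 Q3 Q4 Q5]
  have J: "0 \<le> (LBINT u:{s..t}. X u \<omega> ^ 4)" for \<omega> by (rule path_power_integral_nonneg)
  show i1: "integrable M (\<lambda>\<omega>. X t \<omega> ^ 4)"
    by (rule Bochner_Integration.integrable_bound[OF q(1)]) (use J pos in \<open>auto simp: q_def intro!: AE_I2\<close>)
  have "integrable M (\<lambda>\<omega>. (q \<omega> - X t \<omega> ^ 4) / (2 * b))" using q(1) i1 by auto
  then show i2: "integrable M (\<lambda>\<omega>. LBINT u:{s..t}. X u \<omega> ^ 4)" using pos by (simp add: q_def)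
  show "(\<integral>\<omega>. X t \<omega> ^ 4 \<partial>M) + 2 * b * (\<integral>\<omega>. (LBINT u:{s..t}. X u \<omega> ^ 4) \<partial>M) \<le> (\<integral>\<omega>. X s \<omega> ^ 4 \<partial>M) + c4 * (t - s)"
    using q(2) i1 i2 unfolding q_def by simp
qed

lemma X4_integrable: "0 \<le> t \<Longrightarrow> integrable M (\<lambda>\<omega>. X t \<omega> ^ 4)"
  using fourth_moment_step(1)[of 0 t] X_init[of 0] by simp

definition m4 :: "real \<Rightarrow> real" where
  "m4 t = (\<integral>\<omega>. X t \<omega> ^ 4 \<partial>M)"

lemma m4_nonneg: "0 \<le> m4 t"
  unfolding m4_def by (intro Bochner_Integration.integral_nonneg) auto

lemma path4_integrable:
  assumes "0 \<le> s" "s \<le> t"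
  shows "integrable M (\<lambda>\<omega>. LBINT u:{s..t}. X u \<omega> ^ 4)"
  by (rule fourth_moment_step(2)[OF assms X4_integrable[OF assms(1)]])

lemma m4_step:
  assumes "0 \<le> s" "s \<le> t"
  shows "m4 t + 2 * b * (\<integral>\<omega>. (LBINT u:{s..t}. X u \<omega> ^ 4) \<partial>M) \<le> m4 s + c4 * (t - s)"
  unfolding m4_def by (rule fourth_moment_step(3)[OF assms X4_integrable[OF assms(1)]])

lemma expected_path4_nonneg: "0 \<le> (\<integral>\<omega>. (LBINT u:{s..t}. X u \<omega> ^ 4) \<partial>M)"
  by (intro Bochner_Integration.integral_nonneg path_power_integral_nonneg)

text \<open>As \<open>m4\<close> grows at most linearly with slope \<open>c4\<close>, a large value at time \<open>s + 1\<close> forces large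
  values on all of \<open>[s, s + 1]\<close>, which makes the dissipation term large.\<close>

lemma m4_le_expected_path:
  assumes "0 \<le> s"
  shows "m4 (s + 1) - c4 \<le> (\<integral>\<omega>. (LBINT u:{s..s+1}. X u \<omega> ^ 4) \<partial>M)"
proof -
  have low: "m4 (s + 1) - c4 \<le> m4 u" if "u \<in> {s..s+1}" for u
  proof -
    have "m4 (s + 1) \<le> m4 u + c4 * (s + 1 - u)"
      using m4_step[of u "s + 1"] that assms pos expected_path4_nonneg[of u "s + 1"]
      by (smt (verit) atLeastAtMost_iff mult_nonneg_nonneg)
    also have "c4 * (s + 1 - u) \<le> c4 * 1" using that c4_nonneg by (intro mult_left_mono) auto
    finally show ?thesis by simp
  qed
  have meas: "(\<lambda>z. ennreal (indicator {s..s+1} (snd z) * X (snd z) (fst z) ^ 4)) \<in> borel_measurable (M \<Otimes>\<^sub>M lborel)"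
  proof -
    have "(\<lambda>z. indicator {s..s+1} (snd z) :: real) \<in> borel_measurable (M \<Otimes>\<^sub>M lborel)"
      by (rule measurable_compose[OF measurable_snd borel_measurable_indicator]) auto
    then show ?thesis by measurable
  qed
  interpret P: pair_sigma_finite M lborel ..
  \<comment> \<open>Tonelli's theorem in \<open>ennreal\<close> avoids a separate discussion of
    \<open>m4\<close> as an integrand in time; a negative left-hand side is simply sent to
    0.\<close>
  have "ennreal (m4 (s + 1) - c4) = (\<integral>\<^sup>+u. ennreal (m4 (s + 1) - c4) * indicator {s..s+1} u \<partial>lborel)"
    by (simp add: nn_integral_cmult_indicator)
  also have "\<dots> \<le> (\<integral>\<^sup>+u. (\<integral>\<^sup>+\<omega>. ennreal (indicator {s..s+1} u * X u \<omega> ^ 4) \<partial>M) \<partial>lborel)"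
  proof (rule nn_integral_mono)
    fix u :: real
    show "ennreal (m4 (s + 1) - c4) * indicator {s..s+1} u \<le> (\<integral>\<^sup>+\<omega>. ennreal (indicator {s..s+1} u * X u \<omega> ^ 4) \<partial>M)"
    proof (cases "u \<in> {s..s+1}")
      case True
      then have "(\<integral>\<^sup>+\<omega>. ennreal (X u \<omega> ^ 4) \<partial>M) = ennreal (m4 u)"
        unfolding m4_def using assms by (intro nn_integral_eq_integral X4_integrable) auto
      then show ?thesis using True low[OF True] by (simp add: ennreal_leI)
    qed simp
  qed
  also have "\<dots> = (\<integral>\<^sup>+\<omega>. (\<integral>\<^sup>+u. ennreal (indicator {s..s+1} u * X u \<omega> ^ 4) \<partial>lborel) \<partial>M)"
    by (rule P.Fubini') (use meas in \<open>simp add: case_prod_beta\<close>)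
  also have "\<dots> = (\<integral>\<^sup>+\<omega>. ennreal (LBINT u:{s..s+1}. X u \<omega> ^ 4) \<partial>M)"
  proof (rule nn_integral_cong)
    fix \<omega>
    show "(\<integral>\<^sup>+u. ennreal (indicator {s..s+1} u * X u \<omega> ^ 4) \<partial>lborel) = ennreal (LBINT u:{s..s+1}. X u \<omega> ^ 4)"
      using path_power_integrable[of s "s + 1" \<omega> 4] unfolding set_integrable_def set_lebesgue_integral_def real_scaleR_def
      by (intro nn_integral_eq_integral) auto
  qed
  also have "\<dots> = ennreal (\<integral>\<omega>. (LBINT u:{s..s+1}. X u \<omega> ^ 4) \<partial>M)"
    using path4_integrable[of s "s + 1"] assms path_power_integral_nonneg by (intro nn_integral_eq_integral) auto
  finally show ?thesis using expected_path4_nonneg by (simp add: ennreal_le_iff)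
qed

text \<open>\<open>m4_step\<close> and \<open>m4_le_expected_path\<close> give
  \<open>(1 + 2 * b) * m4 (n + 1) \<le> m4 n + c4 * (1 + 2 * b)\<close>. The fixed point of this
  recursion is the second summand; \<open>r0 ^ 4\<close> is added to cover the initial
  value.\<close>

definition m4_sup :: real where "m4_sup = r0 ^ 4 + c4 * (1 + 2 * b) / (2 * b)"

lemma m4_bounded: "m4 (real n) \<le> m4_sup"
proof (induction n)
  case 0
  have "m4 0 = r0 ^ 4" unfolding m4_def by (simp add: X_init prob_space)
  then show ?case using pos c4_nonneg by (simp add: m4_sup_def)
next
  case (Suc n)
  have "m4 (real n + 1) + 2 * b * (m4 (real n + 1) - c4) \<le> m4 (real n) + c4"
  proof -
    have "2 * b * (m4 (real n + 1) - c4) \<le> 2 * b * (\<integral>\<omega>. (LBINT u:{real n..real n+1}. X u \<omega> ^ 4) \<partial>M)"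
      using m4_le_expected_path[of "real n"] pos by (intro mult_left_mono) auto
    then show ?thesis using m4_step[of "real n" "real n + 1"] by simp
  qed
  also have "\<dots> \<le> m4_sup + c4" using Suc by simp
  finally have 1: "(1 + 2 * b) * m4 (real n + 1) \<le> m4_sup + c4 * (1 + 2 * b)" by (simp add: algebra_simps)
  have "c4 * (1 + 2 * b) / (2 * b) * (2 * b) \<le> m4_sup * (2 * b)"
    unfolding m4_sup_def using pos by (intro mult_right_mono) auto
  then have "c4 * (1 + 2 * b) \<le> m4_sup * (2 * b)" using pos by simp
  with 1 have "(1 + 2 * b) * m4 (real n + 1) \<le> (1 + 2 * b) * m4_sup" by (simp add: algebra_simps)
  then have "m4 (real n + 1) \<le> m4_sup" by (rule mult_left_le_imp_le) (use pos in simp)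
  then show ?case by (simp add: add.commute)
qed

lemma expected_path4_le: "(\<integral>\<omega>. (LBINT u:{real n..real n+1}. X u \<omega> ^ 4) \<partial>M) \<le> (m4_sup + c4) / (2 * b)"
  using m4_step[of "real n" "real n + 1"] m4_bounded[of n] m4_nonneg[of "real n + 1"] pos
  by (simp add: field_simps)

end

text \<open>Jensen's inequality on an interval of length 1, obtained from the nonnegative integral
  of \<open>(f u - m)\<^sup>2\<close>, where \<open>m\<close> is the mean of
  \<open>f\<close>.\<close>

lemma unit_interval_integral_square_le:
  fixes f :: "real \<Rightarrow> real"
  assumes f: "set_integrable lborel {s..s+1} f" and f2: "set_integrable lborel {s..s+1} (\<lambda>u. (f u)\<^sup>2)"
  shows "(LBINT u:{s..s+1}. f u)\<^sup>2 \<le> (LBINT u:{s..s+1}. (f u)\<^sup>2)"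
proof -
  define m where "m = (LBINT u:{s..s+1}. f u)"
  have c: "set_integrable lborel {s..s+1} (\<lambda>u. m\<^sup>2)"
    by (rule set_integrable_bounded_interval[of _ _ _ "m\<^sup>2"]) auto
  have "0 \<le> (LBINT u:{s..s+1}. (f u - m)\<^sup>2)"
    unfolding set_lebesgue_integral_def by (intro Bochner_Integration.integral_nonneg) auto
  also have "(LBINT u:{s..s+1}. (f u - m)\<^sup>2) = (LBINT u:{s..s+1}. ((f u)\<^sup>2 - 2 * m * f u) + m\<^sup>2)"
    by (simp add: power2_eq_square algebra_simps)
  also have "\<dots> = (LBINT u:{s..s+1}. (f u)\<^sup>2 - 2 * m * f u) + (LBINT u:{s..s+1}. m\<^sup>2)"
    using f f2 c by (intro set_integral_add(2) set_integral_diff(1)) auto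
  also have "(LBINT u:{s..s+1}. (f u)\<^sup>2 - 2 * m * f u) = (LBINT u:{s..s+1}. (f u)\<^sup>2) - (LBINT u:{s..s+1}. 2 * m * f u)"
    using f f2 by (intro set_integral_diff(2)) auto
  also have "(LBINT u:{s..s+1}. m\<^sup>2) = m\<^sup>2" by (simp add: set_lebesgue_integral_def)
  also have "(LBINT u:{s..s+1}. 2 * m * f u) = 2 * m * m" by (simp add: m_def)
  finally show ?thesis unfolding m_def[symmetric] by (simp add: power2_eq_square)
qed

lemma pow_le_one_add_pow4: "0 \<le> x \<Longrightarrow> x \<le> 1 + x ^ 4" "0 \<le> x \<Longrightarrow> x\<^sup>2 \<le> 1 + x ^ 4" for x :: real
proof -
  assume "0 \<le> x"
  have "0 \<le> (x\<^sup>2 - 1)\<^sup>2" by simp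
  also have "(x\<^sup>2 - 1)\<^sup>2 = x ^ 4 - 2 * x\<^sup>2 + 1" by (simp add: power2_eq_square eval_nat_numeral algebra_simps)
  finally have 1: "2 * x\<^sup>2 \<le> 1 + x ^ 4" by simp
  then show "x\<^sup>2 \<le> 1 + x ^ 4" using zero_le_power2[of x] by linarith
  have "0 \<le> (x - 1)\<^sup>2" by simp
  then have "2 * x \<le> x\<^sup>2 + 1" by (simp add: power2_eq_square algebra_simps)
  moreover have "0 \<le> x ^ 4" by simp
  ultimately show "x \<le> 1 + x ^ 4" using 1 by linarith
qed

section \<open>The Poisson equation and its martingale increments\<close>

context cir
begin

definition lim_const :: real where "lim_const = a\<^sup>2 / b\<^sup>2 + a * \<sigma>\<^sup>2 / (2 * b\<^sup>2)"

text \<open>The generator maps x to a - b x and x^2 to (2 a + \<sigma>^2) x - 2 b x^2. This factor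
  makes the linear terms in the generator image of \<open>psi\<close> cancel, and
  \<open>a * bet\<close> is \<open>lim_const\<close>.\<close>

definition bet :: real where "bet = (2 * a + \<sigma>\<^sup>2) / (2 * b\<^sup>2)"

definition psi :: "real \<Rightarrow> real" where "psi x = x\<^sup>2 / (2 * b) + bet * x"

definition pdiff :: "real \<Rightarrow> real \<Rightarrow> 'a \<Rightarrow> real" where
  "pdiff s t \<omega> = psi (X t \<omega>) - psi (X s \<omega>) - (LBINT u:{s..t}. lim_const - (X u \<omega>)\<^sup>2)"

lemma bet_pos: "0 < bet"
  using pos unfolding bet_def by (intro divide_pos_pos add_pos_nonneg) auto

lemma psi_nonneg: "0 \<le> x \<Longrightarrow> 0 \<le> psi x"
  using pos bet_pos unfolding psi_def by (intro add_nonneg_nonneg) auto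

lemma psi_borel [measurable]: "psi \<in> borel_measurable borel"
  unfolding psi_def[abs_def] by measurable

lemma pdiff_M [measurable]: "pdiff s t \<in> borel_measurable M"
proof -
  have [measurable]: "(\<lambda>\<omega>. LBINT u:{s..t}. lim_const - (X u \<omega>)\<^sup>2) \<in> borel_measurable M"
    by (rule path_integral_M[of "\<lambda>x. lim_const - x\<^sup>2"]) measurable
  show ?thesis unfolding pdiff_def by measurable
qed

text \<open>\<open>psi\<close> is unbounded, so the identity is first used for the same combination
  of \<open>sat\<close> and its square. This function and its generator image are both at most a
  constant times \<open>1 + x ^ 4\<close>, uniformly in \<open>l \<le> 1\<close>, so the fourth
  moments supply the dominating variable \<open>w\<close>.\<close>

lemma pdiff_orthogonal_bounded:
  assumes st: "0 \<le> s" "s \<le> t" and Z: "Z \<in> borel_measurable (F s)" "\<And>\<omega>. \<omega> \<in> space M \<Longrightarrow> \<bar>Z \<omega>\<bar> \<le> C"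
  shows "(\<integral>\<omega>. Z \<omega> * pdiff s t \<omega> \<partial>M) = 0"
proof -
  define l where "l = (\<lambda>n. 1 / real (Suc n))"
  have l: "0 < l n" "l n \<le> 1" for n by (auto simp: l_def)
  define f where "f = (\<lambda>n x. (1 / (2 * b)) * sat (l n) x ^ 2 + bet * sat (l n) x)"
  define L where "L = (\<lambda>n x. (1 / (2 * b)) * sat_gen2 (l n) x + bet * sat_gen1 (l n) x)"
  have fL: "bdynkin (f n) (L n)" for n
    unfolding f_def L_def by (intro bdynkin_lincomb bdynkin_sat2 bdynkin_sat l)
  have [measurable]: "f n \<in> borel_measurable borel" "L n \<in> borel_measurable borel" for n
    using fL[of n] by (auto simp: bdynkin_def)
  have C: "0 \<le> C" using Z(2) not_empty by (meson abs_ge_zero all_not_in_conv order_trans)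
  define P where "P = 1 / (2 * b) + bet"
  have P: "0 \<le> P" using pos bet_pos by (simp add: P_def)
  have f_bound: "\<bar>f n x\<bar> \<le> P * (1 + x ^ 4)" if "0 \<le> x" for n x
  proof -
    note sb = sat_bounds[OF l(1)[of n] that]
    have "sat (l n) x ^ 2 \<le> x\<^sup>2" using sb by (intro power_mono) auto
    then have "sat (l n) x ^ 2 \<le> 1 + x ^ 4" "sat (l n) x \<le> 1 + x ^ 4"
      using pow_le_one_add_pow4[OF that] sb by linarith+
    then have "f n x \<le> (1 / (2 * b)) * (1 + x ^ 4) + bet * (1 + x ^ 4)"
      unfolding f_def using pos bet_pos by (intro add_mono mult_left_mono) auto
    moreover have "0 \<le> f n x" unfolding f_def using pos bet_pos sb by (intro add_nonneg_nonneg mult_nonneg_nonneg) auto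
    ultimately show ?thesis by (simp add: P_def algebra_simps)
  qed
  \<comment> \<open>The two brackets come from the bounds for \<open>sat_gen2\<close> and
    \<open>sat_gen1\<close>, weighted like the two terms of \<open>L\<close>.\<close>
  define B where "B = (2 * a + 2 * b + 2 * \<sigma>\<^sup>2) / (2 * b) + bet * (a + b + \<sigma>\<^sup>2)"
  have B: "0 \<le> B" using pos bet_pos unfolding B_def by (intro add_nonneg_nonneg mult_nonneg_nonneg divide_nonneg_nonneg) auto
  have L_bound: "\<bar>L n x\<bar> \<le> B * (1 + x ^ 4)" if x: "0 \<le> x" for n x
  proof -
    define e where "e = exp (- (l n * x))"
    define g where "g = sat (l n) x"
    have e: "0 < e" "e \<le> 1" using l[of n] x by (auto simp: e_def)
    have g: "0 \<le> g" "g \<le> x" "0 \<le> l n * g" "l n * g \<le> 1"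
      using sat_bounds[OF l(1)[of n] x] l(1)[of n] by (auto simp: g_def)
    have x4: "x \<le> 1 + x ^ 4" "x\<^sup>2 \<le> 1 + x ^ 4" "1 \<le> 1 + x ^ 4" using pow_le_one_add_pow4[OF x] by auto
    have ax: "\<bar>a - b * x\<bar> \<le> a + b * x" using pos x by (auto simp: abs_le_iff)
    have s2: "0 \<le> \<sigma>\<^sup>2 * x" using x by simp
    have 1: "\<bar>sat_gen1 (l n) x\<bar> \<le> (a + b + \<sigma>\<^sup>2) * (1 + x ^ 4)"
    proof -
      have "\<bar>e * (a - b * x)\<bar> \<le> 1 * (a + b * x)" unfolding abs_mult using e ax by (intro mult_mono) auto
      moreover have "\<bar>l n * e * (\<sigma>\<^sup>2 * x) / 2\<bar> \<le> 1 * (\<sigma>\<^sup>2 * x)"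
      proof -
        have "l n * e \<le> 1 * 1" using l[of n] e by (intro mult_mono) auto
        then have "l n * e * (\<sigma>\<^sup>2 * x) \<le> 1 * (\<sigma>\<^sup>2 * x)" using s2 by (intro mult_right_mono) auto
        moreover have "0 \<le> l n * e * (\<sigma>\<^sup>2 * x)" using l(1)[of n] e s2 x by (intro mult_nonneg_nonneg) auto
        ultimately show ?thesis by simp
      qed
      ultimately have "\<bar>sat_gen1 (l n) x\<bar> \<le> a * 1 + b * x + \<sigma>\<^sup>2 * x"
        unfolding sat_gen1_def e_def[symmetric] by (simp add: abs_le_iff)
      also have "\<dots> \<le> a * (1 + x ^ 4) + b * (1 + x ^ 4) + \<sigma>\<^sup>2 * (1 + x ^ 4)"
        using pos x4 by (intro add_mono mult_left_mono) auto
      finally show ?thesis by (simp add: algebra_simps)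
    qed
    have 2: "\<bar>sat_gen2 (l n) x\<bar> \<le> (2 * a + 2 * b + 2 * \<sigma>\<^sup>2) * (1 + x ^ 4)"
    proof -
      have "\<bar>2 * g * e * (a - b * x)\<bar> \<le> (2 * x * 1) * (a + b * x)"
        unfolding abs_mult using e g ax x by (intro mult_mono mult_nonneg_nonneg) auto
      moreover have "\<bar>(2 * e ^ 2 - 2 * l n * g * e) * (\<sigma>\<^sup>2 * x) / 2\<bar> \<le> 2 * (\<sigma>\<^sup>2 * x)"
      proof -
        have "e ^ 2 \<le> 1" "0 \<le> e ^ 2" using e by (auto simp: power_le_one)
        moreover have "(l n * g) * e \<le> 1 * 1" using g e by (intro mult_mono) auto
        moreover have "0 \<le> (l n * g) * e" by (rule mult_nonneg_nonneg) (use g e in auto)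
        moreover have "2 * l n * g * e = 2 * ((l n * g) * e)" by simp
        ultimately have "\<bar>2 * e ^ 2 - 2 * l n * g * e\<bar> \<le> 4" unfolding abs_le_iff by linarith
        then have "\<bar>2 * e ^ 2 - 2 * l n * g * e\<bar> * (\<sigma>\<^sup>2 * x) \<le> 4 * (\<sigma>\<^sup>2 * x)" using s2 by (rule mult_right_mono)
        then show ?thesis using x by (simp add: abs_mult)
      qed
      ultimately have "\<bar>sat_gen2 (l n) x\<bar> \<le> 2 * a * x + 2 * b * x\<^sup>2 + 2 * \<sigma>\<^sup>2 * x"
        unfolding sat_gen2_def e_def[symmetric] g_def[symmetric]
        by (intro order_trans[OF abs_triangle_ineq]) (simp add: power2_eq_square algebra_simps)
      also have "\<dots> \<le> 2 * a * (1 + x ^ 4) + 2 * b * (1 + x ^ 4) + 2 * \<sigma>\<^sup>2 * (1 + x ^ 4)"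
        using pos x4 by (intro add_mono mult_left_mono) auto
      finally show ?thesis by (simp add: algebra_simps)
    qed
    have "\<bar>L n x\<bar> \<le> (1 / (2 * b)) * \<bar>sat_gen2 (l n) x\<bar> + bet * \<bar>sat_gen1 (l n) x\<bar>"
      unfolding L_def using pos bet_pos by (intro order_trans[OF abs_triangle_ineq]) (simp add: abs_mult)
    also have "\<dots> \<le> (1 / (2 * b)) * ((2 * a + 2 * b + 2 * \<sigma>\<^sup>2) * (1 + x ^ 4)) + bet * ((a + b + \<sigma>\<^sup>2) * (1 + x ^ 4))"
      using 1 2 pos bet_pos by (intro add_mono mult_left_mono) auto
    also have "\<dots> = B * (1 + x ^ 4)" by (simp add: B_def field_simps)
    finally show ?thesis .
  qed
  have f_lim: "(\<lambda>n. f n x) \<longlonglongrightarrow> psi x" if "0 \<le> x" for x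
  proof -
    have "(\<lambda>n. f n x) \<longlonglongrightarrow> (1 / (2 * b)) * x ^ 2 + bet * x"
      unfolding f_def l_def by (intro tendsto_intros sat_tendsto that)
    then show ?thesis by (simp add: psi_def)
  qed
  have L_lim: "(\<lambda>n. L n x) \<longlonglongrightarrow> lim_const - x\<^sup>2" if "0 \<le> x" for x
  proof -
    have "(\<lambda>n. L n x) \<longlonglongrightarrow>
      (1 / (2 * b)) * (2 * x * 1 * (a - b * x) + (2 * 1 ^ 2 - 2 * 0 * x * 1) * (\<sigma>\<^sup>2 * x) / 2) +
       bet * (1 * (a - b * x) - 0 * 1 * (\<sigma>\<^sup>2 * x) / 2)"
      unfolding L_def l_def sat_gen1_def sat_gen2_def
      by (intro tendsto_intros sat_tendsto exp_scale_tendsto LIMSEQ_Suc[OF lim_1_over_n] that) simp_all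
    \<comment> \<open>The Poisson equation: inserting the limits 1, 0 and \<open>x\<close> of the
      exponential, \<open>l n\<close> and \<open>sat\<close> leaves
      \<open>lim_const - x\<^sup>2\<close>.\<close>
    also have "(1 / (2 * b)) * (2 * x * 1 * (a - b * x) + (2 * 1 ^ 2 - 2 * 0 * x * 1) * (\<sigma>\<^sup>2 * x) / 2) +
       bet * (1 * (a - b * x) - 0 * 1 * (\<sigma>\<^sup>2 * x) / 2) = lim_const - x\<^sup>2"
      using pos unfolding bet_def lim_const_def by (simp add: field_simps power2_eq_square)
    finally show ?thesis .
  qed
  have path_lim: "(\<lambda>n. LBINT u:{s..t}. L n (X u \<omega>)) \<longlonglongrightarrow> (LBINT u:{s..t}. lim_const - (X u \<omega>)\<^sup>2)" for \<omega>
  proof -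
    obtain K where K: "0 \<le> K" "\<And>u. u \<in> {s..t} \<Longrightarrow> X u \<omega> \<le> K" using X_bounded_on by blast
    show ?thesis
    proof (rule set_integral_bounded_convergence[where B = "B * (1 + K ^ 4)"])
      fix n u assume "u \<in> {s..t}"
      then have "X u \<omega> ^ 4 \<le> K ^ 4" using K X_nonneg by (intro power_mono) auto
      then have "B * (1 + X u \<omega> ^ 4) \<le> B * (1 + K ^ 4)" using B by (intro mult_left_mono) auto
      then show "\<bar>L n (X u \<omega>)\<bar> \<le> B * (1 + K ^ 4)" using L_bound[OF X_nonneg, of n u \<omega>] by linarith
    qed (auto intro: L_lim X_nonneg)
  qed
  define w where "w = (\<lambda>\<omega>. C * (P * (1 + X t \<omega> ^ 4) + P * (1 + X s \<omega> ^ 4) + B * ((t - s) + (LBINT u:{s..t}. X u \<omega> ^ 4))))"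
  have w_int: "integrable M w"
    unfolding w_def using X4_integrable[of t] X4_integrable[of s] path4_integrable[OF st] st
    by (intro integrable_mult_right Bochner_Integration.integrable_add) auto
  have path_bound: "\<bar>LBINT u:{s..t}. L n (X u \<omega>)\<bar> \<le> B * ((t - s) + (LBINT u:{s..t}. X u \<omega> ^ 4))" for n \<omega>
  proof -
    obtain B' where B': "\<And>x. 0 \<le> x \<Longrightarrow> \<bar>L n x\<bar> \<le> B'" using fL[of n] unfolding bdynkin_def by blast
    have i1: "set_integrable lborel {s..t} (\<lambda>u. L n (X u \<omega>))" by (rule bounded_path_integrable[OF _ B']) auto
    have i2: "set_integrable lborel {s..t} (\<lambda>u. 1 :: real)" by (rule set_integrable_bounded_interval[of _ _ _ 1]) auto
    have i3: "set_integrable lborel {s..t} (\<lambda>u. 1 + X u \<omega> ^ 4)"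
      by (intro set_integral_add(1) i2 path_power_integrable)
    have "\<bar>LBINT u:{s..t}. L n (X u \<omega>)\<bar> \<le> (\<integral>u. norm (indicator {s..t} u *\<^sub>R L n (X u \<omega>)) \<partial>lborel)"
      unfolding set_lebesgue_integral_def real_norm_def[symmetric] by (rule integral_norm_bound)
    also have "\<dots> \<le> (\<integral>u. indicator {s..t} u *\<^sub>R (B * (1 + X u \<omega> ^ 4)) \<partial>lborel)"
    proof (rule integral_mono)
      show "integrable lborel (\<lambda>u. norm (indicator {s..t} u *\<^sub>R L n (X u \<omega>)))"
        using i1 unfolding set_integrable_def by (rule integrable_norm)
      show "integrable lborel (\<lambda>u. indicator {s..t} u *\<^sub>R (B * (1 + X u \<omega> ^ 4)))"
        using set_integrable_mult_right[of B, OF i3] unfolding set_integrable_def by simp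
      show "norm (indicator {s..t} u *\<^sub>R L n (X u \<omega>)) \<le> indicator {s..t} u *\<^sub>R (B * (1 + X u \<omega> ^ 4))" for u
        using L_bound[OF X_nonneg, of n u \<omega>] by (auto simp: indicator_def)
    qed
    also have "\<dots> = B * (LBINT u:{s..t}. 1 + X u \<omega> ^ 4)"
      unfolding set_lebesgue_integral_def by (simp add: mult.left_commute flip: integral_mult_right_zero)
    also have "(LBINT u:{s..t}. 1 + X u \<omega> ^ 4) = (t - s) + (LBINT u:{s..t}. X u \<omega> ^ 4)"
      using set_integral_add(2)[OF i2 path_power_integrable] st by (simp add: set_lebesgue_integral_def)
    finally show ?thesis .
  qed
  have Z_M [measurable]: "Z \<in> borel_measurable M" by (rule measurable_F_M[OF Z(1)])
  define D where "D = (\<lambda>n \<omega>. Z \<omega> * (f n (X t \<omega>) - f n (X s \<omega>) - (LBINT u:{s..t}. L n (X u \<omega>))))"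
  have "(\<lambda>n. \<integral>\<omega>. D n \<omega> \<partial>M) \<longlonglongrightarrow> (\<integral>\<omega>. Z \<omega> * pdiff s t \<omega> \<partial>M)"
  proof (rule integral_dominated_convergence[OF _ _ w_int])
    show "(\<lambda>\<omega>. Z \<omega> * pdiff s t \<omega>) \<in> borel_measurable M" by measurable
    have [measurable]: "(\<lambda>\<omega>. LBINT u:{s..t}. L n (X u \<omega>)) \<in> borel_measurable M" for n
      by (rule path_integral_M) measurable
    show "D n \<in> borel_measurable M" for n unfolding D_def by measurable
    show "AE \<omega> in M. (\<lambda>n. D n \<omega>) \<longlonglongrightarrow> Z \<omega> * pdiff s t \<omega>"
      unfolding D_def pdiff_def by (intro AE_I2 tendsto_mult tendsto_diff tendsto_const f_lim X_nonneg path_lim)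
    show "AE \<omega> in M. norm (D n \<omega>) \<le> w \<omega>" for n
    proof (rule AE_I2)
      fix \<omega> assume "\<omega> \<in> space M"
      have "\<bar>f n (X t \<omega>) - f n (X s \<omega>) - (LBINT u:{s..t}. L n (X u \<omega>))\<bar> \<le>
         P * (1 + X t \<omega> ^ 4) + P * (1 + X s \<omega> ^ 4) + B * ((t - s) + (LBINT u:{s..t}. X u \<omega> ^ 4))"
        using f_bound[OF X_nonneg, of n t \<omega>] f_bound[OF X_nonneg, of n s \<omega>] path_bound[of n \<omega>] by linarith
      then show "norm (D n \<omega>) \<le> w \<omega>"
        unfolding D_def w_def real_norm_def abs_mult using Z(2)[OF \<open>\<omega> \<in> space M\<close>] C by (intro mult_mono) auto
    qed
  qed
  moreover have "(\<integral>\<omega>. D n \<omega> \<partial>M) = 0" for n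
    using fL[of n] st Z unfolding bdynkin_def D_def by blast
  ultimately have "(\<lambda>n. 0 :: real) \<longlonglongrightarrow> (\<integral>\<omega>. Z \<omega> * pdiff s t \<omega> \<partial>M)" by simp
  then show ?thesis using LIMSEQ_unique[OF tendsto_const] by metis
qed

end

section \<open>The ergodic limit\<close>

text \<open>The expected sum of the squares is finite, so almost surely the series of squares
  converges and its terms tend to 0.\<close>

lemma AE_tendsto_zero_of_square_bound:
  fixes Y :: "nat \<Rightarrow> 'a \<Rightarrow> real"
  assumes Y: "\<And>k. Y k \<in> borel_measurable M" "\<And>k. integrable M (\<lambda>\<omega>. (Y k \<omega>)\<^sup>2)"
    and le: "\<And>k. (\<integral>\<omega>. (Y k \<omega>)\<^sup>2 \<partial>M) \<le> C / (real (Suc k))\<^sup>2"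
  shows "AE \<omega> in M. (\<lambda>k. Y k \<omega>) \<longlonglongrightarrow> 0"
proof -
  note [measurable] = Y(1)
  have "summable (\<lambda>k. 1 / (real (Suc k))\<^sup>2)"
    using inverse_power_summable[of 2, where 'a = real] by (subst summable_Suc_iff) (simp add: inverse_eq_divide)
  from summable_mult[OF this, of C] have sC: "summable (\<lambda>k. C / (real (Suc k))\<^sup>2)"
    unfolding times_divide_eq_right mult_1_right .
  have C: "0 \<le> C" using order_trans[OF Bochner_Integration.integral_nonneg le[of 0]] by simp
  have "(\<integral>\<^sup>+\<omega>. (\<Sum>k. ennreal ((Y k \<omega>)\<^sup>2)) \<partial>M) = (\<Sum>k. \<integral>\<^sup>+\<omega>. ennreal ((Y k \<omega>)\<^sup>2) \<partial>M)"
    by (rule nn_integral_suminf) measurable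
  also have "\<dots> \<le> (\<Sum>k. ennreal (C / (real (Suc k))\<^sup>2))"
  proof (rule suminf_le)
    fix k
    have "(\<integral>\<^sup>+\<omega>. ennreal ((Y k \<omega>)\<^sup>2) \<partial>M) = ennreal (\<integral>\<omega>. (Y k \<omega>)\<^sup>2 \<partial>M)"
      by (rule nn_integral_eq_integral[OF Y(2)]) auto
    then show "(\<integral>\<^sup>+\<omega>. ennreal ((Y k \<omega>)\<^sup>2) \<partial>M) \<le> ennreal (C / (real (Suc k))\<^sup>2)"
      using le[of k] by (simp only: ennreal_leI)
  qed auto
  also have "\<dots> = ennreal (\<Sum>k. C / (real (Suc k))\<^sup>2)"
    using C by (intro suminf_ennreal2 sC) auto
  finally have "(\<integral>\<^sup>+\<omega>. (\<Sum>k. ennreal ((Y k \<omega>)\<^sup>2)) \<partial>M) \<noteq> \<infinity>" by (auto simp: top_unique)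
  then have "AE \<omega> in M. (\<Sum>k. ennreal ((Y k \<omega>)\<^sup>2)) \<noteq> \<infinity>"
    by (intro nn_integral_PInf_AE) auto
  then show ?thesis
  proof eventually_elim
    case (elim \<omega>)
    then have "summable (\<lambda>k. (Y k \<omega>)\<^sup>2)" by (intro summable_suminf_not_top) auto
    then have "(\<lambda>k. (Y k \<omega>)\<^sup>2) \<longlonglongrightarrow> 0" by (rule summable_LIMSEQ_zero)
    then have "(\<lambda>k. sqrt ((Y k \<omega>)\<^sup>2)) \<longlonglongrightarrow> sqrt 0" by (rule tendsto_real_sqrt)
    then show ?case by (simp add: tendsto_rabs_zero_iff)
  qed
qed

lemma ratio_Suc_tendsto: "(\<lambda>k. real (Suc k) / real (Suc (Suc k))) \<longlonglongrightarrow> 1"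
  "(\<lambda>k. real (Suc (Suc k)) / real (Suc k)) \<longlonglongrightarrow> 1"
proof -
  have "(\<lambda>k. 1 + 1 / real (Suc k)) \<longlonglongrightarrow> 1 + 0"
    by (intro tendsto_add tendsto_const LIMSEQ_Suc[OF lim_1_over_n])
  moreover have "real (Suc (Suc k)) / real (Suc k) = 1 + 1 / real (Suc k)" for k
    by (simp add: field_simps)
  ultimately show 1: "(\<lambda>k. real (Suc (Suc k)) / real (Suc k)) \<longlonglongrightarrow> 1" by simp
  have "(\<lambda>k. inverse (real (Suc (Suc k)) / real (Suc k))) \<longlonglongrightarrow> inverse 1"
    using 1 by (rule tendsto_inverse) simp
  then show "(\<lambda>k. real (Suc k) / real (Suc (Suc k))) \<longlonglongrightarrow> 1" by (simp del: of_nat_Suc)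
qed

text \<open>For \<open>x\<^sup>2 \<le> T \<le> (x + 1)\<^sup>2\<close> monotonicity bounds the
  average by those at the two squares, up to the factor \<open>((x + 1) / x)\<^sup>2\<close> or its
  inverse, which tends to 1.\<close>

lemma average_interpolation:
  fixes \<phi> :: "real \<Rightarrow> real"
  assumes mono: "\<And>s t. 0 \<le> s \<Longrightarrow> s \<le> t \<Longrightarrow> \<phi> s \<le> \<phi> t" and nonneg: "\<And>t. 0 \<le> \<phi> t"
    and lim: "(\<lambda>k. \<phi> ((real (Suc k))\<^sup>2) / (real (Suc k))\<^sup>2) \<longlonglongrightarrow> c"
  shows "((\<lambda>T. \<phi> T / T) \<longlongrightarrow> c) at_top"
proof -
  define A where "A = (\<lambda>k. \<phi> ((real (Suc k))\<^sup>2) / (real (Suc k))\<^sup>2)"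
  \<comment> \<open>Index \<open>k\<close> stands for the square of \<open>k + 1\<close>, hence the
    shift by one: \<open>Suc (k T)\<close> is the integer part of \<open>sqrt T\<close> once
    \<open>T \<ge> 1\<close>.\<close>
  define k where "k = (\<lambda>T. nat \<lfloor>sqrt T\<rfloor> - 1)"
  have k_top: "filterlim k sequentially at_top"
    unfolding filterlim_at_top
  proof
    fix Z :: nat
    show "\<forall>\<^sub>F T in at_top. Z \<le> k T"
    proof (rule eventually_mono[OF eventually_ge_at_top])
      fix T :: real assume "(real Z + 1)\<^sup>2 \<le> T"
      then have "real Z + 1 \<le> sqrt T" by (rule real_le_rsqrt)
      then have "int Z + 1 \<le> \<lfloor>sqrt T\<rfloor>" by (simp add: le_floor_iff)
      then show "Z \<le> k T" unfolding k_def by linarith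
    qed
  qed
  define lo where "lo = (\<lambda>k. A k * (real (Suc k) / real (Suc (Suc k)))\<^sup>2)"
  define up where "up = (\<lambda>k. A (Suc k) * (real (Suc (Suc k)) / real (Suc k))\<^sup>2)"
  have "lo \<longlonglongrightarrow> c * 1\<^sup>2"
    unfolding lo_def A_def by (intro tendsto_mult tendsto_power lim ratio_Suc_tendsto)
  then have lo: "((\<lambda>T. lo (k T)) \<longlongrightarrow> c) at_top"
    using filterlim_compose[OF _ k_top, of lo "nhds c"] by simp
  have "up \<longlonglongrightarrow> c * 1\<^sup>2"
    unfolding up_def A_def by (intro tendsto_mult tendsto_power LIMSEQ_Suc[OF lim] ratio_Suc_tendsto)
  then have up: "((\<lambda>T. up (k T)) \<longlongrightarrow> c) at_top"
    using filterlim_compose[OF _ k_top, of up "nhds c"] by simp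
  have between: "lo (k T) \<le> \<phi> T / T \<and> \<phi> T / T \<le> up (k T)" if T: "1 \<le> T" for T
  proof -
    have "1 \<le> sqrt T" using T by simp
    then have f: "1 \<le> \<lfloor>sqrt T\<rfloor>" by (simp add: le_floor_iff)
    then have kk: "real (Suc (k T)) = real_of_int \<lfloor>sqrt T\<rfloor>" unfolding k_def by (simp add: of_nat_diff)
    define x where "x = real (Suc (k T))"
    have x: "1 \<le> x" "x \<le> sqrt T" "sqrt T \<le> x + 1" unfolding x_def kk using f by linarith+
    have "x\<^sup>2 \<le> (sqrt T)\<^sup>2" "(sqrt T)\<^sup>2 \<le> (x + 1)\<^sup>2" using x by (intro power_mono; linarith)+
    then have xT: "x\<^sup>2 \<le> T" "T \<le> (x + 1)\<^sup>2" using T by auto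
    have x2: "0 < x\<^sup>2" "0 < (x + 1)\<^sup>2" using x by auto
    have "lo (k T) = \<phi> (x\<^sup>2) / (x + 1)\<^sup>2"
      unfolding lo_def A_def x_def[symmetric] using x by (simp add: x_def power_divide field_simps)
    also have "\<dots> \<le> \<phi> T / (x + 1)\<^sup>2" using mono[of "x\<^sup>2" T] xT x2 by (intro divide_right_mono) auto
    also have "\<dots> \<le> \<phi> T / T" using xT T x2 nonneg by (intro divide_left_mono) auto
    finally have 1: "lo (k T) \<le> \<phi> T / T" .
    have "\<phi> T / T \<le> \<phi> T / x\<^sup>2" using xT T x2 nonneg by (intro divide_left_mono) auto
    also have "\<dots> \<le> \<phi> ((x + 1)\<^sup>2) / x\<^sup>2" using mono[of T "(x + 1)\<^sup>2"] xT T by (intro divide_right_mono) auto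
    also have "\<dots> = up (k T)"
    proof -
      have "real (Suc (Suc (k T))) = x + 1" by (simp add: x_def)
      then show ?thesis unfolding up_def A_def using x x_def[symmetric] by (simp add: power_divide add.commute)
    qed
    finally show ?thesis using 1 by simp
  qed
  show ?thesis
    by (rule real_tendsto_sandwich[OF _ _ lo up]; rule eventually_mono[OF eventually_ge_at_top[of 1]]) (use between in auto)
qed

context cir
begin

definition psi_c :: real where "psi_c = 4 * (1 / (2 * b) + bet)\<^sup>2"

lemma psi_square_le:
  assumes "0 \<le> x"
  shows "(psi x)\<^sup>2 \<le> psi_c * (1 + x ^ 4)"
proof -
  define P where "P = 1 / (2 * b) + bet"
  have P: "0 \<le> P" using pos bet_pos by (simp add: P_def)
  have "0 \<le> (x - 1)\<^sup>2" by simp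
  then have "2 * x \<le> 1 + x\<^sup>2" by (simp add: power2_eq_square algebra_simps)
  then have x: "x \<le> 1 + x\<^sup>2" using assms zero_le_power2[of x] by linarith
  have "psi x \<le> (1 / (2 * b)) * (1 + x\<^sup>2) + bet * (1 + x\<^sup>2)"
    unfolding psi_def using pos bet_pos x by (intro add_mono) (auto simp: divide_right_mono)
  then have "psi x \<le> P * (1 + x\<^sup>2)" by (simp add: P_def algebra_simps)
  then have "(psi x)\<^sup>2 \<le> (P * (1 + x\<^sup>2))\<^sup>2" using psi_nonneg[OF assms] by (intro power_mono)
  also have "\<dots> = P\<^sup>2 * (1 + x\<^sup>2)\<^sup>2" by (rule power_mult_distrib)
  also have "\<dots> \<le> P\<^sup>2 * (4 * (1 + x ^ 4))"
  proof (rule mult_left_mono)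
    have "(1 + x\<^sup>2)\<^sup>2 = 1 + 2 * x\<^sup>2 + x ^ 4" by (simp add: power2_eq_square eval_nat_numeral algebra_simps)
    also have "\<dots> \<le> 4 * (1 + x ^ 4)"
    proof -
      have "0 \<le> x ^ 4" by simp
      then show ?thesis using pow_le_one_add_pow4(2)[OF assms] by argo
    qed
    finally show "(1 + x\<^sup>2)\<^sup>2 \<le> 4 * (1 + x ^ 4)" .
  qed simp
  also have "\<dots> = psi_c * (1 + x ^ 4)" by (simp add: psi_c_def P_def)
  finally show ?thesis .
qed

text \<open>Integer times are enough for the unit increments, and they are the times covered by
  \<open>m4_bounded\<close>.\<close>

lemma psi_square_moment:
  shows "integrable M (\<lambda>\<omega>. (psi (X (real n) \<omega>))\<^sup>2)"
    "(\<integral>\<omega>. (psi (X (real n) \<omega>))\<^sup>2 \<partial>M) \<le> psi_c * (1 + m4_sup)"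
proof -
  have i: "integrable M (\<lambda>\<omega>. psi_c * (1 + X (real n) \<omega> ^ 4))"
    using X4_integrable[of "real n"] by (intro integrable_mult_right Bochner_Integration.integrable_add) auto
  show i2: "integrable M (\<lambda>\<omega>. (psi (X (real n) \<omega>))\<^sup>2)"
    by (rule Bochner_Integration.integrable_bound[OF i])
      (use psi_square_le[OF X_nonneg] in \<open>auto intro!: AE_I2 intro: order_trans[OF _ abs_ge_self]\<close>)
  have "(\<integral>\<omega>. (psi (X (real n) \<omega>))\<^sup>2 \<partial>M) \<le> (\<integral>\<omega>. psi_c * (1 + X (real n) \<omega> ^ 4) \<partial>M)"
    by (rule integral_mono[OF i2 i]) (rule psi_square_le[OF X_nonneg])
  also have "\<dots> = psi_c * (1 + m4 (real n))"
    using X4_integrable[of "real n"] by (simp add: m4_def prob_space)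
  also have "\<dots> \<le> psi_c * (1 + m4_sup)"
    using m4_bounded[of n] by (intro mult_left_mono) (auto simp: psi_c_def)
  finally show "(\<integral>\<omega>. (psi (X (real n) \<omega>))\<^sup>2 \<partial>M) \<le> psi_c * (1 + m4_sup)" .
qed

abbreviation md :: "nat \<Rightarrow> 'a \<Rightarrow> real" where
  "md n \<equiv> pdiff (real n) (real n + 1)"

text \<open>The factor 3 is that of \<open>sum3_square_le\<close>. The first summand accounts for
  \<open>psi\<close> at the two end points, the second for the time integral through Jensen's
  inequality and \<open>(c - x\<^sup>2)\<^sup>2 \<le> 2 * c\<^sup>2 + 2 * x ^ 4\<close>.\<close>

definition md_c :: real where
  "md_c = 3 * (2 * (psi_c * (1 + m4_sup)) + (2 * lim_const\<^sup>2 + 2 * ((m4_sup + c4) / (2 * b))))"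

lemma sum3_square_le: "(x + y + z)\<^sup>2 \<le> 3 * (x\<^sup>2 + y\<^sup>2 + z\<^sup>2)" for x y z :: real
proof -
  have "0 \<le> (x - y)\<^sup>2 + (y - z)\<^sup>2 + (x - z)\<^sup>2" by simp
  then show ?thesis by (simp add: power2_eq_square algebra_simps)
qed

lemma md_square_moment:
  shows "integrable M (\<lambda>\<omega>. (md n \<omega>)\<^sup>2)" "(\<integral>\<omega>. (md n \<omega>)\<^sup>2 \<partial>M) \<le> md_c"
proof -
  define J where "J = (\<lambda>\<omega>. LBINT u:{real n..real n+1}. X u \<omega> ^ 4)"
  define B where "B = (\<lambda>\<omega>. 3 * ((psi (X (real (Suc n)) \<omega>))\<^sup>2 + (psi (X (real n) \<omega>))\<^sup>2 + (2 * lim_const\<^sup>2 + 2 * J \<omega>)))"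
  have J: "integrable M J" unfolding J_def by (rule path4_integrable) auto
  have iB: "integrable M B"
    unfolding B_def using J psi_square_moment(1)[of n] psi_square_moment(1)[of "Suc n"]
    by (intro integrable_mult_right Bochner_Integration.integrable_add) auto
  have le: "(md n \<omega>)\<^sup>2 \<le> B \<omega>" for \<omega>
  proof -
    have c: "set_integrable lborel {real n..real n+1} (\<lambda>u. k)" for k :: real
      by (rule set_integrable_bounded_interval[of _ _ _ "\<bar>k\<bar>"]) auto
    have X2: "set_integrable lborel {real n..real n+1} (\<lambda>u. (X u \<omega>)\<^sup>2)"
      and X4: "set_integrable lborel {real n..real n+1} (\<lambda>u. X u \<omega> ^ 4)" by (rule path_power_integrable)+
    have i1: "set_integrable lborel {real n..real n+1} (\<lambda>u. lim_const - (X u \<omega>)\<^sup>2)"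
      by (intro set_integral_diff(1) c X2)
    have sq: "(lim_const - (X u \<omega>)\<^sup>2)\<^sup>2 = (lim_const\<^sup>2 - 2 * lim_const * (X u \<omega>)\<^sup>2) + X u \<omega> ^ 4" for u
      by (simp add: power2_eq_square eval_nat_numeral algebra_simps)
    have i2: "set_integrable lborel {real n..real n+1} (\<lambda>u. (lim_const - (X u \<omega>)\<^sup>2)\<^sup>2)"
      unfolding sq by (intro set_integral_add(1) set_integral_diff(1) c X4 set_integrable_mult_right X2)
    have "(LBINT u:{real n..real n+1}. lim_const - (X u \<omega>)\<^sup>2)\<^sup>2 \<le> (LBINT u:{real n..real n+1}. (lim_const - (X u \<omega>)\<^sup>2)\<^sup>2)"
      by (rule unit_interval_integral_square_le[OF i1 i2])
    also have "\<dots> \<le> (LBINT u:{real n..real n+1}. 2 * lim_const\<^sup>2 + 2 * X u \<omega> ^ 4)"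
    proof (rule set_integral_mono[OF i2])
      show "set_integrable lborel {real n..real n+1} (\<lambda>u. 2 * lim_const\<^sup>2 + 2 * X u \<omega> ^ 4)"
        by (intro set_integral_add(1) c set_integrable_mult_right X4)
      fix u
      have "0 \<le> (lim_const + (X u \<omega>)\<^sup>2)\<^sup>2" by simp
      then show "(lim_const - (X u \<omega>)\<^sup>2)\<^sup>2 \<le> 2 * lim_const\<^sup>2 + 2 * X u \<omega> ^ 4"
        by (simp add: power2_eq_square eval_nat_numeral algebra_simps)
    qed
    also have "\<dots> = (LBINT u:{real n..real n+1}. 2 * lim_const\<^sup>2) + (LBINT u:{real n..real n+1}. 2 * X u \<omega> ^ 4)"
      by (intro set_integral_add(2) c set_integrable_mult_right X4)
    also have "\<dots> = 2 * lim_const\<^sup>2 + 2 * J \<omega>"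
      unfolding J_def by (simp add: set_lebesgue_integral_def)
    finally have I: "(LBINT u:{real n..real n+1}. lim_const - (X u \<omega>)\<^sup>2)\<^sup>2 \<le> 2 * lim_const\<^sup>2 + 2 * J \<omega>" .
    have "(md n \<omega>)\<^sup>2 \<le> 3 * ((psi (X (real n + 1) \<omega>))\<^sup>2 + (- psi (X (real n) \<omega>))\<^sup>2 + (- (LBINT u:{real n..real n+1}. lim_const - (X u \<omega>)\<^sup>2))\<^sup>2)"
      using sum3_square_le[of "psi (X (real n + 1) \<omega>)" "- psi (X (real n) \<omega>)" "- (LBINT u:{real n..real n+1}. lim_const - (X u \<omega>)\<^sup>2)"]
      by (simp add: pdiff_def)
    then show ?thesis using I by (simp add: B_def add.commute)
  qed
  show i: "integrable M (\<lambda>\<omega>. (md n \<omega>)\<^sup>2)"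
    by (rule Bochner_Integration.integrable_bound[OF iB])
      (use le in \<open>auto intro!: AE_I2 intro: order_trans[OF _ abs_ge_self]\<close>)
  have "(\<integral>\<omega>. (md n \<omega>)\<^sup>2 \<partial>M) \<le> (\<integral>\<omega>. B \<omega> \<partial>M)" by (rule integral_mono[OF i iB le])
  also have "\<dots> = 3 * ((\<integral>\<omega>. (psi (X (real (Suc n)) \<omega>))\<^sup>2 \<partial>M) + (\<integral>\<omega>. (psi (X (real n) \<omega>))\<^sup>2 \<partial>M) + (2 * lim_const\<^sup>2 + 2 * (\<integral>\<omega>. J \<omega> \<partial>M)))"
    unfolding B_def using J psi_square_moment(1)[of n] psi_square_moment(1)[of "Suc n"] by (simp add: prob_space)
  also have "\<dots> \<le> md_c"
  proof -
    have "p \<le> P \<Longrightarrow> q \<le> P \<Longrightarrow> j \<le> R \<Longrightarrow> 3 * (q + p + (c + 2 * j)) \<le> 3 * (2 * P + (c + 2 * R))"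
      for p q j c P R :: real by argo
    from this[OF psi_square_moment(2) psi_square_moment(2) expected_path4_le] show ?thesis
      unfolding md_c_def J_def .
  qed
  finally show "(\<integral>\<omega>. (md n \<omega>)\<^sup>2 \<partial>M) \<le> md_c" .
qed

text \<open>The time integral must be measurable for \<open>F v\<close>, but the joint measurability
  lemma asks for a process that is \<open>F v\<close>-measurable at all times. Stopping the path at
  \<open>v\<close> provides this without changing the values on [s,t].\<close>

lemma pdiff_F:
  assumes "s \<le> t" "t \<le> v"
  shows "pdiff s t \<in> borel_measurable (F v)"
proof -
  have "(\<lambda>z. X (min (snd z) v) (fst z)) \<in> borel_measurable (F v \<Otimes>\<^sub>M lborel)"
  proof (rule continuous_process_measurable_pair[where X = "\<lambda>u. X (min u v)"])
    show "X (min u v) \<in> borel_measurable (F v)" for u by (rule X_F') simp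
    show "continuous_on UNIV (\<lambda>u. X (min u v) \<omega>)" for \<omega>
      by (rule continuous_on_compose2[OF X_cont, of _ "\<lambda>u. min u v"]) (auto intro!: continuous_intros)
  qed
  then have [measurable]: "(\<lambda>\<omega>. LBINT u:{s..t}. lim_const - (X (min u v) \<omega>)\<^sup>2) \<in> borel_measurable (F v)"
    by (intro set_integral_measurable_pair borel_measurable_diff borel_measurable_power borel_measurable_const)
  have "(LBINT u:{s..t}. lim_const - (X (min u v) \<omega>)\<^sup>2) = (LBINT u:{s..t}. lim_const - (X u \<omega>)\<^sup>2)" for \<omega>
    using assms by (intro set_lebesgue_integral_cong) (auto simp: min_def)
  then have eq: "pdiff s t = (\<lambda>\<omega>. psi (X t \<omega>) - psi (X s \<omega>) - (LBINT u:{s..t}. lim_const - (X (min u v) \<omega>)\<^sup>2))"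
    by (simp add: pdiff_def fun_eq_iff)
  have [measurable]: "X t \<in> borel_measurable (F v)" "X s \<in> borel_measurable (F v)"
    using assms by (auto intro: X_F')
  show ?thesis unfolding eq by measurable
qed

lemma md_product_integrable: "integrable M (\<lambda>\<omega>. md j \<omega> * md n \<omega>)"
proof (rule Bochner_Integration.integrable_bound)
  show "integrable M (\<lambda>\<omega>. (md j \<omega>)\<^sup>2 + (md n \<omega>)\<^sup>2)" using md_square_moment(1)[of j] md_square_moment(1)[of n] by simp
  show "AE \<omega> in M. norm (md j \<omega> * md n \<omega>) \<le> norm ((md j \<omega>)\<^sup>2 + (md n \<omega>)\<^sup>2)"
  proof (rule AE_I2)
    fix \<omega>
    have "2 * (\<bar>md j \<omega>\<bar> * \<bar>md n \<omega>\<bar>) \<le> (md j \<omega>)\<^sup>2 + (md n \<omega>)\<^sup>2"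
      using sum_squares_bound[of "\<bar>md j \<omega>\<bar>" "\<bar>md n \<omega>\<bar>"] by simp
    moreover have "0 \<le> \<bar>md j \<omega>\<bar> * \<bar>md n \<omega>\<bar>" by simp
    ultimately show "norm (md j \<omega> * md n \<omega>) \<le> norm ((md j \<omega>)\<^sup>2 + (md n \<omega>)\<^sup>2)"
      unfolding real_norm_def abs_mult by linarith
  qed
qed measurable

text \<open>The past increment is unbounded and is truncated at height \<open>k\<close>; the product
  of the two square integrable increments dominates the passage to the limit.\<close>

lemma md_orthogonal:
  assumes "j < n"
  shows "(\<integral>\<omega>. md j \<omega> * md n \<omega> \<partial>M) = 0"
proof -
  define Z where "Z = (\<lambda>k \<omega>. max (- real k) (min (real k) (md j \<omega>)))"
  have jF: "md j \<in> borel_measurable (F (real n))" using assms by (intro pdiff_F) auto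
  have ZF: "Z k \<in> borel_measurable (F (real n))" for k
    unfolding Z_def using jF by measurable
  have "(\<lambda>k. \<integral>\<omega>. Z k \<omega> * md n \<omega> \<partial>M) \<longlonglongrightarrow> (\<integral>\<omega>. md j \<omega> * md n \<omega> \<partial>M)"
  proof (rule integral_dominated_convergence[where w = "\<lambda>\<omega>. \<bar>md j \<omega> * md n \<omega>\<bar>"])
    show "(\<lambda>\<omega>. md j \<omega> * md n \<omega>) \<in> borel_measurable M" by measurable
    show "(\<lambda>\<omega>. Z k \<omega> * md n \<omega>) \<in> borel_measurable M" for k unfolding Z_def by measurable
    show "integrable M (\<lambda>\<omega>. \<bar>md j \<omega> * md n \<omega>\<bar>)" by (rule integrable_abs[OF md_product_integrable])
    show "AE \<omega> in M. (\<lambda>k. Z k \<omega> * md n \<omega>) \<longlonglongrightarrow> md j \<omega> * md n \<omega>"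
    proof (rule AE_I2, rule tendsto_mult[OF _ tendsto_const])
      fix \<omega>
      have "\<forall>\<^sub>F k in sequentially. \<bar>md j \<omega>\<bar> \<le> real k"
        using filterlim_real_sequentially unfolding filterlim_at_top by blast
      then have "\<forall>\<^sub>F k in sequentially. Z k \<omega> = md j \<omega>"
        unfolding Z_def by eventually_elim auto
      then show "(\<lambda>k. Z k \<omega>) \<longlonglongrightarrow> md j \<omega>" by (rule tendsto_eventually)
    qed
    show "AE \<omega> in M. norm (Z k \<omega> * md n \<omega>) \<le> \<bar>md j \<omega> * md n \<omega>\<bar>" for k
    proof (rule AE_I2)
      fix \<omega>
      have "\<bar>Z k \<omega>\<bar> \<le> \<bar>md j \<omega>\<bar>" unfolding Z_def by (auto simp: min_def max_def)
      then show "norm (Z k \<omega> * md n \<omega>) \<le> \<bar>md j \<omega> * md n \<omega>\<bar>"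
        unfolding real_norm_def abs_mult by (intro mult_right_mono) auto
    qed
  qed
  moreover have "(\<integral>\<omega>. Z k \<omega> * md n \<omega> \<partial>M) = 0" for k
    by (rule pdiff_orthogonal_bounded[OF _ _ ZF, where C = "real k"]) (auto simp: Z_def)
  ultimately have "(\<lambda>k. 0 :: real) \<longlonglongrightarrow> (\<integral>\<omega>. md j \<omega> * md n \<omega> \<partial>M)" by simp
  then show ?thesis using LIMSEQ_unique[OF tendsto_const] by metis
qed

definition mart :: "nat \<Rightarrow> 'a \<Rightarrow> real" where
  "mart n \<omega> = (\<Sum>j<n. md j \<omega>)"

lemma mart_M [measurable]: "mart n \<in> borel_measurable M"
  unfolding mart_def by measurable

text \<open>Orthogonality removes the mixed term, so the second moment grows only linearly in
  \<open>n\<close>.\<close>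

lemma mart_square_moment:
  "integrable M (\<lambda>\<omega>. (mart n \<omega>)\<^sup>2) \<and> (\<integral>\<omega>. (mart n \<omega>)\<^sup>2 \<partial>M) \<le> real n * md_c"
proof (induction n)
  case (Suc n)
  have cross: "mart n \<omega> * md n \<omega> = (\<Sum>j<n. md j \<omega> * md n \<omega>)" for \<omega>
    unfolding mart_def by (rule sum_distrib_right)
  have ic: "integrable M (\<lambda>\<omega>. mart n \<omega> * md n \<omega>)"
    unfolding cross by (intro Bochner_Integration.integrable_sum md_product_integrable)
  have zc: "(\<integral>\<omega>. mart n \<omega> * md n \<omega> \<partial>M) = 0"
    unfolding cross using md_product_integrable md_orthogonal
    by (subst Bochner_Integration.integral_sum) auto
  have sq: "(mart (Suc n) \<omega>)\<^sup>2 = (mart n \<omega>)\<^sup>2 + 2 * (mart n \<omega> * md n \<omega>) + (md n \<omega>)\<^sup>2" for \<omega>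
    unfolding mart_def by (simp add: power2_sum)
  show ?case unfolding sq
    using Suc ic zc md_square_moment[of n] by (simp add: algebra_simps)
qed (simp add: mart_def)

lemma square_path_integrable: "set_integrable lborel {s..t} (\<lambda>u. (X u \<omega>)\<^sup>2)"
  by (rule path_power_integrable)

lemma mart_eq:
  "mart n \<omega> = psi (X (real n) \<omega>) - psi r0 - lim_const * real n + (LBINT u:{0..real n}. (X u \<omega>)\<^sup>2)"
proof (induction n)
  case 0
  have "(LBINT u:{0..0}. (X u \<omega>)\<^sup>2) = 0"
    using has_bochner_integral_integral_eq[OF lborel_integral_at_point[of 0 "\<lambda>u. (X u \<omega>)\<^sup>2"]]
    by (simp add: set_lebesgue_integral_def)
  then show ?case by (simp add: mart_def X_init)
next
  case (Suc n)
  have c: "set_integrable lborel {real n..real n+1} (\<lambda>u. lim_const)"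
    by (rule set_integrable_bounded_interval[of _ _ _ "\<bar>lim_const\<bar>"]) auto
  have "(LBINT u:{0..real n+1}. (X u \<omega>)\<^sup>2) = (LBINT u:{0..real n}. (X u \<omega>)\<^sup>2) + (LBINT u:{real n..real n+1}. (X u \<omega>)\<^sup>2)"
    by (rule set_integral_split_interval[OF square_path_integrable]) auto
  moreover have "(LBINT u:{real n..real n+1}. lim_const - (X u \<omega>)\<^sup>2) = lim_const - (LBINT u:{real n..real n+1}. (X u \<omega>)\<^sup>2)"
    using set_integral_diff(2)[OF c square_path_integrable] by (simp add: set_lebesgue_integral_def)
  moreover have "mart (Suc n) \<omega> = mart n \<omega> + md n \<omega>" by (simp add: mart_def)
  moreover have "real (Suc n) = real n + 1" by simp
  ultimately show ?case using Suc unfolding pdiff_def by (simp only: distrib_left)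
qed

lemma ergodic:
  "AE \<omega> in M. ((\<lambda>T. (LBINT u:{0..T}. (X u \<omega>)\<^sup>2) / T) \<longlongrightarrow> lim_const) at_top"
proof -
  define N where "N = (\<lambda>k. Suc k ^ 2)"
  have N: "real (N k) = (real (Suc k))\<^sup>2" for k by (simp add: N_def)
  have N1: "1 \<le> real (N k)" "0 < real (N k)" for k unfolding N by (auto simp del: of_nat_Suc simp: one_le_power)
  \<comment> \<open>The boundary term of \<open>psi\<close> is included in \<open>Y\<close> because
    its second moment is bounded, too. What then separates the time average from its limit is
    \<open>Y\<close> and a deterministic term tending to 0.\<close>
  define Y where "Y = (\<lambda>k \<omega>. (mart (N k) \<omega> - psi (X (real (N k)) \<omega>)) / real (N k))"
  define B where "B = psi_c * (1 + m4_sup)"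
  have "AE \<omega> in M. (\<lambda>k. Y k \<omega>) \<longlonglongrightarrow> 0"
  proof (rule AE_tendsto_zero_of_square_bound[where C = "2 * (md_c + B)"])
    show "Y k \<in> borel_measurable M" for k unfolding Y_def by measurable
    fix k
    define n where "n = N k"
    have n: "1 \<le> real n" using N1 by (simp add: n_def)
    define R where "R = (\<lambda>\<omega>. 2 * ((mart n \<omega>)\<^sup>2 + (psi (X (real n) \<omega>))\<^sup>2) / (real n)\<^sup>2)"
    have iR: "integrable M R" unfolding R_def using mart_square_moment[of n] psi_square_moment(1)[of n] by simp
    have le: "(Y k \<omega>)\<^sup>2 \<le> R \<omega>" for \<omega>
    proof -
      have "(x - y)\<^sup>2 \<le> 2 * (x\<^sup>2 + y\<^sup>2)" for x y :: real
        using zero_le_power2[of "x + y"] by (simp add: power2_eq_square algebra_simps)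
      then show ?thesis unfolding Y_def R_def n_def power_divide by (intro divide_right_mono) auto
    qed
    show i: "integrable M (\<lambda>\<omega>. (Y k \<omega>)\<^sup>2)"
    proof (rule Bochner_Integration.integrable_bound[OF iR])
      show "(\<lambda>\<omega>. (Y k \<omega>)\<^sup>2) \<in> borel_measurable M" unfolding Y_def by measurable
    qed (use le in \<open>auto intro!: AE_I2 intro: order_trans[OF _ abs_ge_self]\<close>)
    have "(\<integral>\<omega>. (Y k \<omega>)\<^sup>2 \<partial>M) \<le> (\<integral>\<omega>. R \<omega> \<partial>M)" by (rule integral_mono[OF i iR le])
    also have "\<dots> = 2 * ((\<integral>\<omega>. (mart n \<omega>)\<^sup>2 \<partial>M) + (\<integral>\<omega>. (psi (X (real n) \<omega>))\<^sup>2 \<partial>M)) / (real n)\<^sup>2"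
      unfolding R_def using mart_square_moment[of n] psi_square_moment(1)[of n] by simp
    also have "\<dots> \<le> 2 * (real n * md_c + real n * B) / (real n)\<^sup>2"
    proof -
      have "0 \<le> B" using order_trans[OF Bochner_Integration.integral_nonneg psi_square_moment(2)[of 0]] by (simp add: B_def)
      \<comment> \<open>As \<open>n \<ge> 1\<close>, the bounded moment of \<open>psi\<close> may be
        counted \<open>n\<close> times, which gives both contributions the order 1 / n after
        division.\<close>
      then have "B \<le> real n * B" using n mult_right_mono[of 1 "real n" B] by simp
      then show ?thesis using mart_square_moment[of n] psi_square_moment(2)[of n]
        unfolding B_def[symmetric] by (intro divide_right_mono) auto
    qed
    also have "\<dots> = 2 * (md_c + B) / real n" using n by (simp add: power2_eq_square field_simps)
    finally show "(\<integral>\<omega>. (Y k \<omega>)\<^sup>2 \<partial>M) \<le> 2 * (md_c + B) / (real (Suc k))\<^sup>2" by (simp only: n_def N)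
  qed
  then show ?thesis
  proof eventually_elim
    case (elim \<omega>)
    define \<phi> where "\<phi> = (\<lambda>T. LBINT u:{0..T}. (X u \<omega>)\<^sup>2)"
    have eq: "\<phi> (real (N k)) / real (N k) = Y k \<omega> + psi r0 * (1 / real (Suc k))\<^sup>2 + lim_const" for k
    proof -
      have "\<phi> (real (N k)) = (mart (N k) \<omega> - psi (X (real (N k)) \<omega>)) + psi r0 + lim_const * real (N k)"
        using mart_eq[of "N k" \<omega>] by (simp add: \<phi>_def)
      then have "\<phi> (real (N k)) / real (N k) = Y k \<omega> + psi r0 / real (N k) + lim_const"
        using N1(2)[of k] by (simp add: Y_def add_divide_distrib)
      then show ?thesis by (simp add: N power_one_over)
    qed
    have "(\<lambda>k. Y k \<omega> + psi r0 * (1 / real (Suc k))\<^sup>2 + lim_const) \<longlonglongrightarrow> 0 + psi r0 * 0\<^sup>2 + lim_const"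
      by (intro tendsto_add tendsto_mult tendsto_power tendsto_const elim LIMSEQ_Suc[OF lim_1_over_n])
    then have "(\<lambda>k. \<phi> (real (N k)) / real (N k)) \<longlonglongrightarrow> lim_const" unfolding eq by simp
    then have "(\<lambda>k. \<phi> ((real (Suc k))\<^sup>2) / (real (Suc k))\<^sup>2) \<longlonglongrightarrow> lim_const" unfolding N .
    moreover have "\<phi> s \<le> \<phi> t" if "0 \<le> s" "s \<le> t" for s t
      using set_integral_split_interval[OF square_path_integrable[of 0 t \<omega>], of s] that
        set_integral_square_nonneg[of s t "\<lambda>u. X u \<omega>"] by (simp add: \<phi>_def)
    moreover have "0 \<le> \<phi> t" for t unfolding \<phi>_def by (rule set_integral_square_nonneg)
    ultimately show ?case using average_interpolation[of \<phi> lim_const] unfolding \<phi>_def by blast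
  qed
qed

end

section \<open>Passage to a regular version of the given process\<close>

text \<open>The given solution has its path properties almost surely only. It is changed on one null
  set that contains all failures; since the augmented filtration contains the null sets, the new
  process is still adapted.\<close>

lemma cir_process_version:
  fixes M :: "'a measure" and W r :: "real \<Rightarrow> 'a \<Rightarrow> real" and a b \<sigma> r0 :: real
  assumes pos: "0 < a" "0 < b" "0 < \<sigma>" "0 < r0"
    and W: "standard_wiener_process M W" and r: "cir_process M W a b \<sigma> r0 r"
  obtains X I where "cir M W X I a b \<sigma> r0" "AE \<omega> in M. \<forall>t\<ge>0. X t \<omega> = r t \<omega>"
proof -
  interpret standard_wiener_process M W by (rule W)
  obtain I where ad: "adapted F r" and ito: "is_ito_integral M F W (\<lambda>u \<omega>. \<sigma> * sqrt (r u \<omega>)) I"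
    and ae: "AE \<omega> in M. continuous_on {0..} (\<lambda>t. r t \<omega>)" "AE \<omega> in M. r 0 \<omega> = r0"
      "AE \<omega> in M. \<forall>t\<ge>0. r t \<omega> = r0 + (LBINT u:{0..t}. a - b * r u \<omega>) + I t \<omega>"
      "AE \<omega> in M. \<forall>t\<ge>0. 0 \<le> r t \<omega>"
    using r unfolding cir_process_def strong_solution_def by blast
  have "AE \<omega> in M. continuous_on {0..} (\<lambda>t. r t \<omega>) \<and> r 0 \<omega> = r0 \<and> (\<forall>t\<ge>0. 0 \<le> r t \<omega>)"
    using ae by auto
  then obtain N where N: "{\<omega>\<in>space M. \<not> (continuous_on {0..} (\<lambda>t. r t \<omega>) \<and> r 0 \<omega> = r0 \<and> (\<forall>t\<ge>0. 0 \<le> r t \<omega>))} \<subseteq> N"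
      "N \<in> null_sets M" unfolding eventually_ae_filter by blast
  \<comment> \<open>On the exceptional set the constant \<open>r0\<close> satisfies all pathwise
    requirements, and \<open>max 0 t\<close> extends the other paths continuously to negative
    times.\<close>
  define X where "X = (\<lambda>t \<omega>. if \<omega> \<in> space M - N then r (max 0 t) \<omega> else r0)"
  have good: "continuous_on {0..} (\<lambda>t. r t \<omega>)" "r 0 \<omega> = r0" "\<And>t. 0 \<le> t \<Longrightarrow> 0 \<le> r t \<omega>"
    if "\<omega> \<in> space M - N" for \<omega> using N(1) that by auto
  have XF: "X t \<in> borel_measurable (F t')" if "max 0 t \<le> t'" for t t'
  proof -
    have "r (max 0 t) \<in> borel_measurable (F (max 0 t))" using ad by (auto simp: adapted_def)
    then have rF: "r (max 0 t) \<in> borel_measurable (F t')" using that by (rule measurable_F_mono)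
    have "{\<omega> \<in> space (F t'). \<omega> \<in> space M - N} = space (F t') - N" by auto
    moreover have "space (F t') - N \<in> sets (F t')" using sets.compl_sets[OF null_sets_F[OF N(2)], of t'] by simp
    ultimately show ?thesis unfolding X_def by (intro measurable_If rF measurable_const) auto
  qed
  have X_cont: "continuous_on UNIV (\<lambda>t. X t \<omega>)" for \<omega>
  proof (cases "\<omega> \<in> space M - N")
    case True
    have "continuous_on UNIV (\<lambda>t. r (max 0 t) \<omega>)"
      by (rule continuous_on_compose2[OF good(1)[OF True], of _ "max 0"]) (auto intro!: continuous_intros)
    then show ?thesis using True by (simp add: X_def)
  next
    case False
    then show ?thesis by (simp only: X_def if_False continuous_on_const)
  qed
  have AE_N: "AE \<omega> in M. \<omega> \<in> space M - N" using AE_not_in[OF N(2)] AE_space by eventually_elim auto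
  then have eq: "AE \<omega> in M. \<forall>t\<ge>0. X t \<omega> = r t \<omega>"
    by eventually_elim (auto simp: X_def max_def)
  have XM: "X t \<in> borel_measurable M" for t by (rule measurable_F_M[OF XF[OF order_refl]])
  have "cir M W X I a b \<sigma> r0"
  proof (unfold_locales)
    show "X t \<in> borel_measurable (F t)" if "0 \<le> t" for t using that by (intro XF) auto
    show "X t \<omega> = r0" if "t \<le> 0" for t \<omega> using that good(2)[of \<omega>] by (auto simp: X_def max_def)
    show "0 \<le> X t \<omega>" for t \<omega> using good(3)[of \<omega> "max 0 t"] pos by (auto simp: X_def)
    show "AE \<omega> in M. \<forall>t\<ge>0. X t \<omega> = r0 + (LBINT u:{0..t}. a - b * X u \<omega>) + I t \<omega>"
      using eq ae(3)
    proof eventually_elim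
      case (elim \<omega>)
      have "(LBINT u:{0..t}. a - b * X u \<omega>) = (LBINT u:{0..t}. a - b * r u \<omega>)" for t
        using elim(1) by (intro set_lebesgue_integral_cong) auto
      then show ?case using elim by simp
    qed
    fix t :: real assume "0 \<le> t"
    then obtain n s \<xi> where sp: "\<And>k::nat. simple_process F (n k) (s k) (\<xi> k)"
      and A: "tendsto_in_probability M
        (\<lambda>k \<omega>. LBINT u:{0..t}. (simple_value (n k) (s k) (\<xi> k) u \<omega> - \<sigma> * sqrt (r u \<omega>))\<^sup>2) (\<lambda>_. 0)"
      and B: "tendsto_in_probability M (\<lambda>k. simple_integral_process W (n k) (s k) (\<xi> k) t) (I t)"
      using ito unfolding is_ito_integral_def by blast
    have "tendsto_in_probability M
        (\<lambda>k \<omega>. LBINT u:{0..t}. (simple_value (n k) (s k) (\<xi> k) u \<omega> - \<sigma> * sqrt (X u \<omega>))\<^sup>2) (\<lambda>_. 0)"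
    \<comment> \<open>The integrals for \<open>X\<close> and \<open>r\<close> coincide almost
      surely, but measurability is part of \<open>tendsto_in_probability\<close> and has to be
      established for the version.\<close>
    proof (rule tendsto_in_probability_zero_le[OF A A, of _ 1])
      fix k
      show "(\<lambda>\<omega>. LBINT u:{0..t}. (simple_value (n k) (s k) (\<xi> k) u \<omega> - \<sigma> * sqrt (X u \<omega>))\<^sup>2) \<in> borel_measurable M"
      proof (rule set_integral_measurable_pair)
        have [measurable]: "(\<lambda>z. simple_value (n k) (s k) (\<xi> k) (snd z) (fst z)) \<in> borel_measurable (M \<Otimes>\<^sub>M lborel)"
          by (rule simple_value_measurable_pair) (use simple_processD(3)[OF sp] measurable_F_M in auto)
        have [measurable]: "(\<lambda>z. X (snd z) (fst z)) \<in> borel_measurable (M \<Otimes>\<^sub>M lborel)"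
          by (rule continuous_process_measurable_pair[OF XM X_cont])
        show "(\<lambda>z. (simple_value (n k) (s k) (\<xi> k) (snd z) (fst z) - \<sigma> * sqrt (X (snd z) (fst z)))\<^sup>2) \<in> borel_measurable (M \<Otimes>\<^sub>M lborel)"
          by measurable
      qed
      show "AE \<omega> in M. \<bar>LBINT u:{0..t}. (simple_value (n k) (s k) (\<xi> k) u \<omega> - \<sigma> * sqrt (X u \<omega>))\<^sup>2\<bar> \<le>
        1 * (\<bar>LBINT u:{0..t}. (simple_value (n k) (s k) (\<xi> k) u \<omega> - \<sigma> * sqrt (r u \<omega>))\<^sup>2\<bar> +
          \<bar>LBINT u:{0..t}. (simple_value (n k) (s k) (\<xi> k) u \<omega> - \<sigma> * sqrt (r u \<omega>))\<^sup>2\<bar>)"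
        using eq
      proof eventually_elim
        case (elim \<omega>)
        have "(LBINT u:{0..t}. (simple_value (n k) (s k) (\<xi> k) u \<omega> - \<sigma> * sqrt (X u \<omega>))\<^sup>2) =
          (LBINT u:{0..t}. (simple_value (n k) (s k) (\<xi> k) u \<omega> - \<sigma> * sqrt (r u \<omega>))\<^sup>2)"
          using elim by (intro set_lebesgue_integral_cong) auto
        then show ?case by simp
      qed
    qed simp
    then show "\<exists>n s \<xi>. (\<forall>k::nat. simple_process F (n k) (s k) (\<xi> k)) \<and>
      tendsto_in_probability M
        (\<lambda>k \<omega>. LBINT u:{0..t}. (simple_value (n k) (s k) (\<xi> k) u \<omega> - \<sigma> * sqrt (X u \<omega>))\<^sup>2) (\<lambda>_. 0) \<and>
      tendsto_in_probability M (\<lambda>k. simple_integral_process W (n k) (s k) (\<xi> k) t) (I t)"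
      using sp B by blast
  qed (use pos X_cont in auto)
  with eq show ?thesis by (intro that)
qed

theorem theorem7:
  fixes M :: "'a measure" and W r :: "real \<Rightarrow> 'a \<Rightarrow> real" and a b \<sigma> r0 :: real
  assumes "0 < a" and "0 < b" and "0 < \<sigma>" and "0 < r0"
    and "standard_wiener_process M W"
    and "cir_process M W a b \<sigma> r0 r"
  shows "AE \<omega> in M.
    ((\<lambda>T. (1 / T) * (LBINT t:{0..T}. (r t \<omega>)\<^sup>2)) \<longlongrightarrow> a\<^sup>2 / b\<^sup>2 + a * \<sigma>\<^sup>2 / (2 * b\<^sup>2)) at_top"
proof -
  obtain X I where X: "cir M W X I a b \<sigma> r0" and eq: "AE \<omega> in M. \<forall>t\<ge>0. X t \<omega> = r t \<omega>"
    by (rule cir_process_version[OF assms]) (rule that)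
  interpret cir M W X I a b \<sigma> r0 by (rule X)
  show ?thesis
    using ergodic eq
  proof eventually_elim
    case (elim \<omega>)
    have "(LBINT t:{0..T}. (r t \<omega>)\<^sup>2) = (LBINT t:{0..T}. (X t \<omega>)\<^sup>2)" for T
      using elim(2) by (intro set_lebesgue_integral_cong) auto
    then show ?case using elim(1) by (simp add: lim_const_def)
  qed
qed

end
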